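(* Let $h$ be a positive integer. Then: (1) For every multiplicative complement $(A_1,\ldots,A_h)$ of order $h$, we have $$\limsup_{x\to\infty}\max\{A_1(x),\ldots,A_h(x)\}\frac{(\log x)^{1-\frac1h}}{x}\ge\frac{1}{\Gamma\left(\frac1h\right)}.$$ (2) There exists a multiplicative complement $(A_1,\ldots,A_h)$ of order $h$ for which $$\lim_{x\to\infty}\max\{A_1(x),\ldots,A_h(x)\}\frac{(\log x)^{1-\frac1h}}{x}=\frac{1}{\Gamma\left(\frac1h\right)}.$$
   Context: $\mathbb{Z}^+$ denotes the set of positive integers, $\log$ the natural logarithm, and $\Gamma$ the Euler gamma function. For $A\subseteq\mathbb{Z}^+$, the counting function is $A(x)=|\{a\in A:a\le x\}|$. An $h$-tuple $(A_1,\ldots,A_h)$ of subsets of $\mathbb{Z}^+$ is a multiplicative complement of order $h$ if every positive integer can be written in the form $a_1\cdots a_h$ with $a_i\in A_i$ for all $1\le i\le h$. A limsup may equal $+\infty$. *)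

theory Defs
  imports "HOL-Analysis.Analysis"
begin

definition counting_function :: "nat set \<Rightarrow> real \<Rightarrow> nat" where
  "counting_function A x = card {a \<in> A. real a \<le> x}"

(* An h-tuple of sets is a function on the index set {1..h};
   its values at other indices play no role. *)
definition multiplicative_complement :: "nat \<Rightarrow> (nat \<Rightarrow> nat set) \<Rightarrow> bool" where
  "multiplicative_complement h A \<longleftrightarrow>
     (\<forall>i\<in>{1..h}. A i \<subseteq> {0<..}) \<and>
     (\<forall>n>0. \<exists>a. (\<forall>i\<in>{1..h}. a i \<in> A i) \<and> n = (\<Prod>i=1..h. a i))"

(* Meaningful for h \<ge> 1, where Max is taken over a nonempty set. *)
definition max_counting :: "nat \<Rightarrow> (nat \<Rightarrow> nat set) \<Rightarrow> real \<Rightarrow> nat" where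
  "max_counting h A x = Max ((\<lambda>i. counting_function (A i) x) ` {1..h})"

end

theory Submission
  imports Defs "HOL-Number_Theory.Prime_Powers" "HOL-Real_Asymp.Real_Asymp"
begin

text \<open>
  Write $\kappa = 1/h$. For the lower bound, multiply out the Dirichlet series
  $F_i(s) = \sum_{a \in A_i} a^{-s}$: since every integer is a product $a_1 \cdots a_h$, one has
  $\prod_i F_i(s) \ge \zeta(s) \ge 1/(s-1)$ for $s > 1$. If all counting functions were eventually at most
  $c\,x (\log x)^{\kappa-1}$ with $c < 1/\Gamma(\kappa)$, partial summation would give
  $F_i(s) \le c\,\Gamma(\kappa)(s-1)^{-\kappa} (1+o(1))$ as $s \to 1$, a contradiction.

  For the construction, split the primes into $h$ classes and let $A_i$ consist of the integers composed
  of primes of class $i$. The classes are chosen greedily, each prime going to the class with the least sum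
  of the weights $-\log(1-1/p)$. The discrepancy between the classes then tends to $0$, which gives
  $F_i(s) \sim (s-1)^{-\kappa}$, and Karamata's theorem yields
  $\sum_{a \in A_i, a \le x} 1/a \sim (\log x)^{\kappa}/\Gamma(\kappa+1)$. To pass from this logarithmic
  average to the counting function without the prime number theorem, use
  $\sum_{a \le x} \log a = \sum_{a \le x} \psi_i(x/a)$, where $a$ runs through $A_i$ and $\psi_i$ is the
  Chebyshev function of class $i$. The greedy choice gives even $\psi_i = \kappa\psi + o(x)$, and
  $\psi(y) - y + 1 + \gamma$ has such small sums over all $y = x/m$ that sieving them down to
  $m \in A_i$ costs only $O(x)$; hence $\sum_{a \le x} \psi(x/a) = x \sum_{a \le x} 1/a + O(x)$.
\<close>

section \<open>Dirichlet series and the lower bound\<close>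

text \<open>When the primes are split into classes, the product of the \<open>h\<close> Dirichlet
  series is exactly zeta. If F_i ~ c_i (s-1)^(-1/h), the c_i multiply to 1 and the largest counting
  function overshoots the bound by the factor max c_i, so optimality forces every c_i = 1. This is
  why the balanced weights are the logarithms of the Euler factors at s = 1 and not 1/p: they fix
  the limits themselves, not just the orders of growth.

  Karamata's theorem controls sums of 1/a only, and such an asymptotic cannot be differentiated.
  Counting needs Chebyshev information on each class, for which a discrepancy tending to 0 is too
  weak: trading weights of size 1/p for log p costs a factor p log p, so the discrepancy must be
  o(1/log n). The greedy rule achieves this because it forgets old imbalance: a class that has
  received a prime after m leads any other by at most about 1/m.

  An error O(x) in the identity for the sum of log a is affordable because the main term has order x
  (log x)^(1/h); hence averages of psi(y) - y suffice.\<close>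

lemma powr_neg_telescope:
  fixes x d :: real
  assumes "x > 0" "d > 0"
  shows "(x + 1) powr -(1 + d) \<le> (x powr -d - (x + 1) powr -d) / d"
    and "(x powr -d - (x + 1) powr -d) / d \<le> x powr -(1 + d)"
proof -
  have "\<exists>z>x. z < x + 1 \<and> (x + 1) powr -d - x powr -d = (x + 1 - x) * (-d * z powr (-d - 1))"
    using assms by (intro MVT2) (auto intro!: derivative_eq_intros simp: powr_diff)
  then obtain z where z: "z > x" "z < x + 1"
    "(x + 1) powr -d - x powr -d = - (d * z powr (-d - 1))" by auto
  have "(x powr -d - (x + 1) powr -d) / d = z powr -(1 + d)"
  proof -
    have "-d - 1 = -(1 + d)" by simp
    with z(3) have "x powr -d - (x + 1) powr -d = d * z powr -(1 + d)" by simp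
    then show ?thesis using assms by simp
  qed
  moreover have "(x + 1) powr -(1 + d) \<le> z powr -(1 + d)" "z powr -(1 + d) \<le> x powr -(1 + d)"
    using z assms by (intro powr_mono2'; simp)+
  ultimately show "(x + 1) powr -(1 + d) \<le> (x powr -d - (x + 1) powr -d) / d"
    "(x powr -d - (x + 1) powr -d) / d \<le> x powr -(1 + d)" by simp_all
qed

lemma zeta_partial_sum_ge:
  assumes "d > 0"
  shows "(1 - (real N + 1) powr -d) / d \<le> (\<Sum>n=1..N. real n powr -(1 + d))"
proof (induction N)
  case (Suc N)
  have "(1 - (real (Suc N) + 1) powr -d) / d =
      (1 - (real N + 1) powr -d) / d + ((real (Suc N)) powr -d - (real (Suc N) + 1) powr -d) / d"
    using assms by (simp add: field_simps)
  then show ?case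
    using Suc powr_neg_telescope(2)[of "real (Suc N)" d] assms by simp
qed simp

lemma zeta_partial_sum_le:
  assumes "d > 0"
  shows "(\<Sum>n=1..N. real n powr -(1 + d)) \<le> 1 + 1 / d"
proof -
  have "(\<Sum>n=1..Suc N. real n powr -(1 + d)) \<le> 1 + (1 - (real (Suc N)) powr -d) / d" for N
  proof (induction N)
    case (Suc N)
    have "1 + (1 - (real (Suc (Suc N))) powr -d) / d =
      1 + (1 - (real (Suc N)) powr -d) / d + ((real (Suc N)) powr -d - (real (Suc N) + 1) powr -d) / d"
      using assms by (simp add: field_simps)
    then show ?case
      using Suc powr_neg_telescope(1)[of "real (Suc N)" d] assms by (simp add: add_ac)
  qed simp
  moreover have "1 + (1 - (real N) powr -d) / d \<le> 1 + 1 / d" for N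
    using assms by (simp add: divide_right_mono)
  ultimately have "(\<Sum>n=1..Suc N. real n powr -(1 + d)) \<le> 1 + 1 / d" for N
    using order_trans by blast
  moreover have "(\<Sum>n=1..N. real n powr -(1 + d)) \<le> (\<Sum>n=1..Suc N. real n powr -(1 + d))"
    by (intro sum_mono2) auto
  ultimately show ?thesis using order_trans by blast
qed

section \<open>Laplace integrals of counting functions\<close>

lemma nn_integral_gamma_scaled:
  fixes a k :: real
  assumes "a > 0" "k > 0"
  shows "(\<integral>\<^sup>+u. ennreal (indicator {0..} u * (u powr (k - 1) * exp (-(a * u)))) \<partial>lborel)
           = ennreal (Gamma k * a powr -k)"
proof -
  let ?f = "\<lambda>u::real. indicator {0..} u * (u powr (k - 1) * exp (-(a * u)))"
  have "ennreal (Gamma k) = (\<integral>\<^sup>+t. ennreal (indicator {0..} t * t powr (k - 1) / exp t) \<partial>lborel)"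
    by (rule Gamma_conv_nn_integral_real) fact
  also have "\<dots> = ennreal \<bar>a\<bar> * (\<integral>\<^sup>+t. ennreal (indicator {0..} (0 + a * t) * (0 + a * t) powr (k - 1) / exp (0 + a * t)) \<partial>lborel)"
    using assms by (intro nn_integral_real_affine) auto
  also have "(\<lambda>t. ennreal (indicator {0..} (0 + a * t) * (0 + a * t) powr (k - 1) / exp (0 + a * t))) =
     (\<lambda>t. ennreal (a powr (k - 1)) * ennreal (?f t))"
    using assms by (auto simp: fun_eq_iff indicator_def powr_mult exp_minus field_simps
        zero_le_mult_iff simp flip: ennreal_mult)
  also have "(\<integral>\<^sup>+t. ennreal (a powr (k - 1)) * ennreal (?f t) \<partial>lborel) = ennreal (a powr (k - 1)) * (\<integral>\<^sup>+t. ennreal (?f t) \<partial>lborel)"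
    by (rule nn_integral_cmult) measurable
  finally have *: "ennreal (Gamma k) = ennreal (a powr k) * (\<integral>\<^sup>+t. ennreal (?f t) \<partial>lborel)"
    using assms by (simp add: powr_diff mult.assoc[symmetric] flip: ennreal_mult)
  have "ennreal (Gamma k * a powr -k) = ennreal (a powr -k) * ennreal (Gamma k)"
    using assms by (subst mult.commute, subst ennreal_mult') auto
  also have "\<dots> = ennreal (a powr -k * a powr k) * (\<integral>\<^sup>+t. ennreal (?f t) \<partial>lborel)"
    unfolding * by (simp add: ennreal_mult' mult.assoc)
  also have "a powr -k * a powr k = 1" using assms by (simp flip: powr_add)
  finally show ?thesis by simp
qed

text \<open>With \<open>t = ln a\<close> this writes \<open>a powr -s\<close> as an integral over
  \<open>u \<ge> ln a\<close>; summing over \<open>a\<close> under the integral produces the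
  counting function.\<close>

lemma nn_integral_exp_tail:
  fixes s t :: real
  assumes "s > 0"
  shows "(\<integral>\<^sup>+u. ennreal (s * exp (-(s * u))) * indicator {t..} u \<partial>lborel) = ennreal (exp (-(s * t)))"
proof -
  have "((\<lambda>u. - exp (-(s * u))) \<longlongrightarrow> 0) at_top" using assms by real_asymp
  then have "(\<integral>\<^sup>+u. ennreal (s * exp (-(s * u))) * indicator {t..} u \<partial>lborel) = ennreal (0 - (- exp (-(s * t))))"
    using assms by (intro nn_integral_FTC_atLeast) (auto intro!: derivative_eq_intros)
  then show ?thesis by simp
qed

text \<open>Partial summation in the variable $u = \ln x$.\<close>
lemma sum_powr_conv_nn_integral:
  fixes s :: real
  assumes "finite B" "B \<subseteq> {0<..}" "s > 0"
  shows "ennreal (\<Sum>a\<in>B. real a powr -s) =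
    (\<integral>\<^sup>+u. ennreal (indicator {0..} u * (s * exp (-(s * u)) * real (card {a\<in>B. real a \<le> exp u}))) \<partial>lborel)"
proof -
  have "ennreal (\<Sum>a\<in>B. real a powr -s) = (\<Sum>a\<in>B. ennreal (real a powr -s))"
    by (rule sum_ennreal[symmetric]) simp
  also have "\<dots> = (\<Sum>a\<in>B. (\<integral>\<^sup>+u. ennreal (s * exp (-(s * u))) * indicator {ln (real a)..} u \<partial>lborel))"
    using assms by (intro sum.cong refl) (auto simp: nn_integral_exp_tail powr_def)
  also have "\<dots> = (\<integral>\<^sup>+u. (\<Sum>a\<in>B. ennreal (s * exp (-(s * u))) * indicator {ln (real a)..} u) \<partial>lborel)"
    by (rule nn_integral_sum[symmetric]) measurable
  also have "\<dots> = (\<integral>\<^sup>+u. ennreal (indicator {0..} u * (s * exp (-(s * u)) * real (card {a\<in>B. real a \<le> exp u}))) \<partial>lborel)"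
  proof (rule nn_integral_cong)
    fix u :: real
    have le_iff: "ln (real a) \<le> u \<longleftrightarrow> real a \<le> exp u" if "a \<in> B" for a
    proof -
      have "real a > 0" using that assms(2) by auto
      then show ?thesis by (metis exp_gt_zero ln_exp ln_le_cancel_iff)
    qed
    have "(\<Sum>a\<in>B. ennreal (s * exp (-(s * u))) * indicator {ln (real a)..} u)
        = (\<Sum>a\<in>B. ennreal (s * exp (-(s * u)) * indicator {a. real a \<le> exp u} a))"
      using le_iff by (intro sum.cong refl) (auto simp: indicator_def)
    also have "\<dots> = ennreal (\<Sum>a\<in>B. s * exp (-(s * u)) * indicator {a. real a \<le> exp u} a)"
      using assms by (intro sum_ennreal) auto
    also have "(\<Sum>a\<in>B. s * exp (-(s * u)) * indicator {a. real a \<le> exp u} a) = s * exp (-(s * u)) * real (card {a\<in>B. real a \<le> exp u})"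
      using assms(1) by (simp add: sum_distrib_left[symmetric] sum.If_cases indicator_def Int_def)
    also have "\<dots> = indicator {0..} u * (s * exp (-(s * u)) * real (card {a\<in>B. real a \<le> exp u}))"
    proof (cases "u \<ge> 0")
      \<comment> \<open>Elements are at least 1, so nothing is counted for \<open>u < 0\<close> and
        the restriction to the half-line is free.\<close>
      case False
      have "{a\<in>B. real a \<le> exp u} = {}"
      proof -
        have "real a > exp u" if "a \<in> B" for a
        proof -
          have "exp u < 1" using False by simp
          also have "1 \<le> real a" using that assms(2) by auto
          finally show ?thesis .
        qed
        then show ?thesis by (auto simp: not_le)
      qed
      then have "card {a\<in>B. real a \<le> exp u} = 0" by (metis card.empty)
      then show ?thesis by simp
    qed auto
    finally show "(\<Sum>a\<in>B. ennreal (s * exp (-(s * u))) * indicator {ln (real a)..} u) =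
      ennreal (indicator {0..} u * (s * exp (-(s * u)) * real (card {a\<in>B. real a \<le> exp u})))" .
  qed
  finally show ?thesis .
qed

lemma card_nat_real_le:
  assumes "B \<subseteq> {0<..}" "x \<ge> 0"
  shows "finite {a\<in>B. real a \<le> x}" "real (card {a\<in>B. real a \<le> x}) \<le> x"
proof -
  have sub: "{a\<in>B. real a \<le> x} \<subseteq> {1..nat \<lfloor>x\<rfloor>}" using assms by (auto simp: le_nat_floor dest!: subsetD)
  then show "finite {a\<in>B. real a \<le> x}" by (rule finite_subset) simp
  have "card {a\<in>B. real a \<le> x} \<le> nat \<lfloor>x\<rfloor>" using card_mono[OF _ sub] by simp
  then show "real (card {a\<in>B. real a \<le> x}) \<le> x" using assms(2) by linarith
qed

text \<open>The integral is cut at \<open>U\<close>: below it the trivial count \<open>exp u\<close>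
  contributes at most \<open>U * exp U\<close>, above it the hypothesis produces a Gamma integral.
  The bound does not involve \<open>B\<close>, so it serves all truncations of an infinite set at
  once.\<close>

lemma sum_powr_le_of_card_le:
  fixes c k U d :: real
  assumes "finite B" "B \<subseteq> {0<..}" "d > 0" "k > 0" "c \<ge> 0" "U \<ge> 0"
  assumes le: "\<And>u. u \<ge> U \<Longrightarrow> real (card {a\<in>B. real a \<le> exp u}) \<le> c * exp u * u powr (k - 1)"
  shows "(\<Sum>a\<in>B. real a powr -(1 + d)) \<le> (1 + d) * (U * exp U + c * (Gamma k * d powr -k))"
proof -
  let ?N = "\<lambda>u. real (card {a\<in>B. real a \<le> exp u})"
  have pt: "indicator {0..} u * ((1 + d) * exp (-((1 + d) * u)) * ?N u) \<le>
      (1 + d) * exp U * indicator {0..U} u + (1 + d) * c * (indicator {0..} u * (u powr (k - 1) * exp (-(d * u))))"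
    for u :: real
  proof (cases "u \<ge> 0")
    case u: True
    show ?thesis
    proof (cases "u \<le> U")
      case True
      have "?N u \<le> exp u" using assms(2) by (intro card_nat_real_le) auto
      also have "exp u \<le> exp U" using True by simp
      finally have "exp (-((1 + d) * u)) * ?N u \<le> 1 * exp U"
        using u assms by (intro mult_mono) auto
      then have "(1 + d) * (exp (-((1 + d) * u)) * ?N u) \<le> (1 + d) * exp U"
        using assms by (intro mult_left_mono) auto
      moreover have "0 \<le> (1 + d) * c * (u powr (k - 1) * exp (-(d * u)))" using assms by simp
      ultimately show ?thesis using True u by (simp add: mult.assoc)
    next
      case False
      have "(1 + d) * exp (-((1 + d) * u)) * ?N u \<le> (1 + d) * exp (-((1 + d) * u)) * (c * exp u * u powr (k - 1))"
        using False assms by (intro mult_left_mono le) auto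
      also have "\<dots> = (1 + d) * c * (u powr (k - 1) * (exp (-((1 + d) * u)) * exp u))"
        by (simp add: mult_ac)
      also have "exp (-((1 + d) * u)) * exp u = exp (-(d * u))"
        by (simp add: algebra_simps flip: exp_add)
      finally show ?thesis using False u by (simp add: mult.assoc)
    qed
  qed auto
  have "ennreal (\<Sum>a\<in>B. real a powr -(1 + d)) =
     (\<integral>\<^sup>+u. ennreal (indicator {0..} u * ((1 + d) * exp (-((1 + d) * u)) * ?N u)) \<partial>lborel)"
    using assms by (intro sum_powr_conv_nn_integral) auto
  also have "\<dots> \<le> (\<integral>\<^sup>+u. (ennreal ((1 + d) * exp U) * indicator {0..U} u + ennreal ((1 + d) * c) *
        ennreal (indicator {0..} u * (u powr (k - 1) * exp (-(d * u))))) \<partial>lborel)"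
  proof (rule nn_integral_mono)
    fix u :: real
    have "ennreal (indicator {0..} u * ((1 + d) * exp (-((1 + d) * u)) * ?N u)) \<le>
        ennreal ((1 + d) * exp U * indicator {0..U} u + (1 + d) * c * (indicator {0..} u * (u powr (k - 1) * exp (-(d * u)))))"
      using pt by (rule ennreal_leI)
    also have "\<dots> = ennreal ((1 + d) * exp U) * indicator {0..U} u + ennreal ((1 + d) * c) *
        ennreal (indicator {0..} u * (u powr (k - 1) * exp (-(d * u))))"
      using assms by (subst ennreal_plus) (auto simp: ennreal_mult' ennreal_indicator)
    finally show "ennreal (indicator {0..} u * ((1 + d) * exp (-((1 + d) * u)) * ?N u)) \<le> \<dots>" .
  qed
  also have "\<dots> = (\<integral>\<^sup>+u. ennreal ((1 + d) * exp U) * indicator {0..U} u \<partial>lborel) +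
      (\<integral>\<^sup>+u. ennreal ((1 + d) * c) * ennreal (indicator {0..} u * (u powr (k - 1) * exp (-(d * u)))) \<partial>lborel)"
    by (rule nn_integral_add) measurable
  also have "(\<integral>\<^sup>+u. ennreal ((1 + d) * exp U) * indicator {0..U} u \<partial>lborel) = ennreal ((1 + d) * exp U * U)"
    using assms by (simp add: nn_integral_cmult ennreal_mult')
  also have "(\<integral>\<^sup>+u. ennreal ((1 + d) * c) * ennreal (indicator {0..} u * (u powr (k - 1) * exp (-(d * u)))) \<partial>lborel)
     = ennreal ((1 + d) * c) * ennreal (Gamma k * d powr -k)"
    using assms by (subst nn_integral_cmult) (auto simp: nn_integral_gamma_scaled)
  also have "\<dots> = ennreal ((1 + d) * c * (Gamma k * d powr -k))"
    using assms by (subst ennreal_mult') (auto simp: mult.assoc)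
  also have "ennreal ((1 + d) * exp U * U) + \<dots> = ennreal ((1 + d) * (U * exp U + c * (Gamma k * d powr -k)))"
    using assms by (subst ennreal_plus[symmetric]) (auto simp: algebra_simps Gamma_real_pos less_imp_le)
  finally show ?thesis
    using assms by (subst (asm) ennreal_le_iff) (auto intro!: mult_nonneg_nonneg add_nonneg_nonneg simp: Gamma_real_pos less_imp_le)
qed

text \<open>One factorisation is chosen for each \<open>n \<le> N\<close>. The choice is injective
  because the product recovers \<open>n\<close>, and all factors divide \<open>n\<close>, so the
  chosen tuples are distinct terms of the expanded product of truncated sums.\<close>

lemma prod_dirichlet_sums_ge:
  fixes s :: real
  assumes "multiplicative_complement h A"
  shows "(\<Sum>n=1..N. real n powr -s) \<le> (\<Prod>i=1..h. \<Sum>a\<in>A i \<inter> {..N}. real a powr -s)"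
proof -
  have A: "A i \<subseteq> {0<..}" if "i \<in> {1..h}" for i
    using assms that by (auto simp: multiplicative_complement_def)
  have "\<forall>n>0. \<exists>a. (\<forall>i\<in>{1..h}. a i \<in> A i) \<and> n = (\<Prod>i=1..h. a i)"
    using assms by (auto simp: multiplicative_complement_def)
  then obtain f where f: "\<And>n i. n > 0 \<Longrightarrow> i \<in> {1..h} \<Longrightarrow> f n i \<in> A i"
    "\<And>n. n > 0 \<Longrightarrow> n = (\<Prod>i=1..h. f n i)" by metis
  \<comment> \<open>\<open>restrict\<close> puts the tuple into \<open>PiE\<close>, whose members
    are \<open>undefined\<close> off the index set.\<close>
  define g where "g n = restrict (f n) {1..h}" for n
  have prod_g: "(\<Prod>i=1..h. g n i) = n" if "n > 0" for n
    using f(2)[OF that] by (simp add: g_def)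
  have "(\<Sum>n=1..N. real n powr -s) = (\<Sum>n=1..N. \<Prod>i=1..h. real (g n i) powr -s)"
  proof (rule sum.cong[OF refl])
    fix n assume "n \<in> {1..N}"
    then have "real n = (\<Prod>i=1..h. real (g n i))" using prod_g[of n] by (simp flip: of_nat_prod)
    then show "real n powr -s = (\<Prod>i=1..h. real (g n i) powr -s)"
      by (simp add: prod_powr_distrib)
  qed
  also have "\<dots> = (\<Sum>x\<in>g ` {1..N}. \<Prod>i=1..h. real (x i) powr -s)"
  proof (subst sum.reindex)
    show "inj_on g {1..N}"
      by (rule inj_on_inverseI[where g = "\<lambda>x. \<Prod>i=1..h. x i"]) (metis prod_g atLeastAtMost_iff less_le_trans zero_less_one)
  qed simp
  also have "\<dots> \<le> (\<Sum>x\<in>PiE {1..h} (\<lambda>i. A i \<inter> {..N}). \<Prod>i=1..h. real (x i) powr -s)"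
  proof (rule sum_mono2)
    show "g ` {1..N} \<subseteq> PiE {1..h} (\<lambda>i. A i \<inter> {..N})"
    proof safe
      fix n i assume n: "n \<in> {1..N}" and i: "i \<in> {1..h}"
      show "g n i \<in> A i" using f(1) n i by (simp add: g_def)
      have "g n i dvd n" using prod_g[of n] n dvd_prodI[of "{1..h}" i "g n"] i by auto
      then show "g n i \<le> N" using n dvd_imp_le[of "g n i" n] by auto
    qed (auto simp: g_def)
  qed (auto intro!: finite_PiE prod_nonneg)
  also have "\<dots> = (\<Prod>i=1..h. \<Sum>a\<in>A i \<inter> {..N}. real a powr -s)"
    by (rule prod_sum_PiE[symmetric]) auto
  finally show ?thesis .
qed

theorem limsup_max_counting_ge:
  assumes h: "h \<ge> 1" and A: "multiplicative_complement h A"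
  shows "Limsup at_top (\<lambda>x::real. ereal (real (max_counting h A x) * (ln x powr (1 - 1 / real h) / x)))
           \<ge> ereal (1 / Gamma (1 / real h))"
proof (rule ccontr)
  define k where "k = 1 / real h"
  have k: "k > 0" using h by (simp add: k_def)
  have G: "Gamma k > 0" using k by (rule Gamma_real_pos)
  define f where "f x = real (max_counting h A x) * (ln x powr (1 - k) / x)" for x
  assume "\<not> ?thesis"
  then have "Limsup at_top (\<lambda>x. ereal (f x)) < ereal (1 / Gamma k)" by (simp add: k_def f_def)
  \<comment> \<open>The maximum with 0 forces the intermediate constant \<open>c\<close> to be
    positive.\<close>
  then have "max 0 (Limsup at_top (\<lambda>x. ereal (f x))) < ereal (1 / Gamma k)" using G by simp
  then obtain c where c: "max 0 (Limsup at_top (\<lambda>x. ereal (f x))) < ereal c" "ereal c < ereal (1 / Gamma k)"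
    using ereal_dense2 by blast
  then have c: "c > 0" "c * Gamma k < 1" and "Limsup at_top (\<lambda>x. ereal (f x)) < ereal c"
    using G by (auto simp: field_simps)
  then have "eventually (\<lambda>x. ereal (f x) < ereal c) at_top" using Limsup_lessD by blast
  then obtain X where X: "\<And>x. x \<ge> X \<Longrightarrow> f x < c" by (auto simp: eventually_at_top_linorder)
  \<comment> \<open>\<open>U \<ge> 1\<close> keeps \<open>u\<close> positive, so that
    \<open>u powr (1 - k)\<close> is nonzero.\<close>
  define U where "U = max 1 (ln (max 1 X))"
  have "X \<le> exp (ln (max 1 X))" by simp
  also have "\<dots> \<le> exp U" by (simp only: U_def exp_le_cancel_iff max.cobounded2)
  finally have "exp U \<ge> X" .
  moreover have "U \<ge> 1" unfolding U_def by (rule max.cobounded1)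
  ultimately have U: "exp U \<ge> X" "U \<ge> 1" by blast+
  have Apos: "A i \<subseteq> {0<..}" if "i \<in> {1..h}" for i
    using A that by (auto simp: multiplicative_complement_def)
  have count: "real (card {a\<in>A i \<inter> {..N}. real a \<le> exp u}) \<le> c * exp u * u powr (k - 1)"
    if "u \<ge> U" "i \<in> {1..h}" for u i N
  proof -
    have u: "u > 0" using that U by linarith
    have "card {a\<in>A i \<inter> {..N}. real a \<le> exp u} \<le> counting_function (A i) (exp u)"
      unfolding counting_function_def using that Apos by (intro card_mono card_nat_real_le) auto
    also have "\<dots> \<le> max_counting h A (exp u)"
      unfolding max_counting_def using that by (intro Max_ge) auto
    finally have *: "real (card {a\<in>A i \<inter> {..N}. real a \<le> exp u}) \<le> real (max_counting h A (exp u))" by simp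
    have "exp u \<ge> exp U" using that by simp
    then have "f (exp u) < c" using U(1) by (intro X) linarith
    then have "real (max_counting h A (exp u)) \<le> c * exp u / u powr (1 - k)"
      using u by (simp add: f_def field_simps)
    also have "\<dots> = c * exp u * u powr (k - 1)"
      using u by (simp add: powr_diff field_simps)
    finally show ?thesis using * by linarith
  qed
  define K where "K = U * exp U"
  \<comment> \<open>Letting \<open>N\<close> grow turns the lower bound for zeta into
    \<open>1 / d \<le> R ^ h\<close>. Since \<open>(d powr k) ^ h = d\<close>, scaling by
    \<open>d powr k\<close> removes the singularity. The contribution \<open>K\<close> of the range
    below \<open>U\<close> dies as \<open>d\<close> tends to 0, leaving
    \<open>(c * Gamma k) ^ h < 1\<close>.\<close>
  have main: "1 \<le> ((1 + d) * (K * d powr k + c * Gamma k)) ^ h" if d: "d > 0" for d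
  proof -
    define R where "R = (1 + d) * (K + c * (Gamma k * d powr -k))"
    have R0: "R \<ge> 0" unfolding R_def K_def using d U c G by (intro mult_nonneg_nonneg add_nonneg_nonneg) auto
    have "(1 - (real N + 1) powr -d) / d \<le> R ^ h" for N
    proof -
      have "(1 - (real N + 1) powr -d) / d \<le> (\<Sum>n=1..N. real n powr -(1 + d))"
        by (rule zeta_partial_sum_ge) fact
      also have "\<dots> \<le> (\<Prod>i=1..h. \<Sum>a\<in>A i \<inter> {..N}. real a powr -(1 + d))"
        by (rule prod_dirichlet_sums_ge) fact
      also have "\<dots> \<le> (\<Prod>i=1..h. R)"
      proof (intro prod_mono conjI)
        fix i assume i: "i \<in> {1..h}"
        show "(\<Sum>a\<in>A i \<inter> {..N}. real a powr -(1 + d)) \<le> R"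
          unfolding R_def K_def
        proof (rule sum_powr_le_of_card_le)
          show "A i \<inter> {..N} \<subseteq> {0<..}" using Apos[OF i] by blast
        qed (use i d k c U count in simp_all)
      qed (simp add: sum_nonneg)
      finally show ?thesis by simp
    qed
    moreover have "(\<lambda>N. (1 - (real N + 1) powr -d) / d) \<longlonglongrightarrow> (1 - 0) / d"
    proof (intro tendsto_intros)
      show "(\<lambda>N. (real N + 1) powr -d) \<longlonglongrightarrow> 0" using d by real_asymp
    qed (use d in auto)
    ultimately have "1 / d \<le> R ^ h"
      by (intro LIMSEQ_le_const2[where X = "\<lambda>N. (1 - (real N + 1) powr -d) / d"]) auto
    moreover have "(d powr k) ^ h = d"
      using d h by (simp add: k_def powr_power)
    ultimately have "1 \<le> (R * d powr k) ^ h"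
      using d by (simp add: power_mult_distrib field_simps)
    also have "R * d powr k = (1 + d) * (K * d powr k + c * Gamma k * (d powr -k * d powr k))"
      by (simp add: R_def algebra_simps)
    also have "d powr -k * d powr k = 1" using d by (simp flip: powr_add)
    finally show ?thesis by simp
  qed
  have "((\<lambda>d. ((1 + d) * (K * d powr k + c * Gamma k)) ^ h) \<longlongrightarrow> ((1 + 0) * (K * 0 + c * Gamma k)) ^ h) (at_right 0)"
  proof (intro tendsto_intros)
    show "((\<lambda>d. d powr k) \<longlongrightarrow> 0) (at_right 0)" using k by real_asymp
  qed
  moreover have "\<forall>\<^sub>F d in at_right 0. 1 \<le> ((1 + d) * (K * d powr k + c * Gamma k)) ^ h"
    using main by (auto simp: eventually_at_filter)
  ultimately have "1 \<le> ((1 + 0) * (K * 0 + c * Gamma k)) ^ h"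
    by (rule tendsto_lowerbound) simp
  moreover have "(c * Gamma k) ^ h < 1"
    using c G h power_less_one_iff[of "c * Gamma k" h] by simp
  ultimately show False by simp
qed

section \<open>Karamata's Tauberian theorem\<close>

text \<open>The Gamma distribution of shape \<open>k\<close> and rate 1, the limit law of the
  averages \<open>T\<close> below.\<close>

definition gamma_measure :: "real \<Rightarrow> real measure" where
  "gamma_measure k = density lborel (\<lambda>t. ennreal (indicator {0..} t * (t powr (k - 1) * exp (-t)) / Gamma k))"

lemma sets_gamma_measure [simp, measurable_cong]: "sets (gamma_measure k) = sets borel"
  by (simp add: gamma_measure_def)

lemma space_gamma_measure [simp]: "space (gamma_measure k) = UNIV"
  by (simp add: gamma_measure_def)

lemma nn_integral_gamma_measure:
  assumes "f \<in> borel_measurable borel" "k > 0"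
  shows "(\<integral>\<^sup>+t. ennreal (f t) \<partial>gamma_measure k) =
    (\<integral>\<^sup>+t. ennreal (indicator {0..} t * (t powr (k - 1) * exp (-t)) / Gamma k * f t) \<partial>lborel)"
  unfolding gamma_measure_def using assms Gamma_real_pos[of k]
  by (subst nn_integral_density) (auto simp flip: ennreal_mult' intro!: nn_integral_cong)

text \<open>For natural \<open>a\<close> these are the moments of \<open>exp (-t)\<close>, which is
  all that polynomial test functions see; \<open>a = 0\<close> gives total mass 1.\<close>

lemma gamma_measure_exp:
  assumes "k > 0" "a \<ge> 0"
  shows "has_bochner_integral (gamma_measure k) (\<lambda>t. exp (-(a * t))) ((1 + a) powr -k)"
proof (rule has_bochner_integral_nn_integral)
  have "(\<integral>\<^sup>+t. ennreal (exp (-(a * t))) \<partial>gamma_measure k) =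
    (\<integral>\<^sup>+t. ennreal (indicator {0..} t * (t powr (k - 1) * exp (-t)) / Gamma k * exp (-(a * t))) \<partial>lborel)"
    using assms by (intro nn_integral_gamma_measure) measurable
  also have "\<dots> = (\<integral>\<^sup>+t. ennreal (1 / Gamma k) * ennreal (indicator {0..} t * (t powr (k - 1) * exp (-((1 + a) * t)))) \<partial>lborel)"
    using assms Gamma_real_pos[of k]
    by (intro nn_integral_cong) (auto simp: exp_add[symmetric] algebra_simps mult_exp_exp indicator_def simp flip: ennreal_mult')
  also have "\<dots> = ennreal (1 / Gamma k) * ennreal (Gamma k * (1 + a) powr -k)"
    using assms by (subst nn_integral_cmult) (auto simp: nn_integral_gamma_scaled)
  also have "\<dots> = ennreal ((1 + a) powr -k)"
    using assms Gamma_real_pos[of k] by (subst ennreal_mult'[symmetric]) (auto simp: less_imp_neq[symmetric])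
  finally show "(\<integral>\<^sup>+t. ennreal (exp (-(a * t))) \<partial>gamma_measure k) = ennreal ((1 + a) powr -k)" .
qed (use assms in auto)

lemma finite_measure_gamma_measure:
  assumes "k > 0"
  shows "finite_measure (gamma_measure k)" "measure (gamma_measure k) UNIV = 1"
proof -
  have "(\<integral>\<^sup>+t. ennreal (exp (-(0 * t))) \<partial>gamma_measure k) = ennreal ((1 + 0) powr -k)"
    using gamma_measure_exp[OF assms, of 0] by (intro nn_integral_eq_integral[THEN trans])
      (auto simp: has_bochner_integral_iff)
  then have "emeasure (gamma_measure k) UNIV = 1"
    using nn_integral_const[of "gamma_measure k" 1] by simp
  then show "finite_measure (gamma_measure k)" "measure (gamma_measure k) UNIV = 1"
    by (auto intro!: finite_measureI simp: measure_def)
qed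

text \<open>The factor \<open>exp t\<close> cancels the exponential of the density, leaving
  \<open>t powr (k - 1)\<close> on \<open>{0..c}\<close>; \<open>k * Gamma k = Gamma (k + 1)\<close>
  then gives the constant of the Tauberian theorem.\<close>

lemma gamma_measure_exp_cutoff:
  assumes "k > 0" "c > 0"
  shows "(\<integral>\<^sup>+t. ennreal (exp t * indicator {..c} t) \<partial>gamma_measure k) = ennreal (c powr k / Gamma (k + 1))"
proof -
  have G: "Gamma k > 0" using assms by (simp add: Gamma_real_pos)
  have int: "((\<lambda>t. t powr (k - 1)) has_integral (c powr k / k)) {0..c}"
    using has_integral_powr_from_0[of "k - 1" c] assms by simp
  have "(\<integral>\<^sup>+t. ennreal (exp t * indicator {..c} t) \<partial>gamma_measure k) =
    (\<integral>\<^sup>+t. ennreal (indicator {0..} t * (t powr (k - 1) * exp (-t)) / Gamma k * (exp t * indicator {..c} t)) \<partial>lborel)"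
    using assms by (intro nn_integral_gamma_measure) measurable
  also have "\<dots> = (\<integral>\<^sup>+t. ennreal (1 / Gamma k) * ennreal (indicator {0..c} t * t powr (k - 1)) \<partial>lborel)"
    using G by (intro nn_integral_cong) (auto simp: exp_minus indicator_def simp flip: ennreal_mult')
  also have "\<dots> = ennreal (1 / Gamma k) * (\<integral>\<^sup>+t. ennreal (indicator {0..c} t * t powr (k - 1)) \<partial>lborel)"
    by (rule nn_integral_cmult) measurable
  also have "(\<integral>\<^sup>+t. ennreal (indicator {0..c} t * t powr (k - 1)) \<partial>lborel) = ennreal (c powr k / k)"
  proof (rule nn_integral_has_integral_lborel)
    have "(\<lambda>t. indicator {0..c} t * t powr (k - 1)) = (\<lambda>t. if t \<in> {0..c} then t powr (k - 1) else 0)"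
      by (auto simp: fun_eq_iff)
    then show "((\<lambda>t. indicator {0..c} t * t powr (k - 1)) has_integral c powr k / k) UNIV"
      using int by (simp only: has_integral_restrict_UNIV)
  qed auto
  also have "ennreal (1 / Gamma k) * \<dots> = ennreal (c powr k / (k * Gamma k))"
    using assms G by (subst ennreal_mult'[symmetric]) (auto simp: field_simps)
  also have "k * Gamma k = Gamma (k + 1)"
    using assms by (subst Gamma_plus1) auto
  finally show ?thesis .
qed

text \<open>Masses \<open>b n\<close> at points \<open>l n\<close> whose Laplace transform behaves
  like \<open>d powr -k\<close> at 0. The application takes \<open>b n = 1 / n\<close> on a
  semigroup and \<open>l n = ln n\<close>, so \<open>d\<close> is the distance of the Dirichlet
  series variable from 1.\<close>

locale karamata =
  fixes b l :: "nat \<Rightarrow> real" and k :: real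
  assumes k_pos: "k > 0"
    and b_nonneg: "b n \<ge> 0"
    and l_nonneg: "l n \<ge> 0"
    and summable_laplace: "d > 0 \<Longrightarrow> summable (\<lambda>n. b n * exp (-(d * l n)))"
    and laplace_limit: "((\<lambda>d. d powr k * (\<Sum>n. b n * exp (-(d * l n)))) \<longlongrightarrow> 1) (at_right 0)"
begin

text \<open>Karamata's device: \<open>g\<close> is tested at \<open>x = exp (-(d * l n))\<close>,
  where a monomial merely rescales \<open>d\<close>. The additional weight \<open>x\<close> makes
  the sums converge for every bounded \<open>g\<close>, with total mass tending to 1.\<close>

definition T :: "real \<Rightarrow> (real \<Rightarrow> real) \<Rightarrow> real" where
  "T d g = d powr k * (\<Sum>n. b n * exp (-(d * l n)) * g (exp (-(d * l n))))"

definition I :: "(real \<Rightarrow> real) \<Rightarrow> real" where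
  "I g = (\<integral>t. g (exp (-t)) \<partial>gamma_measure k)"

lemma exp_in_unit: "d > 0 \<Longrightarrow> exp (-(d * l n)) \<in> {0..1}"
  using l_nonneg[of n] by simp

lemma T_summable:
  assumes "d > 0" "\<And>x. x \<in> {0..1} \<Longrightarrow> \<bar>g x\<bar> \<le> C"
  shows "summable (\<lambda>n. b n * exp (-(d * l n)) * g (exp (-(d * l n))))"
proof (rule summable_comparison_test'[where N = 0])
  show "summable (\<lambda>n. C * (b n * exp (-(d * l n))))"
    using summable_laplace[OF assms(1)] by (rule summable_mult)
  fix n
  have "\<bar>b n * exp (-(d * l n))\<bar> * \<bar>g (exp (-(d * l n)))\<bar> \<le> \<bar>b n * exp (-(d * l n))\<bar> * C"
    using assms exp_in_unit by (intro mult_left_mono) auto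
  then show "norm (b n * exp (-(d * l n)) * g (exp (-(d * l n)))) \<le> C * (b n * exp (-(d * l n)))"
    using b_nonneg[of n] by (simp add: abs_mult mult.commute)
qed

lemma T_diff_le:
  assumes "d > 0" "\<And>x. x \<in> {0..1} \<Longrightarrow> \<bar>g x\<bar> \<le> C" "\<And>x. x \<in> {0..1} \<Longrightarrow> \<bar>q x\<bar> \<le> C'"
    "\<And>x. x \<in> {0..1} \<Longrightarrow> \<bar>g x - q x\<bar> \<le> e"
  shows "\<bar>T d g - T d q\<bar> \<le> e * (d powr k * (\<Sum>n. b n * exp (-(d * l n))))"
proof -
  let ?E = "\<lambda>n. exp (-(d * l n))"
  have e: "e \<ge> 0" using assms(4)[of 0] by simp
  have sg: "summable (\<lambda>n. b n * ?E n * g (?E n))" and sq: "summable (\<lambda>n. b n * ?E n * q (?E n))"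
    using T_summable assms by blast+
  have bound: "norm (b n * ?E n * g (?E n) - b n * ?E n * q (?E n)) \<le> e * (b n * ?E n)" for n
  proof -
    have "b n * ?E n * \<bar>g (?E n) - q (?E n)\<bar> \<le> b n * ?E n * e"
      using assms exp_in_unit b_nonneg by (intro mult_left_mono) auto
    then show ?thesis using b_nonneg[of n] by (simp add: abs_mult mult_ac flip: right_diff_distrib)
  qed
  have "T d g - T d q = d powr k * (\<Sum>n. b n * ?E n * g (?E n) - b n * ?E n * q (?E n))"
    unfolding T_def using suminf_diff[OF sg sq] by (simp add: algebra_simps)
  then have "\<bar>T d g - T d q\<bar> = \<bar>d powr k * (\<Sum>n. b n * ?E n * g (?E n) - b n * ?E n * q (?E n))\<bar>"
    by (rule arg_cong)
  also have "\<dots> = d powr k * \<bar>\<Sum>n. b n * ?E n * g (?E n) - b n * ?E n * q (?E n)\<bar>"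
    unfolding abs_mult by simp
  also have "\<dots> \<le> d powr k * (\<Sum>n. e * (b n * ?E n))"
  proof (rule mult_left_mono)
    have "norm (\<Sum>n. b n * ?E n * g (?E n) - b n * ?E n * q (?E n)) \<le> (\<Sum>n. e * (b n * ?E n))"
      by (rule norm_suminf_le[OF bound summable_mult[OF summable_laplace[OF assms(1)]]])
    then show "\<bar>\<Sum>n. b n * ?E n * g (?E n) - b n * ?E n * q (?E n)\<bar> \<le> (\<Sum>n. e * (b n * ?E n))" by simp
  qed simp
  also have "\<dots> = e * (d powr k * (\<Sum>n. b n * ?E n))"
    by (simp add: suminf_mult[OF summable_laplace[OF assms(1)]])
  finally show ?thesis .
qed

lemma I_diff_le:
  assumes "continuous_on UNIV g" "continuous_on UNIV q" "\<And>x. x \<in> {0..1} \<Longrightarrow> \<bar>g x\<bar> \<le> C"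
    "\<And>x. x \<in> {0..1} \<Longrightarrow> \<bar>q x\<bar> \<le> C'" "\<And>x. x \<in> {0..1} \<Longrightarrow> \<bar>g x - q x\<bar> \<le> e"
  shows "\<bar>I g - I q\<bar> \<le> e"
proof -
  interpret finite_measure "gamma_measure k" by (rule finite_measure_gamma_measure) (rule k_pos)
  \<comment> \<open>The law lives on \<open>t \<ge> 0\<close>, so bounds on the unit interval
    suffice.\<close>
  have ae: "AE t in gamma_measure k. exp (-t) \<in> {0..1}"
    unfolding gamma_measure_def by (subst AE_density) (auto simp: indicator_def)
  have int: "integrable (gamma_measure k) (\<lambda>t. f (exp (-t)))"
    if "continuous_on UNIV f" "\<And>x. x \<in> {0..1} \<Longrightarrow> \<bar>f x\<bar> \<le> c" for f :: "real \<Rightarrow> real" and c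
  proof (rule integrable_const_bound[where B = c])
    show "AE t in gamma_measure k. norm (f (exp (-t))) \<le> c" using ae by eventually_elim (use that in auto)
    show "(\<lambda>t. f (exp (-t))) \<in> borel_measurable (gamma_measure k)"
      using that(1) by (rule borel_measurable_continuous_on) (simp add: gamma_measure_def)
  qed
  have ig: "integrable (gamma_measure k) (\<lambda>t. g (exp (-t)))" and iq: "integrable (gamma_measure k) (\<lambda>t. q (exp (-t)))"
    using int assms by blast+
  have "I g - I q = (\<integral>t. g (exp (-t)) - q (exp (-t)) \<partial>gamma_measure k)"
    unfolding I_def using ig iq by simp
  then have "\<bar>I g - I q\<bar> = \<bar>\<integral>t. g (exp (-t)) - q (exp (-t)) \<partial>gamma_measure k\<bar>"
    by (rule arg_cong)
  also have "\<dots> \<le> (\<integral>t. \<bar>g (exp (-t)) - q (exp (-t))\<bar> \<partial>gamma_measure k)"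
    using integral_norm_bound[of "gamma_measure k" "\<lambda>t. g (exp (-t)) - q (exp (-t))"] by simp
  also have "\<dots> \<le> (\<integral>t. e \<partial>gamma_measure k)"
  proof (rule integral_mono_AE)
    show "AE t in gamma_measure k. \<bar>g (exp (-t)) - q (exp (-t))\<bar> \<le> e"
      using ae by eventually_elim (use assms(5) in auto)
  qed (use ig iq in auto)
  also have "\<dots> = e" using finite_measure_gamma_measure(2)[OF k_pos] by simp
  finally show ?thesis .
qed

text \<open>\<open>exp (-(d * l n)) ^ (i + 1)\<close> is the Laplace kernel at
  \<open>(1 + i) * d\<close>, so rescaling \<open>laplace_limit\<close> gives
  \<open>(1 + i) powr -k\<close>, the corresponding moment of the Gamma law.\<close>

lemma T_power_limit: "((\<lambda>d. T d (\<lambda>x. x ^ i)) \<longlongrightarrow> I (\<lambda>x. x ^ i)) (at_right 0)"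
proof -
  let ?c = "1 + real i"
  have "I (\<lambda>x. x ^ i) = ?c powr -k"
    using gamma_measure_exp[OF k_pos, of "real i"] unfolding I_def
    by (simp add: exp_of_nat_mult[symmetric] has_bochner_integral_iff)
  moreover have "((\<lambda>d. ?c powr -k * ((?c * d) powr k * (\<Sum>n. b n * exp (-((?c * d) * l n))))) \<longlongrightarrow> ?c powr -k * 1) (at_right 0)"
  proof (intro tendsto_mult tendsto_const filterlim_compose[OF laplace_limit])
    show "filterlim (\<lambda>d. ?c * d) (at_right 0) (at_right 0)" by real_asymp
  qed
  moreover have "\<forall>\<^sub>F d in at_right 0. ?c powr -k * ((?c * d) powr k * (\<Sum>n. b n * exp (-((?c * d) * l n)))) = T d (\<lambda>x. x ^ i)"
    unfolding eventually_at_filter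
  proof (intro always_eventually allI impI)
    fix d :: real assume "d \<noteq> 0" "d \<in> {0<..}"
    then have d: "d > 0" by simp
    have "exp (-((?c * d) * l n)) = exp (-(d * l n)) * exp (-(d * l n)) ^ i" for n
      by (simp add: exp_of_nat_mult[symmetric] algebra_simps flip: exp_add)
    moreover have "?c powr -k * (?c * d) powr k = d powr k"
    proof -
      have "(?c * d) powr k = ?c powr k * d powr k" using d by (intro powr_mult)
      then show ?thesis by (simp add: powr_minus)
    qed
    ultimately show "?c powr -k * ((?c * d) powr k * (\<Sum>n. b n * exp (-((?c * d) * l n)))) = T d (\<lambda>x. x ^ i)"
      by (simp add: T_def mult.assoc[symmetric])
  qed
  ultimately show ?thesis using tendsto_cong by force
qed

lemma T_poly_limit:
  "((\<lambda>d. T d (\<lambda>x. \<Sum>i\<le>m. a i * x ^ i)) \<longlongrightarrow> I (\<lambda>x. \<Sum>i\<le>m. a i * x ^ i)) (at_right 0)"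
proof -
  have "I (\<lambda>x. \<Sum>i\<le>m. a i * x ^ i) = (\<Sum>i\<le>m. a i * I (\<lambda>x. x ^ i))"
  proof -
    have "integrable (gamma_measure k) (\<lambda>t. exp (-t) ^ i)" for i
      using gamma_measure_exp[OF k_pos, of "real i"]
      by (simp add: exp_of_nat_mult[symmetric] has_bochner_integral_iff)
    then show ?thesis unfolding I_def by (subst Bochner_Integration.integral_sum) auto
  qed
  moreover have "\<forall>\<^sub>F d in at_right 0. (\<Sum>i\<le>m. a i * T d (\<lambda>x. x ^ i)) = T d (\<lambda>x. \<Sum>i\<le>m. a i * x ^ i)"
    unfolding eventually_at_filter
  proof (intro always_eventually allI impI)
    fix d :: real assume "d \<noteq> 0" "d \<in> {0<..}"
    then have d: "d > 0" by simp
    let ?E = "\<lambda>n. exp (-(d * l n))"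
    have sm: "summable (\<lambda>n. b n * ?E n * ?E n ^ i)" for i
      using d by (intro T_summable[where g = "\<lambda>x. x ^ i" and C = 1]) (auto simp: power_le_one)
    have "(\<Sum>i\<le>m. a i * T d (\<lambda>x. x ^ i)) = d powr k * (\<Sum>i\<le>m. \<Sum>n. a i * (b n * ?E n * ?E n ^ i))"
      using sm by (subst suminf_mult) (auto simp: T_def sum_distrib_left mult_ac)
    also have "(\<Sum>i\<le>m. \<Sum>n. a i * (b n * ?E n * ?E n ^ i)) = (\<Sum>n. \<Sum>i\<le>m. a i * (b n * ?E n * ?E n ^ i))"
      using sm by (intro suminf_sum[symmetric] summable_mult)
    finally show "(\<Sum>i\<le>m. a i * T d (\<lambda>x. x ^ i)) = T d (\<lambda>x. \<Sum>i\<le>m. a i * x ^ i)"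
      by (simp add: T_def sum_distrib_left mult_ac)
  qed
  moreover have "((\<lambda>d. \<Sum>i\<le>m. a i * T d (\<lambda>x. x ^ i)) \<longlongrightarrow> (\<Sum>i\<le>m. a i * I (\<lambda>x. x ^ i))) (at_right 0)"
    by (intro tendsto_intros T_power_limit)
  ultimately show ?thesis using tendsto_cong by force
qed

lemma T_continuous_limit:
  assumes g: "continuous_on UNIV g"
  shows "((\<lambda>d. T d g) \<longlongrightarrow> I g) (at_right 0)"
proof (rule tendstoI)
  fix e :: real assume e: "e > 0"
  have "continuous_on {0..1} g" using g continuous_on_subset by blast
  \<comment> \<open>Budget: the total mass is eventually below 2, so replacing \<open>g\<close> by
    \<open>q\<close> costs at most \<open>e / 2\<close> in \<open>T\<close> and \<open>e / 4\<close>
    in \<open>I\<close>; convergence for \<open>q\<close> takes the last quarter.\<close>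
  then obtain q where "real_polynomial_function q" and q: "\<And>x. x \<in> {0..1} \<Longrightarrow> \<bar>g x - q x\<bar> < e / 4"
    using Stone_Weierstrass_real_polynomial_function[of "{0..1}" g "e / 4"] e by auto
  then obtain a m where qa: "q = (\<lambda>x. \<Sum>i\<le>m. a i * x ^ i)"
    by (auto simp: real_polynomial_function_iff_sum)
  have cq: "continuous_on UNIV q" unfolding qa by (intro continuous_intros)
  have bd: "\<exists>C. \<forall>x\<in>{0..1}. \<bar>f x\<bar> \<le> C" if "continuous_on UNIV f" for f :: "real \<Rightarrow> real"
  proof -
    have "compact (f ` {0..1})"
      using that continuous_on_subset by (intro compact_continuous_image) auto
    from compact_imp_bounded[OF this] show ?thesis by (auto simp: bounded_iff)
  qed
  obtain C where C: "\<And>x. x \<in> {0..1} \<Longrightarrow> \<bar>g x\<bar> \<le> C" using bd[OF g] by blast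
  obtain C' where C': "\<And>x. x \<in> {0..1} \<Longrightarrow> \<bar>q x\<bar> \<le> C'" using bd[OF cq] by blast
  have I: "\<bar>I g - I q\<bar> \<le> e / 4"
    using q by (intro I_diff_le[OF g cq C C']) (auto intro: less_imp_le)
  have "\<forall>\<^sub>F d in at_right 0. dist (T d q) (I q) < e / 4"
    using T_poly_limit[of a m] e unfolding qa by (intro tendstoD) auto
  moreover have "\<forall>\<^sub>F d in at_right 0. d powr k * (\<Sum>n. b n * exp (-(d * l n))) < 2"
    using laplace_limit by (rule order_tendstoD) simp
  moreover have "\<forall>\<^sub>F d in at_right (0::real). d > 0" by (simp add: eventually_at_right_less)
  ultimately show "\<forall>\<^sub>F d in at_right 0. dist (T d g) (I g) < e"
  proof eventually_elim
    case (elim d)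
    have "\<bar>T d g - T d q\<bar> \<le> e / 4 * (d powr k * (\<Sum>n. b n * exp (-(d * l n))))"
      using q by (intro T_diff_le[OF elim(3) C C']) (auto intro: less_imp_le)
    also have "\<dots> \<le> e / 4 * 2" using elim(2) e by (intro mult_left_mono) auto
    finally show ?case using I elim(1) e unfolding dist_real_def by linarith
  qed
qed

text \<open>A continuous function lying between $1_{x \ge \beta}/x$ and $1_{x \ge \alpha}/x$.\<close>
definition ramp :: "real \<Rightarrow> real \<Rightarrow> real \<Rightarrow> real" where
  "ramp \<alpha> \<beta> x = max 0 (min 1 ((x - \<alpha>) / (\<beta> - \<alpha>))) / max x \<alpha>"

lemma ramp:
  assumes "0 < \<alpha>" "\<alpha> < \<beta>"
  shows "continuous_on UNIV (ramp \<alpha> \<beta>)" "ramp \<alpha> \<beta> x \<ge> 0"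
    "x > 0 \<Longrightarrow> x * ramp \<alpha> \<beta> x \<le> indicator {\<alpha>..} x" "x > 0 \<Longrightarrow> x * ramp \<alpha> \<beta> x \<ge> indicator {\<beta>..} x"
proof -
  have ramp_eq: "ramp \<alpha> \<beta> = (\<lambda>x. max 0 (min 1 ((x - \<alpha>) / (\<beta> - \<alpha>))) / max x \<alpha>)"
    by (rule ext) (rule ramp_def)
  have nz: "\<forall>x\<in>UNIV. max x \<alpha> \<noteq> 0" using assms by (metis max.strict_coboundedI2 order_less_irrefl)
  show "continuous_on UNIV (ramp \<alpha> \<beta>)"
    unfolding ramp_eq using assms nz
    by (intro continuous_on_divide continuous_on_max continuous_on_min continuous_on_const
        continuous_on_diff continuous_on_id) simp_all
  define c where "c = max 0 (min 1 ((x - \<alpha>) / (\<beta> - \<alpha>)))"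
  have c: "0 \<le> c" "c \<le> 1" by (simp_all add: c_def)
  have r: "ramp \<alpha> \<beta> x = c / max x \<alpha>" by (simp only: ramp_def c_def)
  show nonneg: "ramp \<alpha> \<beta> x \<ge> 0"
    unfolding r using c assms by (intro divide_nonneg_nonneg) (simp_all add: max.coboundedI2)
  have val: "x * ramp \<alpha> \<beta> x = c" if "x > 0" "x \<ge> \<alpha>"
    using that by (simp add: r max_absorb1)
  show "x * ramp \<alpha> \<beta> x \<le> indicator {\<alpha>..} x" if "x > 0"
  proof (cases "x \<ge> \<alpha>")
    case True
    then show ?thesis using val that c by simp
  next
    case False
    then have "(x - \<alpha>) / (\<beta> - \<alpha>) \<le> 0" using assms by (intro divide_nonpos_nonneg) simp_all
    then have "c = 0" by (simp add: c_def min.coboundedI2 max_absorb1)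
    then show ?thesis by (simp add: r)
  qed
  show "x * ramp \<alpha> \<beta> x \<ge> indicator {\<beta>..} x" if "x > 0"
  proof (cases "x \<ge> \<beta>")
    case True
    then have "(x - \<alpha>) / (\<beta> - \<alpha>) \<ge> 1" using assms by simp
    then have "c = 1" by (simp add: c_def min_absorb1)
    then show ?thesis using val that assms True by simp
  next
    case False
    then show ?thesis using that nonneg by simp
  qed
qed

lemma nn_integral_I:
  assumes "continuous_on UNIV g" "\<And>x. g x \<ge> 0" "\<And>x. x \<in> {0..1} \<Longrightarrow> g x \<le> C"
  shows "(\<integral>\<^sup>+t. ennreal (g (exp (-t))) \<partial>gamma_measure k) = ennreal (I g)"
  unfolding I_def
proof (rule nn_integral_eq_integral)
  interpret finite_measure "gamma_measure k" by (rule finite_measure_gamma_measure) (rule k_pos)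
  show "integrable (gamma_measure k) (\<lambda>t. g (exp (-t)))"
  proof (rule integrable_const_bound[where B = C])
    have "AE t in gamma_measure k. exp (-t) \<in> {0..1}"
      unfolding gamma_measure_def by (subst AE_density) (auto simp: indicator_def)
    then show "AE t in gamma_measure k. norm (g (exp (-t))) \<le> C"
      by eventually_elim (use assms in auto)
    show "(\<lambda>t. g (exp (-t))) \<in> borel_measurable (gamma_measure k)"
      using assms(1) by (rule borel_measurable_continuous_on) (simp add: gamma_measure_def)
  qed
qed (use assms in auto)

text \<open>At \<open>x = exp (-t)\<close> the ramp vanishes for \<open>t > t1\<close> and equals
  \<open>exp t\<close> for \<open>t \<le> t2\<close>, so its integral lies between two cutoff
  integrals.\<close>

lemma I_ramp:
  assumes "0 < t2" "t2 < t1"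
  shows "I (ramp (exp (-t1)) (exp (-t2))) \<le> t1 powr k / Gamma (k + 1)"
    "t2 powr k / Gamma (k + 1) \<le> I (ramp (exp (-t1)) (exp (-t2)))"
proof -
  let ?g = "ramp (exp (-t1)) (exp (-t2))"
  have r: "0 < exp (-t1)" "exp (-t1) < exp (-t2)" using assms by auto
  note g = ramp[OF r]
  have "?g x \<le> 1 / exp (-t1)" if "x \<in> {0..1}" for x
    unfolding ramp_def by (intro frac_le) simp_all
  then have eq: "(\<integral>\<^sup>+t. ennreal (?g (exp (-t))) \<partial>gamma_measure k) = ennreal (I ?g)"
    using g by (intro nn_integral_I) auto
  have I0: "I ?g \<ge> 0" unfolding I_def using g(2) by (intro integral_nonneg_AE) auto
  have G: "Gamma (k + 1) > 0" using k_pos by (intro Gamma_real_pos) simp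
  have ind: "(indicator {exp (-s)..} (exp (-t)) :: real) = indicator {..s} t" for s t :: real
    by (simp add: indicator_def)
  have cancel: "exp t * (exp (-t) * y) = y" for t y :: real
    by (simp add: exp_minus mult.assoc[symmetric])
  have ub: "?g (exp (-t)) \<le> exp t * indicator {..t1} t" for t
    using mult_left_mono[OF g(3)[of "exp (-t)"], of "exp t"] unfolding ind cancel by simp
  have lb: "exp t * indicator {..t2} t \<le> ?g (exp (-t))" for t
    using mult_left_mono[OF g(4)[of "exp (-t)"], of "exp t"] unfolding ind cancel by simp
  have "ennreal (I ?g) \<le> ennreal (t1 powr k / Gamma (k + 1))"
    unfolding eq[symmetric] using assms k_pos
    by (subst gamma_measure_exp_cutoff[symmetric]) (auto intro!: nn_integral_mono ennreal_leI ub)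
  then show "I ?g \<le> t1 powr k / Gamma (k + 1)" using G by (subst (asm) ennreal_le_iff) auto
  have "ennreal (t2 powr k / Gamma (k + 1)) \<le> ennreal (I ?g)"
    unfolding eq[symmetric] using assms k_pos
    by (subst gamma_measure_exp_cutoff[symmetric]) (auto intro!: nn_integral_mono ennreal_leI lb)
  then show "t2 powr k / Gamma (k + 1) \<le> I ?g" using I0 by (subst (asm) ennreal_le_iff) auto
qed

definition S :: "real \<Rightarrow> real" where
  "S u = (\<Sum>n. b n * indicator {..u} (l n))"

text \<open>Rankin's trick at \<open>d = 1 / u\<close>: where \<open>l n \<le> u\<close>, the factor
  \<open>exp 1 * exp (-(l n / u))\<close> is at least 1.\<close>

lemma S_summable:
  assumes "u > 0"
  shows "summable (\<lambda>n. b n * indicator {..u} (l n))"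
proof (rule summable_comparison_test'[where N = 0])
  show "summable (\<lambda>n. exp 1 * (b n * exp (-(1 / u * l n))))"
    using assms by (intro summable_mult summable_laplace) auto
  fix n
  have "1 \<le> exp 1 * exp (-(1 / u * l n))" if "l n \<le> u"
    using that assms by (simp flip: exp_add)
  then show "norm (b n * indicator {..u} (l n)) \<le> exp 1 * (b n * exp (-(1 / u * l n)))"
    using b_nonneg[of n] mult_left_mono[of 1 "exp 1 * exp (-(1 / u * l n))" "b n"]
    by (auto simp: indicator_def mult_ac)
qed

text \<open>At \<open>d = 1 / u\<close> the condition \<open>l n \<le> u\<close> reads
  \<open>x \<ge> exp (-1)\<close>. A ramp that starts at or above this threshold
  (\<open>t1 \<le> 1\<close>) stays below the sharp cutoff, one that is complete at or below it
  (\<open>t2 \<ge> 1\<close>) stays above.\<close>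

lemma T_ramp:
  assumes "0 < t2" "t2 < t1" "u > 0"
  shows "t1 \<le> 1 \<Longrightarrow> T (1 / u) (ramp (exp (-t1)) (exp (-t2))) \<le> S u / u powr k"
    "t2 \<ge> 1 \<Longrightarrow> S u / u powr k \<le> T (1 / u) (ramp (exp (-t1)) (exp (-t2)))"
proof -
  let ?g = "ramp (exp (-t1)) (exp (-t2))"
  let ?E = "\<lambda>n. exp (-(1 / u * l n))"
  have r: "0 < exp (-t1)" "exp (-t1) < exp (-t2)" using assms by auto
  note g = ramp[OF r]
  have "\<bar>?g x\<bar> \<le> 1 / exp (-t1)" if "x \<in> {0..1}" for x
    unfolding abs_of_nonneg[OF g(2)] unfolding ramp_def by (intro frac_le) simp_all
  then have sm: "summable (\<lambda>n. b n * ?E n * ?g (?E n))"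
    using assms by (intro T_summable) auto
  have Teq: "T (1 / u) ?g = (\<Sum>n. b n * ?E n * ?g (?E n)) / u powr k"
    using assms by (simp add: T_def powr_divide)
  show "T (1 / u) ?g \<le> S u / u powr k" if "t1 \<le> 1"
  proof -
    have "b n * ?E n * ?g (?E n) \<le> b n * indicator {..u} (l n)" for n
    proof -
      have "l n / u \<le> 1" if "exp (-t1) \<le> ?E n" using that \<open>t1 \<le> 1\<close> by simp
      then have "indicator {exp (-t1)..} (?E n) \<le> (indicator {..u} (l n) :: real)"
        using assms by (auto simp: indicator_def field_simps)
      then have "?E n * ?g (?E n) \<le> indicator {..u} (l n)" using g(3)[of "?E n"] by simp
      from mult_left_mono[OF this b_nonneg[of n]] show ?thesis by (simp add: mult.assoc)
    qed
    then show ?thesis unfolding Teq S_def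
      by (intro divide_right_mono suminf_le sm S_summable assms) auto
  qed
  show "S u / u powr k \<le> T (1 / u) ?g" if "t2 \<ge> 1"
  proof -
    have "b n * indicator {..u} (l n) \<le> b n * ?E n * ?g (?E n)" for n
    proof -
      have "exp (-t2) \<le> ?E n" if "l n \<le> u"
      proof -
        have "l n / u \<le> 1" using that assms by simp
        then show ?thesis using \<open>t2 \<ge> 1\<close> by simp
      qed
      then have "(indicator {..u} (l n) :: real) \<le> indicator {exp (-t2)..} (?E n)"
        by (auto simp: indicator_def)
      then have "indicator {..u} (l n) \<le> ?E n * ?g (?E n)" using g(4)[of "?E n"] by simp
      from mult_left_mono[OF this b_nonneg[of n]] show ?thesis by (simp add: mult.assoc)
    qed
    then show ?thesis unfolding Teq S_def
      by (intro divide_right_mono suminf_le sm S_summable assms) auto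
  qed
qed

theorem tauberian: "((\<lambda>u. S u / u powr k) \<longlongrightarrow> 1 / Gamma (k + 1)) at_top"
proof (rule tendstoI)
  fix e :: real assume e: "e > 0"
  let ?G = "Gamma (k + 1)"
  have "?G \<noteq> 0" using Gamma_real_pos[of "k + 1"] k_pos by linarith
  moreover have "((\<lambda>x. (1 + x) powr k) \<longlongrightarrow> 1) (at_right 0)" "((\<lambda>x. (1 - x) powr k) \<longlongrightarrow> 1) (at_right 0)"
    by real_asymp+
  ultimately have lim: "((\<lambda>x. (1 + x) powr k / ?G) \<longlongrightarrow> 1 / ?G) (at_right 0)"
    "((\<lambda>x. (1 - x) powr k / ?G) \<longlongrightarrow> 1 / ?G) (at_right 0)"
    by (auto intro!: tendsto_divide)
  have "\<forall>\<^sub>F x in at_right 0. (1 + x) powr k / ?G < 1 / ?G + e / 2"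
    using lim(1) e by (intro order_tendstoD(2)) auto
  moreover have "\<forall>\<^sub>F x in at_right 0. (1 - x) powr k / ?G > 1 / ?G - e / 2"
    using lim(2) e by (intro order_tendstoD(1)) auto
  moreover have "\<forall>\<^sub>F x in at_right (0::real). x > 0" by (simp add: eventually_at_right_less)
  moreover have "\<forall>\<^sub>F x in at_right (0::real). x < 1" by real_asymp
  ultimately have "\<forall>\<^sub>F x in at_right 0. (1 + x) powr k / ?G < 1 / ?G + e / 2 \<and>
      (1 - x) powr k / ?G > 1 / ?G - e / 2 \<and> x > 0 \<and> x < 1"
    by eventually_elim auto
  then obtain x where x: "(1 + x) powr k / ?G < 1 / ?G + e / 2" "(1 - x) powr k / ?G > 1 / ?G - e / 2"
    "0 < x" "x < 1" using eventually_happens[of _ "at_right (0::real)"] by auto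
  \<comment> \<open>One ramp ends at the jump of the cutoff and the other begins there;
    \<open>x\<close> was chosen so that widening or narrowing by \<open>x\<close> costs less than
    \<open>e / 2\<close> in the limit.\<close>
  let ?gu = "ramp (exp (-(1 + x))) (exp (-1))" and ?gl = "ramp (exp (-1)) (exp (-(1 - x)))"
  have inv: "filterlim (\<lambda>u::real. 1 / u) (at_right 0) at_top" by real_asymp
  have T: "((\<lambda>u. T (1 / u) g) \<longlongrightarrow> I g) at_top" if "continuous_on UNIV g" for g
    using T_continuous_limit[OF that] inv by (rule filterlim_compose)
  have "\<forall>\<^sub>F u in at_top. T (1 / u) ?gu < I ?gu + e / 2"
    using T[of ?gu] ramp(1) x e by (intro order_tendstoD(2)) auto
  moreover have "\<forall>\<^sub>F u in at_top. T (1 / u) ?gl > I ?gl - e / 2"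
    using T[of ?gl] ramp(1) x e by (intro order_tendstoD(1)) auto
  moreover have "\<forall>\<^sub>F u in at_top. u > (0::real)" by (rule eventually_gt_at_top)
  ultimately show "\<forall>\<^sub>F u in at_top. dist (S u / u powr k) (1 / ?G) < e"
  proof eventually_elim
    case (elim u)
    have "S u / u powr k \<le> T (1 / u) ?gu" using T_ramp(2)[of 1 "1 + x" u] x elim by simp
    moreover have "T (1 / u) ?gl \<le> S u / u powr k" using T_ramp(1)[of "1 - x" 1 u] x elim by simp
    moreover have "I ?gu \<le> (1 + x) powr k / ?G" using I_ramp(1)[of 1 "1 + x"] x by simp
    moreover have "(1 - x) powr k / ?G \<le> I ?gl" using I_ramp(2)[of "1 - x" 1] x by simp
    ultimately show ?case using elim x unfolding dist_real_def by linarith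
  qed
qed

end

section \<open>Integers composed of given primes and Euler products\<close>

text \<open>The multiplicative semigroup generated by the primes in \<open>P\<close>. Positivity has
  to be demanded, as \<open>prime_factors 0\<close> is empty.\<close>

definition gen :: "nat set \<Rightarrow> nat set" where
  "gen P = {n. n > 0 \<and> prime_factors n \<subseteq> P}"

lemma gen_pos: "n \<in> gen P \<Longrightarrow> n > 0"
  by (simp add: gen_def)

lemma gen_mult_iff:
  assumes "a > 0" "b > 0"
  shows "a * b \<in> gen P \<longleftrightarrow> a \<in> gen P \<and> b \<in> gen P"
  using assms by (auto simp: gen_def prime_factors_product)

lemma gen_dvd: "n \<in> gen P \<Longrightarrow> d dvd n \<Longrightarrow> d \<in> gen P"
  by (metis dvd_def gen_mult_iff gen_pos nat_0_less_mult_iff)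

lemma gen_empty: "gen {} = {1}"
proof -
  have "n = 1" if "n > 0" "prime_factors n = {}" for n :: nat
    using that prime_factorization_empty_iff[of n] by simp
  then show ?thesis by (auto simp: gen_def)
qed

lemma gen_primes: "gen {p. prime p} = {0<..}"
  by (auto simp: gen_def)

lemma prime_power_in_gen: "prime p \<Longrightarrow> p \<in> P \<Longrightarrow> p ^ i \<in> gen P"
proof (induction i)
  case (Suc i)
  then show ?case
    by (simp add: gen_mult_iff prime_gt_0_nat) (simp add: gen_def prime_factorization_prime prime_gt_0_nat)
qed (simp add: gen_def)

text \<open>Unique factorisation one prime at a time: splitting off the full power of
  \<open>p\<close> yields one Euler factor in the induction below.\<close>

lemma gen_insert:
  assumes p: "prime p" and "p \<notin> Q"
  shows "bij_betw (\<lambda>(i, a). p ^ i * a) (UNIV \<times> gen Q) (gen (insert p Q))"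
proof (rule bij_betw_byWitness[where f' = "\<lambda>n. (multiplicity p n, n div p ^ multiplicity p n)"])
  have p0: "p > 0" "p \<noteq> 1" using p prime_gt_1_nat[of p] by auto
  have nd: "\<not> p dvd a" if "a \<in> gen Q" for a
    using that assms by (auto simp: gen_def in_prime_factors_iff)
  have mult: "multiplicity p (p ^ i * a) = i" if "a \<in> gen Q" for i a
    using nd[OF that] p gen_pos[OF that] p0
    by (subst prime_elem_multiplicity_mult_distrib) (auto simp: multiplicity_same_power' not_dvd_imp_multiplicity_0)
  show "\<forall>x\<in>UNIV \<times> gen Q. (multiplicity p (case x of (i, a) \<Rightarrow> p ^ i * a),
      (case x of (i, a) \<Rightarrow> p ^ i * a) div p ^ multiplicity p (case x of (i, a) \<Rightarrow> p ^ i * a)) = x"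
    using mult p0 by auto
  show "\<forall>n\<in>gen (insert p Q). (case (multiplicity p n, n div p ^ multiplicity p n) of (i, a) \<Rightarrow> p ^ i * a) = n"
    by (simp add: multiplicity_dvd)
  show "(\<lambda>(i, a). p ^ i * a) ` (UNIV \<times> gen Q) \<subseteq> gen (insert p Q)"
  proof safe
    fix i a assume a: "a \<in> gen Q"
    then have "a \<in> gen (insert p Q)" by (auto simp: gen_def)
    moreover have "p ^ i \<in> gen (insert p Q)" using p by (rule prime_power_in_gen) simp
    ultimately show "p ^ i * a \<in> gen (insert p Q)"
      by (subst gen_mult_iff) (auto simp: gen_pos p0)
  qed
  show "(\<lambda>n. (multiplicity p n, n div p ^ multiplicity p n)) ` gen (insert p Q) \<subseteq> UNIV \<times> gen Q"
  proof safe
    fix n assume n: "n \<in> gen (insert p Q)"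
    let ?a = "n div p ^ multiplicity p n"
    have "n = p ^ multiplicity p n * ?a" by (simp add: multiplicity_dvd)
    then have dvd: "?a dvd n" by (metis dvd_triv_right)
    have "\<not> p dvd ?a" using gen_pos[OF n] p0 by (intro multiplicity_decompose) auto
    moreover have "?a \<in> gen (insert p Q)" using n dvd by (rule gen_dvd)
    ultimately show "?a \<in> gen Q" by (auto simp: gen_def in_prime_factors_iff)
  qed auto
qed

text \<open>Each new prime contributes a geometric series. With finitely many primes this converges
  for every \<open>s > 0\<close>, in particular at \<open>s = 1\<close>, where the lower bound for
  the sum of the weights uses it.\<close>

lemma finite_euler_product:
  fixes s :: real
  assumes "finite Q" "\<And>p. p \<in> Q \<Longrightarrow> prime p" "s > 0"
  shows "((\<lambda>n. real n powr -s) has_sum (\<Prod>p\<in>Q. 1 / (1 - real p powr -s))) (gen Q)"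
  using assms(1,2)
proof (induction Q rule: finite_induct)
  case empty
  then show ?case by (simp add: gen_empty has_sum_finite_iff)
next
  case (insert p Q)
  let ?x = "real p powr -s" and ?E = "\<Prod>p\<in>Q. 1 / (1 - real p powr -s)"
  have p: "prime p" using insert by simp
  have p1: "real p > 1" using prime_gt_1_nat[OF p] by simp
  have x: "0 < ?x" "?x < 1" using p1 assms by (auto simp: powr_less_one)
  have "0 \<le> 1 / (1 - real q powr -s)" if "q \<in> Q" for q
    using prime_gt_1_nat[of q] insert.prems[of q] that assms(3) powr_less_one[of "real q" "-s"] by simp
  then have E0: "?E \<ge> 0" by (intro prod_nonneg)
  have IH: "((\<lambda>n. real n powr -s) has_sum ?E) (gen Q)" using insert by simp
  let ?f = "\<lambda>(i, a). ?x ^ i * real a powr -s"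
  have f1: "((\<lambda>a. ?f (i, a)) has_sum (?x ^ i * ?E)) (gen Q)" for i
    using has_sum_cmult_right[OF IH] by simp
  have geo: "((\<lambda>i. ?x ^ i * ?E) has_sum (1 / (1 - ?x) * ?E)) UNIV"
    using x E0 geometric_sums[of ?x]
    by (intro has_sum_cmult_left sums_nonneg_imp_has_sum) auto
  have "(?f has_sum (1 / (1 - ?x) * ?E)) (UNIV \<times> gen Q)"
  proof (rule has_sum_SigmaI[OF f1 geo])
    have "(\<lambda>x. norm (?f x)) summable_on UNIV \<times> gen Q"
    proof (subst Infinite_Sum.abs_summable_on_Sigma_iff, intro conjI ballI)
      fix i show "(\<lambda>a. norm (?f (i, a))) summable_on gen Q"
        using f1[of i] x by (simp add: abs_mult has_sum_imp_summable)
    next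
      have "(\<Sum>\<^sub>\<infinity>a\<in>gen Q. norm (?f (i, a))) = ?x ^ i * ?E" for i
        using f1[of i] x by (intro infsumI) (simp add: abs_mult)
      then show "(\<lambda>i. norm (\<Sum>\<^sub>\<infinity>a\<in>gen Q. norm (?f (i, a)))) summable_on UNIV"
        using geo x E0 by (simp add: abs_mult has_sum_imp_summable)
    qed
    then show "?f summable_on UNIV \<times> gen Q" by (rule abs_summable_summable)
  qed
  moreover have "?f = (\<lambda>y. real (case y of (i, a) \<Rightarrow> p ^ i * a) powr -s)"
  proof -
    have "?x ^ i = (real p ^ i) powr -s" for i
      using p1 by (simp add: powr_power powr_powr mult.commute flip: powr_realpow)
    then show ?thesis by (auto simp: fun_eq_iff powr_mult)
  qed
  ultimately have "((\<lambda>n. real n powr -s) has_sum (1 / (1 - ?x) * ?E)) (gen (insert p Q))"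
    using has_sum_reindex_bij_betw[OF gen_insert[OF p insert(2)], of "\<lambda>n. real n powr -s"] by simp
  then show ?case using insert by simp
qed

lemma sum_powr_gen_le:
  assumes "s > 0" "\<And>p. p \<in> P \<Longrightarrow> prime p"
  shows "(\<Sum>n\<in>gen P \<inter> {..N}. real n powr -s) \<le> (\<Prod>p\<in>P \<inter> {..N}. 1 / (1 - real p powr -s))"
proof (rule finite_sum_le_has_sum[OF finite_euler_product])
  show "gen P \<inter> {..N} \<subseteq> gen (P \<inter> {..N})"
  proof
    fix n assume n: "n \<in> gen P \<inter> {..N}"
    have "q \<le> N" if "q \<in> prime_factors n" for q
      using that n dvd_imp_le[of q n] by (auto simp: in_prime_factors_iff)
    then show "n \<in> gen (P \<inter> {..N})" using n by (auto simp: gen_def)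
  qed
qed (use assms in auto)

text \<open>The logarithm of the Euler factor at \<open>p\<close>; \<open>s = 1\<close> gives the
  weights balanced by the greedy partition.\<close>

definition prime_weight :: "real \<Rightarrow> nat \<Rightarrow> real" where
  "prime_weight s p = - ln (1 - real p powr -s)"

lemma prime_weight_nonneg: "p \<ge> 2 \<Longrightarrow> s > 0 \<Longrightarrow> prime_weight s p \<ge> 0"
  by (simp add: prime_weight_def powr_less_one)

lemma exp_sum_prime_weight:
  assumes "s > 0" "finite Q" "\<And>p. p \<in> Q \<Longrightarrow> p \<ge> 2"
  shows "(\<Prod>p\<in>Q. 1 / (1 - real p powr -s)) = exp (\<Sum>p\<in>Q. prime_weight s p)"
proof -
  have "1 / (1 - real p powr -s) = exp (prime_weight s p)" if "p \<in> Q" for p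
    using assms(1) assms(3)[OF that] powr_less_one[of "real p" "-s"]
    by (simp add: prime_weight_def exp_minus inverse_eq_divide)
  then show ?thesis using assms(2) by (simp add: exp_sum)
qed

lemma summable_on_powr:
  assumes "s > 1"
  shows "(\<lambda>n. real n powr -s) summable_on A"
proof -
  have "summable (\<lambda>n. real n powr -s)" using assms summable_real_powr_iff[of "-s"] by simp
  then have "(\<lambda>n. real n powr -s) summable_on UNIV"
    by (intro norm_summable_imp_summable_on) simp
  then show ?thesis using summable_on_subset_banach by blast
qed

text \<open>The product over primes up to \<open>N\<close> dominates the sum over
  \<open>n \<le> N\<close> and is dominated by the whole series, so it is squeezed to the latter;
  the logarithm turns it into a series of weights.\<close>

theorem euler_product:
  assumes "s > 1" "\<And>p. p \<in> P \<Longrightarrow> prime p"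
  shows "(\<lambda>p. if p \<in> P then prime_weight s p else 0) sums ln (\<Sum>\<^sub>\<infinity>n\<in>gen P. real n powr -s)"
proof -
  let ?F = "\<Sum>\<^sub>\<infinity>n\<in>gen P. real n powr -s"
  let ?E = "\<lambda>N. \<Prod>p\<in>P \<inter> {..N}. 1 / (1 - real p powr -s)"
  have hs: "((\<lambda>n. real n powr -s) has_sum ?F) (gen P)"
    using summable_on_powr[OF assms(1)] by simp
  have "1 \<in> gen P" by (simp add: gen_def)
  then have F1: "?F \<ge> 1" using finite_sum_le_has_sum[OF hs, of "{1}"] by simp
  have upper: "?E N \<le> ?F" for N
  proof (rule has_sum_mono_neutral[OF finite_euler_product hs])
    show "real x powr -s \<le> 0" if "x \<in> gen (P \<inter> {..N}) - gen P" for x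
      using that by (auto simp: gen_def)
  qed (use assms in auto)
  have lower: "(\<Sum>n\<in>gen P \<inter> {..N}. real n powr -s) \<le> ?E N" for N
    using assms by (intro sum_powr_gen_le) auto
  have "((\<lambda>n. if n \<in> gen P then real n powr -s else 0) has_sum ?F) UNIV"
    by (rule has_sum_cong_neutral[THEN iffD1, OF _ _ _ hs]) auto
  then have "(\<lambda>n. if n \<in> gen P then real n powr -s else 0) sums ?F" by (rule has_sum_imp_sums)
  then have "(\<lambda>N. \<Sum>n\<le>N. if n \<in> gen P then real n powr -s else 0) \<longlonglongrightarrow> ?F"
    by (simp add: sums_def_le)
  moreover have "(\<Sum>n\<le>N. if n \<in> gen P then real n powr -s else 0) = (\<Sum>n\<in>gen P \<inter> {..N}. real n powr -s)" for N
    by (subst sum.inter_restrict[symmetric]) (auto simp: Int_commute)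
  ultimately have lim: "(\<lambda>N. \<Sum>n\<in>gen P \<inter> {..N}. real n powr -s) \<longlonglongrightarrow> ?F" by simp
  have "?E \<longlonglongrightarrow> ?F"
  proof (rule tendsto_sandwich[OF _ _ lim tendsto_const])
    show "\<forall>\<^sub>F N in sequentially. (\<Sum>n\<in>gen P \<inter> {..N}. real n powr -s) \<le> ?E N"
      using lower by (rule always_eventually[OF allI])
    show "\<forall>\<^sub>F N in sequentially. ?E N \<le> ?F" using upper by (rule always_eventually[OF allI])
  qed
  then have "(\<lambda>N. ln (?E N)) \<longlonglongrightarrow> ln ?F" using F1 by (intro tendsto_ln) auto
  moreover have "ln (?E N) = (\<Sum>p\<le>N. if p \<in> P then prime_weight s p else 0)" for N
  proof -
    have "?E N = exp (\<Sum>p\<in>P \<inter> {..N}. prime_weight s p)"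
      using assms by (intro exp_sum_prime_weight) (auto simp: prime_ge_2_nat)
    also have "(\<Sum>p\<in>P \<inter> {..N}. prime_weight s p) = (\<Sum>p\<le>N. if p \<in> P then prime_weight s p else 0)"
      by (subst sum.inter_restrict[symmetric]) (auto simp: Int_commute)
    finally show ?thesis by simp
  qed
  ultimately show ?thesis by (simp add: sums_def_le)
qed

section \<open>Balanced sets of primes: the Dirichlet series\<close>

lemma neg_ln_one_minus_bounds:
  fixes x :: real
  assumes "0 \<le> x" "x < 1"
  shows "x \<le> - ln (1 - x)" "- ln (1 - x) \<le> x / (1 - x)"
proof -
  show "x \<le> - ln (1 - x)" using ln_le_minus_one[of "1 - x"] assms by simp
  have "ln (1 / (1 - x)) \<le> 1 / (1 - x) - 1" using assms by (intro ln_le_minus_one) simp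
  also have "1 / (1 - x) - 1 = x / (1 - x)" using assms by (simp add: field_simps)
  finally show "- ln (1 - x) \<le> x / (1 - x)" using assms by (simp add: ln_div)
qed

lemma prime_weight_1_bounds:
  assumes "n \<ge> 2"
  shows "1 / real n \<le> prime_weight 1 n" "prime_weight 1 n \<le> 1 / (real n - 1)"
proof -
  have x: "0 \<le> 1 / real n" "1 / real n < 1" using assms by auto
  have w: "prime_weight 1 n = - ln (1 - 1 / real n)"
    by (simp add: prime_weight_def powr_minus_divide)
  show "1 / real n \<le> prime_weight 1 n" unfolding w using x by (rule neg_ln_one_minus_bounds)
  have "1 / real n / (1 - 1 / real n) = 1 / (real n - 1)" using assms by (simp add: field_simps)
  then show "prime_weight 1 n \<le> 1 / (real n - 1)"
    using neg_ln_one_minus_bounds(2)[OF x] unfolding w by simp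
qed

text \<open>With \<open>x = 1 / p\<close> and \<open>y = p powr -d\<close> both quantities are
  \<open>x * y\<close> plus an error between 0 and \<open>2 * x ^ 2\<close>. This is summable over
  \<open>p\<close> and uniform in \<open>d\<close>, so the weights at \<open>1 + d\<close> may be
  exchanged for those at 1 damped by \<open>p powr -d\<close>, the shape that Abel summation
  handles.\<close>

lemma prime_weight_diff_le:
  fixes d :: real
  assumes "p \<ge> 2" "d \<ge> 0"
  shows "\<bar>prime_weight (1 + d) p - prime_weight 1 p * real p powr -d\<bar> \<le> 2 / real p ^ 2"
proof -
  define x y where "x = 1 / real p" and "y = real p powr -d"
  have x: "0 < x" "x \<le> 1 / 2" using assms by (auto simp: x_def field_simps)
  have y: "0 < y" "y \<le> 1" using assms by (auto simp: y_def powr_le1 powr_minus inverse_le_1_iff ge_one_powr_ge_zero)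
  have xy: "0 < x * y" "x * y \<le> x" using x y by (auto simp: mult_le_cancel_left1)
  have w: "prime_weight 1 p = - ln (1 - x)" using assms by (simp add: prime_weight_def x_def powr_minus_divide)
  have W: "prime_weight (1 + d) p = - ln (1 - x * y)"
    using assms by (simp add: prime_weight_def x_def y_def powr_diff powr_minus_divide)
  have wb: "x \<le> - ln (1 - x)" "- ln (1 - x) \<le> x / (1 - x)"
    using x by (intro neg_ln_one_minus_bounds; simp)+
  have Wb: "x * y \<le> - ln (1 - x * y)" "- ln (1 - x * y) \<le> x * y / (1 - x * y)"
    using x xy by (intro neg_ln_one_minus_bounds; simp)+
  have frac: "z / (1 - z) - z \<le> 2 * x ^ 2" if "0 < z" "z \<le> x" for z
  proof -
    have "z / (1 - z) - z = z ^ 2 / (1 - z)" using that x by (simp add: field_simps power2_eq_square)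
    also have "\<dots> \<le> x ^ 2 / (1 / 2)" using that x by (intro frac_le power_mono) auto
    finally show ?thesis by simp
  qed
  have "- ln (1 - x) * y - - ln (1 - x * y) \<le> x / (1 - x) * y - x * y"
    using wb Wb y by (intro diff_mono mult_right_mono) auto
  also have "\<dots> = (x / (1 - x) - x) * y" by (simp add: algebra_simps)
  also have "\<dots> \<le> 2 * x ^ 2 * 1" using frac[of x] x y by (intro mult_mono) auto
  finally have 1: "- ln (1 - x) * y - - ln (1 - x * y) \<le> 2 * x ^ 2" by simp
  have "- ln (1 - x * y) - - ln (1 - x) * y \<le> x * y / (1 - x * y) - x * y"
    using wb Wb y by (intro diff_mono mult_right_mono) auto
  also have "\<dots> \<le> 2 * x ^ 2" using frac xy by blast
  finally have "\<bar>- ln (1 - x * y) - - ln (1 - x) * y\<bar> \<le> 2 * x ^ 2" using 1 by linarith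
  then show ?thesis unfolding w W y_def[symmetric] by (simp add: x_def power_divide)
qed

text \<open>Abel summation, uniformly in the exponent.\<close>
lemma abel_limit:
  fixes c :: "nat \<Rightarrow> real"
  assumes c0: "c 0 = 0" and lim: "(\<lambda>n. \<Sum>k\<le>n. c k) \<longlonglongrightarrow> 0"
    and sm: "\<And>d. d > 0 \<Longrightarrow> summable (\<lambda>n. c n * real n powr -d)"
  shows "((\<lambda>d. \<Sum>n. c n * real n powr -d) \<longlongrightarrow> 0) (at_right 0)"
proof (rule tendstoI)
  fix e :: real assume e: "e > 0"
  define D where "D n = (\<Sum>k\<le>n. c k)" for n
  have D: "D \<longlonglongrightarrow> 0" using lim by (simp add: D_def[abs_def])
  then have "Bseq D" using Bseq_conv_Bfun convergent_def convergent_imp_Bseq by blast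
  then obtain B where B: "B > 0" "\<And>n. \<bar>D n\<bar> \<le> B" by (auto simp: Bseq_def)
  obtain M0 where M0: "\<And>n. n \<ge> M0 \<Longrightarrow> \<bar>D n\<bar> < e / 2"
    using LIMSEQ_D[OF D, of "e / 2"] e by auto
  define M where "M = max 1 M0"
  have M: "M \<ge> 1" "\<And>n. n \<ge> M \<Longrightarrow> \<bar>D n\<bar> \<le> e / 2" using M0 by (auto simp: M_def intro: less_imp_le)
  \<comment> \<open>Split at \<open>M\<close>: the indices below \<open>M\<close> enter with total
    weight \<open>1 - M powr -d\<close>, which vanishes with \<open>d\<close>, while beyond
    \<open>M\<close> the partial sums are at most \<open>e / 2\<close>.\<close>
  have bound: "\<bar>\<Sum>n. c n * real n powr -d\<bar> \<le> B * (1 - real M powr -d) + e / 2" if d: "d > 0" for d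
  proof -
    define a where "a n = real n powr -d" for n
    have a_mono: "a (Suc n) \<le> a n" if "n \<ge> 1" for n
      unfolding a_def using that d by (intro powr_mono2') auto
    have a_nonneg: "a n \<ge> 0" for n by (simp add: a_def)
    have abs_le: "\<bar>D n * (a n - a (Suc n))\<bar> \<le> C * (a n - a (Suc n))" if "n \<ge> 1" "\<bar>D n\<bar> \<le> C" for n C
      using a_mono[OF that(1)] mult_right_mono[OF that(2), of "a n - a (Suc n)"] by (simp add: abs_mult)
    have parts: "(\<Sum>n\<le>N. c n * a n) = D N * a N + (\<Sum>n=1..<N. D n * (a n - a (Suc n)))" if "N \<ge> 1" for N
      using that
    proof (induction N rule: dec_induct)
      case base
      then show ?case using c0 by (simp add: D_def)
    next
      case (step N)
      then show ?case by (simp add: D_def algebra_simps)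
    qed
    have partial: "\<bar>\<Sum>n\<le>N. c n * a n\<bar> \<le> \<bar>D N\<bar> + (B * (1 - a M) + e / 2)" if N: "N \<ge> M" for N
    proof -
      have "(\<Sum>n=1..<N. D n * (a n - a (Suc n))) = (\<Sum>n=1..<M. D n * (a n - a (Suc n))) + (\<Sum>n=M..<N. D n * (a n - a (Suc n)))"
        using M N by (simp add: sum.atLeastLessThan_concat)
      moreover have "\<bar>\<Sum>n=1..<M. D n * (a n - a (Suc n))\<bar> \<le> (\<Sum>n=1..<M. B * (a n - a (Suc n)))"
        using B by (intro sum_abs[THEN order_trans] sum_mono abs_le) auto
      moreover have "(\<Sum>n=1..<M. B * (a n - a (Suc n))) = B * (a 1 - a M)"
        using M(1) sum_Suc_diff'[of 1 M "\<lambda>n. - a n"] by (simp flip: sum_distrib_left)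
      moreover have "\<bar>\<Sum>n=M..<N. D n * (a n - a (Suc n))\<bar> \<le> (\<Sum>n=M..<N. e / 2 * (a n - a (Suc n)))"
        using M by (intro sum_abs[THEN order_trans] sum_mono abs_le) auto
      moreover have "(\<Sum>n=M..<N. e / 2 * (a n - a (Suc n))) = e / 2 * (a M - a N)"
        using N sum_Suc_diff'[of M N "\<lambda>n. - a n"] by (simp only: sum_distrib_left[symmetric]) simp
      moreover have "B * (a 1 - a M) = B * (1 - a M)" by (simp add: a_def)
      moreover have "a M \<le> 1" "a N \<le> 1"
        using M N d by (auto simp: a_def powr_minus inverse_le_1_iff ge_one_powr_ge_zero)
      moreover have "e / 2 * (a M - a N) \<le> e / 2 * 1"
        using e \<open>a M \<le> 1\<close> a_nonneg[of N] by (intro mult_left_mono) auto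
      moreover have "\<bar>D N * a N\<bar> \<le> \<bar>D N\<bar>"
        using \<open>a N \<le> 1\<close> a_nonneg[of N] by (simp add: abs_mult mult_left_le)
      moreover have "N \<ge> 1" using M N by simp
      ultimately show ?thesis using parts[of N] by linarith
    qed
    have "(\<lambda>n. c n * a n) sums (\<Sum>n. c n * a n)" using sm[OF d] by (simp add: a_def summable_sums)
    then have "(\<lambda>N. \<bar>\<Sum>n\<le>N. c n * a n\<bar>) \<longlonglongrightarrow> \<bar>\<Sum>n. c n * a n\<bar>"
      by (intro tendsto_rabs) (simp add: sums_def_le)
    moreover have "(\<lambda>N. \<bar>D N\<bar> + (B * (1 - a M) + e / 2)) \<longlonglongrightarrow> \<bar>0\<bar> + (B * (1 - a M) + e / 2)"
      using D by (intro tendsto_intros)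
    ultimately have "\<bar>\<Sum>n. c n * a n\<bar> \<le> \<bar>0\<bar> + (B * (1 - a M) + e / 2)"
      using partial by (intro LIMSEQ_le) blast+
    then show ?thesis by (simp add: a_def)
  qed
  have "((\<lambda>d. B * (1 - real M powr -d) + e / 2) \<longlongrightarrow> B * (1 - real M powr -0) + e / 2) (at_right 0)"
    using M(1) by (intro tendsto_intros) auto
  then have lim0: "((\<lambda>d. B * (1 - real M powr -d) + e / 2) \<longlongrightarrow> e / 2) (at_right 0)"
    using M(1) by simp
  have "\<forall>\<^sub>F d in at_right 0. B * (1 - real M powr -d) + e / 2 < e"
    using e by (intro order_tendstoD(2)[OF lim0]) simp
  moreover have "\<forall>\<^sub>F d in at_right (0::real). d > 0" by (simp add: eventually_at_right_less)
  ultimately show "\<forall>\<^sub>F d in at_right 0. dist (\<Sum>n. c n * real n powr -d) 0 < e"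
  proof eventually_elim
    case (elim d)
    then show ?case using bound[of d] by (simp add: dist_real_def)
  qed
qed

lemma summable_prime_weight:
  fixes d :: "nat \<Rightarrow> real" and s :: real
  assumes d: "\<And>p. \<bar>d p\<bar> \<le> 1" "\<And>p. p < 2 \<Longrightarrow> d p = 0" and s: "s > 1"
  shows "summable (\<lambda>p. d p * prime_weight s p)"
proof (rule summable_comparison_test'[where N = 2])
  show "summable (\<lambda>n. 2 * real n powr -s)"
    using s summable_real_powr_iff[of "-s"] by (intro summable_mult) simp
  fix p :: nat assume p: "p \<ge> 2"
  have "real p powr -s \<le> real p powr -1" using p s by (intro powr_mono) auto
  also have "\<dots> \<le> 1 / 2" using p by (simp add: powr_minus_divide field_simps)
  finally have x: "real p powr -s \<le> 1 / 2" .
  have "prime_weight s p \<le> real p powr -s / (1 - real p powr -s)"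
    unfolding prime_weight_def using x by (intro neg_ln_one_minus_bounds) auto
  also have "\<dots> \<le> real p powr -s / (1 / 2)" using x by (intro divide_left_mono) auto
  finally have "prime_weight s p \<le> 2 * real p powr -s" by simp
  moreover have "prime_weight s p \<ge> 0" using p s by (intro prime_weight_nonneg) auto
  ultimately show "norm (d p * prime_weight s p) \<le> 2 * real p powr -s"
    using d(1)[of p] mult_mono[of "\<bar>d p\<bar>" 1 "prime_weight s p" "2 * real p powr -s"] by (simp add: abs_mult)
qed

text \<open>Convergence at \<open>s = 1\<close> may be only conditional, so dominated convergence
  does not reach the whole series. It is applied to the error of
  \<open>prime_weight_diff_le\<close>, which vanishes termwise; \<open>abel_limit\<close> takes care
  of the rest.\<close>

lemma sum_prime_weight_tendsto_0:
  fixes d :: "nat \<Rightarrow> real"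
  assumes d: "\<And>p. \<bar>d p\<bar> \<le> 1" "\<And>p. p < 2 \<Longrightarrow> d p = 0"
    and lim: "(\<lambda>n. \<Sum>p\<le>n. d p * prime_weight 1 p) \<longlonglongrightarrow> 0"
  shows "((\<lambda>t. \<Sum>p. d p * prime_weight (1 + t) p) \<longlongrightarrow> 0) (at_right 0)"
proof -
  let ?e = "\<lambda>p t. d p * (prime_weight (1 + t) p - prime_weight 1 p * real p powr -t)"
  let ?M = "\<lambda>p. 2 / real p ^ 2"
  have sM: "summable ?M"
    using inverse_power_summable[of 2, where 'a = real] by (simp add: divide_inverse summable_mult)
  have le: "norm (?e p t) \<le> ?M p" if "t \<ge> 0" for p t
  proof (cases "p \<ge> 2")
    case True
    have "\<bar>d p\<bar> * \<bar>prime_weight (1 + t) p - prime_weight 1 p * real p powr -t\<bar> \<le> 1 * ?M p"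
      using True that d by (intro mult_mono prime_weight_diff_le) auto
    then show ?thesis by (simp add: abs_mult)
  qed (use d in simp)
  have sw: "summable (\<lambda>p. d p * prime_weight s p)" if "s > 1" for s
    by (rule summable_prime_weight) (use d that in auto)
  have se: "summable (\<lambda>p. ?e p t)" if "t \<ge> 0" for t
    using sM le[OF that] by (rule summable_comparison_test'[where N = 0])
  have pw: "((\<lambda>t. ?e p t) \<longlongrightarrow> 0) (at_right 0)" for p
  proof (cases "p \<ge> 2")
    case True
    have "((\<lambda>t. ?e p t) \<longlongrightarrow> d p * (- ln (1 - real p powr -(1 + 0)) - prime_weight 1 p * real p powr -0)) (at_right 0)"
      unfolding prime_weight_def[of "1 + _"] using True
      by (intro tendsto_intros) (auto simp: powr_minus_divide)
    then show ?thesis using True by (simp add: prime_weight_def)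
  qed (use d in simp)
  have pos: "\<forall>\<^sub>F t in at_right (0::real). t > 0" by (simp add: eventually_at_right_less)
  have "((\<lambda>t. \<Sum>p. ?e p t) \<longlongrightarrow> (\<Sum>p. 0)) (at_right 0)"
  proof (rule tannerys_theorem[OF pw _ sM, THEN conjunct2, THEN conjunct2])
    show "\<forall>\<^sub>F (k, n) in sequentially \<times>\<^sub>F at_right 0. norm (?e k n) \<le> ?M k"
      using pos le by (auto simp: eventually_prod_filter case_prod_unfold intro!: exI[of _ "\<lambda>_. True"] exI[of _ "\<lambda>t. t > 0"])
  qed simp
  moreover have "((\<lambda>t. \<Sum>p. d p * prime_weight 1 p * real p powr -t) \<longlongrightarrow> 0) (at_right 0)"
  proof (rule abel_limit)
    show "summable (\<lambda>p. d p * prime_weight 1 p * real p powr -t)" if "t > 0" for t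
      using summable_diff[OF sw[of "1 + t"] se[of t]] that
      by (simp add: algebra_simps)
  qed (use d lim in auto)
  ultimately have "((\<lambda>t. (\<Sum>p. ?e p t) + (\<Sum>p. d p * prime_weight 1 p * real p powr -t)) \<longlongrightarrow> 0) (at_right 0)"
    using tendsto_add by fastforce
  moreover have "\<forall>\<^sub>F t in at_right 0. (\<Sum>p. ?e p t) + (\<Sum>p. d p * prime_weight 1 p * real p powr -t) = (\<Sum>p. d p * prime_weight (1 + t) p)"
    using pos
  proof eventually_elim
    case (elim t)
    have "summable (\<lambda>p. d p * prime_weight 1 p * real p powr -t)"
      using summable_diff[OF sw[of "1 + t"] se[of t]] elim
      by (simp add: algebra_simps)
    then show ?case using se[of t] elim by (subst suminf_add) (auto simp: algebra_simps)
  qed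
  ultimately show ?thesis by (rule Lim_transform_eventually)
qed

section \<open>The Dirichlet series and the logarithmic average of a balanced class\<close>

lemma summable_on_imp_sums:
  fixes f :: "nat \<Rightarrow> real"
  assumes "f summable_on A"
  shows "(\<lambda>n. if n \<in> A then f n else 0) sums infsum f A"
proof (rule has_sum_imp_sums)
  show "((\<lambda>n. if n \<in> A then f n else 0) has_sum infsum f A) UNIV"
    by (rule has_sum_cong_neutral[THEN iffD1, OF _ _ _ has_sum_infsum[OF assms]]) auto
qed

lemma zeta_bounds:
  assumes "t > 0"
  shows "1 / t \<le> (\<Sum>\<^sub>\<infinity>n\<in>{0<..}. real n powr -(1 + t))" "(\<Sum>\<^sub>\<infinity>n\<in>{0<..}. real n powr -(1 + t)) \<le> 1 + 1 / t"
proof -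
  let ?Z = "\<Sum>\<^sub>\<infinity>n\<in>{0<..}. real n powr -(1 + t)"
  have "(\<lambda>N. \<Sum>n\<le>N. if n \<in> {0<..} then real n powr -(1 + t) else 0) \<longlonglongrightarrow> ?Z"
    using summable_on_imp_sums[OF summable_on_powr[of "1 + t" "{0<..}"]] assms by (simp add: sums_def_le)
  moreover have "(\<Sum>n\<le>N. if n \<in> {0<..} then real n powr -(1 + t) else 0) = (\<Sum>n=1..N. real n powr -(1 + t))" for N
    by (rule sum.mono_neutral_cong_right) auto
  ultimately have lim: "(\<lambda>N. \<Sum>n=1..N. real n powr -(1 + t)) \<longlonglongrightarrow> ?Z" by simp
  then show "?Z \<le> 1 + 1 / t"
    using zeta_partial_sum_le[OF assms] by (intro LIMSEQ_le_const2) auto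
  have "(\<lambda>N. (1 - (real N + 1) powr -t) / t) \<longlonglongrightarrow> (1 - 0) / t"
  proof (intro tendsto_intros)
    show "(\<lambda>N. (real N + 1) powr -t) \<longlonglongrightarrow> 0" using assms by real_asymp
  qed (use assms in auto)
  then show "1 / t \<le> ?Z"
    using LIMSEQ_le[OF _ lim] zeta_partial_sum_ge[OF assms] by force
qed

text \<open>The weighted discrepancy at \<open>1 + t\<close> is \<open>ln F - k * ln Z\<close> for
  the series of \<open>gen P\<close> and zeta, and \<open>t * Z\<close> tends to 1. The limit is
  exactly 1 because the discrepancy tends to 0 and not merely to some constant.\<close>

theorem dirichlet_series_gen_tendsto:
  assumes P: "\<And>p. p \<in> P \<Longrightarrow> prime p" and k: "0 \<le> k" "k \<le> 1"
    and lim: "(\<lambda>n. \<Sum>p | p \<le> n \<and> prime p. (of_bool (p \<in> P) - k) * prime_weight 1 p) \<longlonglongrightarrow> 0"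
  shows "((\<lambda>t. t powr k * (\<Sum>\<^sub>\<infinity>n\<in>gen P. real n powr -(1 + t))) \<longlongrightarrow> 1) (at_right 0)"
proof -
  let ?F = "\<lambda>t. \<Sum>\<^sub>\<infinity>n\<in>gen P. real n powr -(1 + t)" and ?Z = "\<lambda>t. \<Sum>\<^sub>\<infinity>n\<in>{0<..}. real n powr -(1 + t)"
  define d :: "nat \<Rightarrow> real" where "d p = (if prime p then of_bool (p \<in> P) - k else 0)" for p
  have "(\<Sum>p | p \<le> n \<and> prime p. (of_bool (p \<in> P) - k) * prime_weight 1 p) = (\<Sum>p\<le>n. d p * prime_weight 1 p)" for n
    by (rule sum.mono_neutral_cong_left) (auto simp: d_def)
  then have "(\<lambda>n. \<Sum>p\<le>n. d p * prime_weight 1 p) \<longlonglongrightarrow> 0" using lim by simp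
  moreover have "\<bar>d p\<bar> \<le> 1" for p using k by (auto simp: d_def of_bool_def)
  moreover have "d p = 0" if "p < 2" for p using that by (auto simp: d_def dest: prime_ge_2_nat)
  ultimately have "((\<lambda>t. \<Sum>p. d p * prime_weight (1 + t) p) \<longlongrightarrow> 0) (at_right 0)"
    by (intro sum_prime_weight_tendsto_0) auto
  moreover have "((\<lambda>t. k * ln (t * ?Z t)) \<longlongrightarrow> k * 0) (at_right 0)"
  proof (intro tendsto_mult tendsto_const)
    have lower: "\<forall>\<^sub>F t in at_right (0::real). 0 \<le> ln (t * ?Z t)"
      unfolding eventually_at_filter
    proof (intro always_eventually allI impI)
      fix t :: real assume "t \<noteq> 0" "t \<in> {0<..}"
      then show "0 \<le> ln (t * ?Z t)" using zeta_bounds(1)[of t] by (intro ln_ge_zero) (simp add: field_simps)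
    qed
    have upper: "\<forall>\<^sub>F t in at_right (0::real). ln (t * ?Z t) \<le> ln (1 + t)"
      unfolding eventually_at_filter
    proof (intro always_eventually allI impI)
      fix t :: real assume "t \<noteq> 0" "t \<in> {0<..}"
      then have t: "t > 0" by simp
      have "t * (1 / t) \<le> t * ?Z t" "t * ?Z t \<le> t * (1 + 1 / t)"
        using zeta_bounds[OF t] t by (intro mult_left_mono; simp)+
      then show "ln (t * ?Z t) \<le> ln (1 + t)" using t by (subst ln_le_cancel_iff) (auto simp: algebra_simps)
    qed
    have lim_upper: "((\<lambda>t::real. ln (1 + t)) \<longlongrightarrow> 0) (at_right 0)" by real_asymp
    show "((\<lambda>t. ln (t * ?Z t)) \<longlongrightarrow> 0) (at_right 0)"
      by (rule tendsto_sandwich[OF lower upper tendsto_const lim_upper])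
  qed
  ultimately have "((\<lambda>t. exp ((\<Sum>p. d p * prime_weight (1 + t) p) + k * ln (t * ?Z t))) \<longlongrightarrow> 1) (at_right 0)"
    using tendsto_exp[OF tendsto_add] by fastforce
  moreover have "\<forall>\<^sub>F t in at_right 0. exp ((\<Sum>p. d p * prime_weight (1 + t) p) + k * ln (t * ?Z t)) = t powr k * ?F t"
    unfolding eventually_at_filter
  proof (intro always_eventually allI impI)
    fix t :: real assume "t \<noteq> 0" "t \<in> {0<..}"
    then have t: "t > 0" by simp
    have Z: "?Z t > 0" using zeta_bounds(1)[OF t] t by (meson divide_pos_pos less_le_trans zero_less_one)
    have "1 \<in> gen P" by (simp add: gen_def)
    then have F: "?F t \<ge> 1"
      using finite_sum_le_infsum[OF summable_on_powr[of "1 + t" "gen P"], of "{1}"] t by simp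
    have "(\<lambda>p. if p \<in> P then prime_weight (1 + t) p else 0) sums ln (?F t)"
      using t P by (intro euler_product) auto
    moreover have "(\<lambda>p. k * (if p \<in> {p. prime p} then prime_weight (1 + t) p else 0)) sums (k * ln (?Z t))"
      using t euler_product[of "1 + t" "{p. prime p}"] by (intro sums_mult) (auto simp: gen_primes)
    ultimately have "(\<lambda>p. (if p \<in> P then prime_weight (1 + t) p else 0) - k * (if p \<in> {p. prime p} then prime_weight (1 + t) p else 0))
        sums (ln (?F t) - k * ln (?Z t))" by (rule sums_diff)
    also have "(\<lambda>p. (if p \<in> P then prime_weight (1 + t) p else 0) - k * (if p \<in> {p. prime p} then prime_weight (1 + t) p else 0))
        = (\<lambda>p. d p * prime_weight (1 + t) p)"
      using P by (auto simp: d_def fun_eq_iff algebra_simps)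
    finally have "(\<Sum>p. d p * prime_weight (1 + t) p) = ln (?F t) - k * ln (?Z t)"
      by (rule sums_unique[symmetric])
    moreover have "ln (t * ?Z t) = ln t + ln (?Z t)" using t Z by (simp add: ln_mult)
    ultimately have "(\<Sum>p. d p * prime_weight (1 + t) p) + k * ln (t * ?Z t) = ln (?F t) + k * ln t"
      by (simp add: algebra_simps)
    then show "exp ((\<Sum>p. d p * prime_weight (1 + t) p) + k * ln (t * ?Z t)) = t powr k * ?F t"
      using t F by (simp add: exp_add powr_def)
  qed
  ultimately show ?thesis by (rule Lim_transform_eventually)
qed

theorem reciprocal_sum_gen:
  assumes P: "\<And>p. p \<in> P \<Longrightarrow> prime p" and k: "0 < k" "k \<le> 1"
    and lim: "(\<lambda>n. \<Sum>p | p \<le> n \<and> prime p. (of_bool (p \<in> P) - k) * prime_weight 1 p) \<longlonglongrightarrow> 0"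
  shows "(\<lambda>N. (\<Sum>n\<in>gen P \<inter> {..N}. 1 / real n) / ln (real N) powr k) \<longlonglongrightarrow> 1 / Gamma (k + 1)"
proof -
  define b :: "nat \<Rightarrow> real" where "b n = of_bool (n \<in> gen P) / real n" for n
  have eq: "b n * exp (-(t * ln (real n))) = (if n \<in> gen P then real n powr -(1 + t) else 0)" for n t
  proof (cases "n \<in> gen P")
    case True
    then have n: "real n > 0" using gen_pos by simp
    have "-(1 + t) * ln (real n) = - ln (real n) + -(t * ln (real n))" by (simp add: algebra_simps)
    then have "real n powr -(1 + t) = 1 / real n * exp (-(t * ln (real n)))"
      using n by (simp only: powr_def exp_add exp_minus[of "ln (real n)"]) (simp add: inverse_eq_divide)
    then show ?thesis using True by (simp add: b_def)
  qed (simp add: b_def)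
  have sums: "(\<lambda>n. b n * exp (-(t * ln (real n)))) sums (\<Sum>\<^sub>\<infinity>n\<in>gen P. real n powr -(1 + t))" if "t > 0" for t
    unfolding eq using that by (intro summable_on_imp_sums summable_on_powr) auto
  interpret karamata b "\<lambda>n. ln (real n)" k
  proof
    show "0 \<le> ln (real n)" for n by (cases n) auto
    show "summable (\<lambda>n. b n * exp (-(t * ln (real n))))" if "t > 0" for t
      using sums[OF that] by (rule sums_summable)
    show "((\<lambda>t. t powr k * (\<Sum>n. b n * exp (-(t * ln (real n))))) \<longlongrightarrow> 1) (at_right 0)"
    proof (rule Lim_transform_eventually)
      show "((\<lambda>t. t powr k * (\<Sum>\<^sub>\<infinity>n\<in>gen P. real n powr -(1 + t))) \<longlongrightarrow> 1) (at_right 0)"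
        using k by (intro dirichlet_series_gen_tendsto P lim) auto
      show "\<forall>\<^sub>F t in at_right 0. t powr k * (\<Sum>\<^sub>\<infinity>n\<in>gen P. real n powr -(1 + t)) = t powr k * (\<Sum>n. b n * exp (-(t * ln (real n))))"
        unfolding eventually_at_filter
        using sums[THEN sums_unique] by (intro always_eventually allI impI) simp
    qed
  qed (use k in \<open>auto simp: b_def\<close>)
  have "filterlim (\<lambda>N::nat. ln (real N)) at_top sequentially" by real_asymp
  then have "(\<lambda>N. S (ln (real N)) / ln (real N) powr k) \<longlonglongrightarrow> 1 / Gamma (k + 1)"
    using tauberian by (rule filterlim_compose[rotated])
  moreover have "\<forall>\<^sub>F N in sequentially. S (ln (real N)) / ln (real N) powr k = (\<Sum>n\<in>gen P \<inter> {..N}. 1 / real n) / ln (real N) powr k"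
    using eventually_gt_at_top[of 0]
  proof eventually_elim
    case (elim N)
    have "S (ln (real N)) = (\<Sum>n\<in>gen P \<inter> {..N}. b n * indicator {..ln (real N)} (ln (real n)))"
      unfolding S_def
    proof (rule suminf_finite)
      fix n assume n: "n \<notin> gen P \<inter> {..N}"
      show "b n * indicator {..ln (real N)} (ln (real n)) = 0"
        using n elim gen_pos[of n P] by (cases "n \<in> gen P") (auto simp: b_def indicator_def)
    qed auto
    also have "\<dots> = (\<Sum>n\<in>gen P \<inter> {..N}. 1 / real n)"
      using elim by (intro sum.cong) (auto simp: b_def indicator_def dest: gen_pos)
    finally show ?case by simp
  qed
  ultimately show ?thesis by (rule Lim_transform_eventually)
qed

section \<open>From the logarithmic average to the counting function\<close>

text \<open>For \<open>A = gen P\<close> only powers of primes in \<open>P\<close> count, which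
  gives the Chebyshev function of this class; \<open>A = {0<..}\<close> gives the classical
  function.\<close>

definition psi :: "nat set \<Rightarrow> nat \<Rightarrow> real" where
  "psi A n = (\<Sum>d\<in>A \<inter> {1..n}. mangoldt d)"

text \<open>Writes \<open>ln n\<close> as a divisor sum of \<open>mangoldt\<close> and puts
  \<open>n = a * d\<close>. Both cofactors stay in \<open>gen P\<close>, which is closed under
  products and divisors, so the same set indexes the outer sum.\<close>

lemma sum_ln_gen:
  "(\<Sum>n\<in>gen P \<inter> {..N}. ln (real n)) = (\<Sum>a\<in>gen P \<inter> {..N}. psi (gen P) (N div a))"
proof -
  have "(\<Sum>n\<in>gen P \<inter> {..N}. ln (real n)) = (\<Sum>n\<in>gen P \<inter> {..N}. \<Sum>d | d dvd n. mangoldt d)"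
    using mangoldt_sum[where 'a = real] by (intro sum.cong refl) (auto dest: gen_pos)
  also have "\<dots> = (\<Sum>(n, d)\<in>(SIGMA n:gen P \<inter> {..N}. {d. d dvd n}). mangoldt d)"
    by (intro sum.Sigma) (auto dest!: gen_pos)
  also have "\<dots> = (\<Sum>(a, d)\<in>(SIGMA a:gen P \<inter> {..N}. gen P \<inter> {1..N div a}). mangoldt d)"
  proof (rule sum.reindex_bij_witness[of _ "\<lambda>(a, d). (a * d, d)" "\<lambda>(n, d). (n div d, d)"], goal_cases)
    case (2 x)
    then obtain n d where x: "x = (n, d)" "n \<in> gen P" "n \<le> N" "d dvd n" by auto
    then obtain a where n: "n = a * d" by (metis dvd_def mult.commute)
    have pos: "a > 0" "d > 0" using gen_pos[OF x(2)] n by auto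
    have "a \<in> gen P" "d \<in> gen P" using x(2) gen_mult_iff[OF pos] n by auto
    moreover have "a \<le> N" using x(3) n pos by (metis dvd_imp_le dvd_triv_left nat_0_less_mult_iff order_trans)
    moreover have "1 \<le> d" using pos by auto
    moreover have "d \<le> N div a" using x(3) n pos by (simp add: less_eq_div_iff_mult_less_eq mult.commute)
    ultimately show ?case using x n pos by auto
  next
    case (4 x)
    then obtain a d where x: "x = (a, d)" "a \<in> gen P" "a \<le> N" "d \<in> gen P" "1 \<le> d" "d \<le> N div a" by auto
    have "a > 0" "d > 0" using gen_pos x by auto
    then have "a * d \<in> gen P" "a * d \<le> N"
      using x by (auto simp: gen_mult_iff less_eq_div_iff_mult_less_eq mult.commute)
    then show ?case using x by auto
  qed (auto dest: gen_pos)
  also have "\<dots> = (\<Sum>a\<in>gen P \<inter> {..N}. psi (gen P) (N div a))"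
    unfolding psi_def by (rule sum.Sigma[symmetric]) auto
  finally show ?thesis .
qed

lemma ln_fact_conv_sum: "ln (fact N) = (\<Sum>n=1..N. ln (real n))"
proof -
  have "ln (\<Prod>n=1..N. real n) = (\<Sum>n=1..N. ln (real n))" by (rule ln_prod) auto
  then show ?thesis by (simp add: fact_prod)
qed

lemma sum_psi_div: "(\<Sum>m=1..N. psi {0<..} (N div m)) = ln (fact N)"
proof -
  have "{0<..} \<inter> {..N} = {1..N}" by auto
  then have "(\<Sum>m=1..N. psi {0<..} (N div m)) = (\<Sum>n=1..N. ln (real n))"
    using sum_ln_gen[of "{p. prime p}" N] by (simp add: gen_primes)
  then show ?thesis by (simp add: ln_fact_conv_sum)
qed

text \<open>Legendre's sieve: removing the multiples of one prime after the other.\<close>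
lemma sieve_bound:
  fixes f B :: "real \<Rightarrow> real"
  assumes "finite Q" "\<And>q. q \<in> Q \<Longrightarrow> prime q"
    and B: "\<And>y. y \<ge> 1 \<Longrightarrow> 0 \<le> B y" "\<And>y. y \<ge> 1 \<Longrightarrow> \<bar>\<Sum>m | m > 0 \<and> real m \<le> y. f (y / real m)\<bar> \<le> B y"
  shows "\<bar>\<Sum>m | m > 0 \<and> real m \<le> x \<and> (\<forall>q\<in>Q. \<not> q dvd m). f (x / real m)\<bar> \<le> (\<Sum>d | d \<in> gen Q \<and> real d \<le> x. B (x / real d))"
  using assms(1,2)
proof (induction Q arbitrary: x rule: finite_induct)
  case empty
  show ?case
  proof (cases "x \<ge> 1")
    case True
    then have "{d. d \<in> gen {} \<and> real d \<le> x} = {1}" by (auto simp: gen_empty)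
    then show ?thesis using B(2)[OF True] by simp
  next
    case False
    then have "{m. m > 0 \<and> real m \<le> x \<and> (\<forall>q\<in>{}. \<not> q dvd m)} = {}" by auto
    moreover have "{d. d \<in> gen {} \<and> real d \<le> x} = {}" using False by (auto simp: gen_empty)
    ultimately show ?thesis by (simp only: sum.empty abs_zero)
  qed
next
  case (insert p Q)
  have p: "prime p" using insert by simp
  then have p0: "p > 0" by (rule prime_gt_0_nat)
  define C where "C x = {m. m > 0 \<and> real m \<le> x \<and> (\<forall>q\<in>Q. \<not> q dvd m)}" for x
  define D where "D x = {d. d \<in> gen Q \<and> real d \<le> x}" for x
  have IH: "\<bar>\<Sum>m\<in>C x. f (x / real m)\<bar> \<le> (\<Sum>d\<in>D x. B (x / real d))" for x
    using insert by (simp add: C_def D_def)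
  have fin: "finite {m. m > 0 \<and> real m \<le> x}" for x
    by (rule finite_subset[of _ "{..nat \<lfloor>x\<rfloor>}"]) (auto simp: le_nat_floor)
  have finC: "finite (C x)" for x by (rule finite_subset[OF _ fin[of x]]) (auto simp: C_def)
  have finD: "finite (D x)" for x by (rule finite_subset[OF _ fin[of x]]) (auto simp: D_def dest: gen_pos)
  have finD': "finite {d. d \<in> gen (insert p Q) \<and> real d \<le> x}"
    by (rule finite_subset[OF _ fin[of x]]) (auto dest: gen_pos)
  have div_le: "real m \<le> x / real p \<longleftrightarrow> real (p * m) \<le> x" for m
    using p0 by (simp add: field_simps)
  have ndvd: "q dvd p * m \<longleftrightarrow> q dvd m" if "q \<in> Q" for q m
    using that insert p by (metis insertI1 insertI2 prime_dvd_mult_iff primes_dvd_imp_eq dvd_mult)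
  \<comment> \<open>\<open>p\<close> lies outside \<open>Q\<close>, so multiplying by
    \<open>p\<close> does not affect divisibility by the primes of \<open>Q\<close>: the multiples
    of \<open>p\<close> are a copy of the same sifted set at \<open>x / p\<close>. Hence the
    induction is over all \<open>x\<close>.\<close>
  have C_split: "C x = {m \<in> C x. \<not> p dvd m} \<union> (\<lambda>m. p * m) ` C (x / real p)"
  proof (intro equalityI subsetI)
    fix m assume m: "m \<in> C x"
    show "m \<in> {m \<in> C x. \<not> p dvd m} \<union> (\<lambda>m. p * m) ` C (x / real p)"
    proof (cases "p dvd m")
      case True
      then obtain m' where "m = p * m'" by auto
      then show ?thesis using m div_le[of m'] ndvd by (auto simp: C_def)
    qed (use m in auto)
  next
    fix m assume "m \<in> {m \<in> C x. \<not> p dvd m} \<union> (\<lambda>m. p * m) ` C (x / real p)"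
    then show "m \<in> C x" using div_le ndvd p0 by (auto simp: C_def)
  qed
  have "(\<Sum>m\<in>C x. f (x / real m)) = (\<Sum>m\<in>{m \<in> C x. \<not> p dvd m}. f (x / real m)) + (\<Sum>m\<in>(\<lambda>m. p * m) ` C (x / real p). f (x / real m))"
    by (subst C_split, rule sum.union_disjoint) (use finC in auto)
  also have "(\<Sum>m\<in>(\<lambda>m. p * m) ` C (x / real p). f (x / real m)) = (\<Sum>m\<in>C (x / real p). f (x / real p / real m))"
    using p0 by (subst sum.reindex) (auto simp: inj_on_def)
  finally have "(\<Sum>m\<in>{m \<in> C x. \<not> p dvd m}. f (x / real m)) =
      (\<Sum>m\<in>C x. f (x / real m)) - (\<Sum>m\<in>C (x / real p). f (x / real p / real m))" by simp
  then have "\<bar>\<Sum>m\<in>{m \<in> C x. \<not> p dvd m}. f (x / real m)\<bar> \<le> (\<Sum>d\<in>D x. B (x / real d)) + (\<Sum>d\<in>D (x / real p). B (x / real p / real d))"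
    using IH[of x] IH[of "x / real p"] by linarith
  also have "(\<Sum>d\<in>D (x / real p). B (x / real p / real d)) = (\<Sum>d\<in>(\<lambda>d. p * d) ` D (x / real p). B (x / real d))"
    using p0 by (subst sum.reindex) (auto simp: inj_on_def)
  also have "(\<Sum>d\<in>D x. B (x / real d)) + \<dots> = (\<Sum>d\<in>D x \<union> (\<lambda>d. p * d) ` D (x / real p). B (x / real d))"
  proof (rule sum.union_disjoint[symmetric])
    have "\<not> p dvd d" if "d \<in> gen Q" for d
    proof
      assume "p dvd d"
      then have "p \<in> prime_factors d" using p gen_pos[OF that] by (simp add: in_prime_factors_iff)
      then show False using that insert(2) by (auto simp: gen_def)
    qed
    then have "p * d \<notin> D x" for d unfolding D_def by (metis (no_types, lifting) dvd_triv_left mem_Collect_eq)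
    then show "D x \<inter> (\<lambda>d. p * d) ` D (x / real p) = {}" by blast
  qed (use finD in auto)
  also have "\<dots> \<le> (\<Sum>d | d \<in> gen (insert p Q) \<and> real d \<le> x. B (x / real d))"
  \<comment> \<open>The target also contains \<open>d\<close> divisible by \<open>p ^ 2\<close>,
    which inclusion-exclusion never produces. Admitting these nonnegative terms keeps the index set
    simple and does no harm, since \<open>B\<close> is only logarithmic in the application.\<close>
  proof (rule sum_mono2[OF finD'])
    have "d \<in> gen (insert p Q)" if "d \<in> gen Q" for d using that by (auto simp: gen_def)
    moreover have "p * d \<in> gen (insert p Q)" if "d \<in> gen Q" for d
      using that p p0 prime_power_in_gen[of p "insert p Q" 1] gen_pos[OF that]
      by (auto simp: gen_mult_iff) (auto simp: gen_def)
    ultimately show "D x \<union> (\<lambda>d. p * d) ` D (x / real p) \<subseteq> {d. d \<in> gen (insert p Q) \<and> real d \<le> x}"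
      using div_le by (auto simp: D_def)
    fix d assume "d \<in> {d. d \<in> gen (insert p Q) \<and> real d \<le> x} - (D x \<union> (\<lambda>d. p * d) ` D (x / real p))"
    then show "0 \<le> B (x / real d)" by (intro B(1)) (auto dest!: gen_pos simp: field_simps)
  qed
  finally show ?case by (simp add: C_def conj_ac)
qed

text \<open>The increment of \<open>E\<close> is
  \<open>ln (n + 1) - harm n + euler_mascheroni\<close>, between 0 and \<open>1 / (n + 1)\<close>.
  The constant is forced: \<open>ln (fact n)\<close> is about \<open>n * ln n - n\<close>, while
  \<open>n * harm n\<close> is about \<open>n * ln n + euler_mascheroni * n\<close>.\<close>

lemma ln_fact_harm_bounds:
  defines "E \<equiv> (\<lambda>n. ln (fact n) - real n * harm n + (1 + euler_mascheroni) * real n :: real)"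
  shows "0 \<le> E n \<and> E n \<le> harm n"
proof (induction n)
  case 0
  show ?case by (simp add: E_def harm_def)
next
  case (Suc n)
  have "E (Suc n) = E n + (ln (real n + 1) - harm n + euler_mascheroni)"
  proof -
    have "ln (fact (Suc n)) = ln (real n + 1) + ln (fact n)"
      by (simp add: ln_mult add.commute)
    moreover have "real (Suc n) * harm (Suc n) = real n * harm n + harm n + 1"
      by (simp add: harm_Suc field_simps)
    ultimately show ?thesis by (simp add: E_def algebra_simps)
  qed
  moreover have "0 \<le> ln (real n + 1) - harm n + euler_mascheroni \<and>
    ln (real n + 1) - harm n + euler_mascheroni \<le> inverse (real n + 1)"
  proof (cases "n \<ge> 1")
    case True
    have "inverse (real (2 * n)) \<le> inverse (real n + 1)"
      using True by (intro le_imp_inverse_le) auto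
    moreover have "inverse (real (2 * (n + 1))) \<ge> 0" by simp
    moreover have "euler_mascheroni \<in> {harm n - ln (real n + 1) + inverse (real (2 * (n + 1)))..
        harm n - ln (real n + 1) + inverse (real (2 * n))}"
      using euler_mascheroni_bounds[OF True] by (simp add: add.commute)
    ultimately show "0 \<le> ln (real n + 1) - harm n + euler_mascheroni \<and>
      ln (real n + 1) - harm n + euler_mascheroni \<le> inverse (real n + 1)"
      unfolding atLeastAtMost_iff by linarith
  next
    case False
    then have "n = 0" by simp
    then show "0 \<le> ln (real n + 1) - harm n + euler_mascheroni \<and>
      ln (real n + 1) - harm n + euler_mascheroni \<le> inverse (real n + 1)"
      using euler_mascheroni_pos euler_mascheroni_less_13_over_22 by (auto simp: harm_def)
  qed
  ultimately show ?case using Suc by (simp add: harm_Suc add.commute)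
qed

lemma harm_le: "n > 0 \<Longrightarrow> harm n \<le> 1 + ln (real n)"
  using euler_mascheroni_sequence_decreasing[of 1 n] by (simp add: harm_def)

text \<open>Makes the logarithmic errors of the sieve add up to \<open>O(N)\<close>: the sum is
  \<open>N * ln N - ln (fact N)\<close>, at most \<open>1 + euler_mascheroni < 2\<close> times
  \<open>N\<close>.\<close>

lemma sum_ln_div_le: "(\<Sum>d=1..N. ln (real N / real d)) \<le> 2 * real N"
proof -
  have "(\<Sum>d=1..N. ln (real N / real d)) = real N * ln (real N) - (\<Sum>d=1..N. ln (real d))"
    by (simp add: ln_div sum_subtractf)
  also have "(\<Sum>d=1..N. ln (real d)) = ln (fact N)"
    by (rule ln_fact_conv_sum[symmetric])
  finally have "(\<Sum>d=1..N. ln (real N / real d)) = real N * ln (real N) - ln (fact N)" .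
  moreover have "ln (fact N) \<ge> real N * harm N - (1 + euler_mascheroni) * real N"
    using ln_fact_harm_bounds[of N] by simp
  moreover have "ln (real N) \<le> harm N" if "N > 0"
  proof -
    have "ln (real N) \<le> ln (real N + 1)" using that by simp
    then show ?thesis using ln_le_harm[of N] by linarith
  qed
  then have "real N * ln (real N) \<le> real N * harm N"
    by (cases "N = 0") (auto intro!: mult_left_mono)
  moreover have "(1 + euler_mascheroni) * real N \<le> 2 * real N"
    using euler_mascheroni_less_13_over_22 by (intro mult_right_mono) auto
  ultimately show ?thesis by linarith
qed

text \<open>The \<open>psi\<close> terms add up to \<open>ln (fact N)\<close>, where
  \<open>N\<close> is the floor of \<open>y\<close>. What remains is the quantity of
  \<open>ln_fact_harm_bounds\<close> minus \<open>(y - N) * harm N\<close>; both lie between 0 and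
  \<open>harm N\<close>. The argument is real because the sieve rescales it.\<close>

lemma sum_psi_error:
  fixes y :: real
  assumes "y \<ge> 1"
  shows "\<bar>\<Sum>m | m > 0 \<and> real m \<le> y. psi {0<..} (nat \<lfloor>y / real m\<rfloor>) - y / real m + (1 + euler_mascheroni)\<bar> \<le> 1 + ln y"
proof -
  define N where "N = nat \<lfloor>y\<rfloor>"
  have N: "N \<ge> 1" "real N \<le> y" "y < real N + 1" using assms by (auto simp: N_def le_nat_floor)
  have set: "{m. m > 0 \<and> real m \<le> y} = {1..N}" by (auto simp: N_def le_nat_floor) (use N in \<open>simp add: N_def; linarith\<close>)
  have fl: "nat \<lfloor>y / real m\<rfloor> = N div m" for m
    using floor_divide_real_eq_div[of "int m" y] assms by (simp add: N_def nat_div_distrib)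
  have "(\<Sum>m=1..N. psi {0<..} (N div m) - y / real m + (1 + euler_mascheroni)) =
      ln (fact N) - y * harm N + (1 + euler_mascheroni) * real N"
    by (simp add: sum.distrib sum_subtractf sum_psi_div harm_def sum_distrib_left divide_inverse del: One_nat_def)
  also have "\<dots> = (ln (fact N) - real N * harm N + (1 + euler_mascheroni) * real N) - (y - real N) * harm N"
    by (simp add: algebra_simps)
  finally have eq: "(\<Sum>m=1..N. psi {0<..} (N div m) - y / real m + (1 + euler_mascheroni)) =
      (ln (fact N) - real N * harm N + (1 + euler_mascheroni) * real N) - (y - real N) * harm N" .
  have "\<bar>\<Sum>m=1..N. psi {0<..} (N div m) - y / real m + (1 + euler_mascheroni)\<bar> \<le> harm N"
  proof -
    have "0 \<le> (y - real N) * harm N" "(y - real N) * harm N \<le> 1 * harm N"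
      using N harm_nonneg[of N, where 'a = real] by (auto intro!: mult_right_mono)
    then show ?thesis using ln_fact_harm_bounds[of N] by (simp only: eq abs_le_iff) linarith
  qed
  also have "harm N \<le> 1 + ln (real N)" using N by (intro harm_le) simp
  also have "\<dots> \<le> 1 + ln y" using N by simp
  finally show ?thesis by (simp only: set fl)
qed

lemma card_gen_le: "card (gen P \<inter> {..N}) \<le> N"
proof -
  have "gen P \<inter> {..N} \<subseteq> {1..N}" by (auto dest!: gen_pos)
  from card_mono[OF _ this] show ?thesis by simp
qed

text \<open>Sifting by the primes up to \<open>N\<close> outside \<open>P\<close> leaves exactly
  \<open>gen P\<close>. Of the constant 5, the sieve takes 3 (\<open>1 + ln (N / d)\<close> summed
  over \<open>d \<le> N\<close>), and taking the shift \<open>1 + euler_mascheroni < 2\<close> out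
  again takes 2.\<close>

lemma sum_psi_gen:
  assumes P: "\<And>p. p \<in> P \<Longrightarrow> prime p"
  shows "\<bar>(\<Sum>a\<in>gen P \<inter> {..N}. psi {0<..} (N div a)) - real N * (\<Sum>a\<in>gen P \<inter> {..N}. 1 / real a)\<bar> \<le> 5 * real N"
proof -
  define Q where "Q = {q. prime q \<and> q \<le> N \<and> q \<notin> P}"
  have Q: "finite Q" by (rule finite_subset[of _ "{..N}"]) (auto simp: Q_def)
  have set: "{m. m > 0 \<and> real m \<le> real N \<and> (\<forall>q\<in>Q. \<not> q dvd m)} = gen P \<inter> {..N}"
  proof (intro equalityI subsetI)
    fix m assume m: "m \<in> {m. m > 0 \<and> real m \<le> real N \<and> (\<forall>q\<in>Q. \<not> q dvd m)}"
    have "q \<in> P" if "q \<in> prime_factors m" for q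
    proof (rule ccontr)
      assume "q \<notin> P"
      moreover have "prime q" "q dvd m" "q \<le> N"
        using that m dvd_imp_le[of q m] by (auto simp: in_prime_factors_iff)
      ultimately show False using m by (auto simp: Q_def)
    qed
    then show "m \<in> gen P \<inter> {..N}" using m by (auto simp: gen_def)
  next
    fix m assume m: "m \<in> gen P \<inter> {..N}"
    then show "m \<in> {m. m > 0 \<and> real m \<le> real N \<and> (\<forall>q\<in>Q. \<not> q dvd m)}"
      by (auto simp: gen_def Q_def in_prime_factors_iff)
  qed
  let ?f = "\<lambda>y. psi {0<..} (nat \<lfloor>y\<rfloor>) - y + (1 + euler_mascheroni)"
  have "\<bar>\<Sum>m | m > 0 \<and> real m \<le> real N \<and> (\<forall>q\<in>Q. \<not> q dvd m). ?f (real N / real m)\<bar> \<le> (\<Sum>d | d \<in> gen Q \<and> real d \<le> real N. 1 + ln (real N / real d))"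
    using Q sum_psi_error by (intro sieve_bound) (auto simp: Q_def)
  also have "\<dots> \<le> (\<Sum>d=1..N. 1 + ln (real N / real d))"
    by (intro sum_mono2) (auto dest: gen_pos simp: Suc_le_eq intro!: add_nonneg_nonneg ln_ge_zero)
  also have "\<dots> \<le> 3 * real N" using sum_ln_div_le[of N] by (simp add: sum.distrib)
  finally have "\<bar>\<Sum>a\<in>gen P \<inter> {..N}. ?f (real N / real a)\<bar> \<le> 3 * real N" by (simp only: set)
  moreover have "(\<Sum>a\<in>gen P \<inter> {..N}. ?f (real N / real a)) = (\<Sum>a\<in>gen P \<inter> {..N}. psi {0<..} (N div a)) -
      real N * (\<Sum>a\<in>gen P \<inter> {..N}. 1 / real a) + (1 + euler_mascheroni) * real (card (gen P \<inter> {..N}))"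
    by (simp add: sum.distrib sum_subtractf sum_distrib_left floor_divide_of_nat_eq)
  moreover have "(1 + euler_mascheroni) * real (card (gen P \<inter> {..N})) \<le> 2 * real N"
    using euler_mascheroni_less_13_over_22 card_gen_le[of P N] by (intro mult_mono) auto
  moreover have "0 \<le> (1 + euler_mascheroni) * real (card (gen P \<inter> {..N}))"
    using euler_mascheroni_pos by (intro mult_nonneg_nonneg) auto
  ultimately show ?thesis by linarith
qed

text \<open>From \<open>ln N = ln a + ln (N / a)\<close>: the first part becomes a sum of
  \<open>psi (gen P)\<close>, which is compared with \<open>k * psi {0<..}\<close> and that with
  \<open>k * N / a\<close>; the second sums to at most \<open>2 * N\<close>. The 7 is this 2 plus
  the 5 of \<open>sum_psi_gen\<close>.\<close>

lemma card_gen_bound: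
  fixes k e C :: real
  assumes P: "\<And>p. p \<in> P \<Longrightarrow> prime p" and k: "0 \<le> k" "k \<le> 1" and C: "C \<ge> 0"
    and psi: "\<And>n. \<bar>psi (gen P) n - k * psi {0<..} n\<bar> \<le> e * real n + C"
  shows "\<bar>real (card (gen P \<inter> {..N})) * ln (real N) - k * real N * (\<Sum>a\<in>gen P \<inter> {..N}. 1 / real a)\<bar>
           \<le> e * real N * (\<Sum>a\<in>gen P \<inter> {..N}. 1 / real a) + (C + 7) * real N"
proof -
  let ?G = "gen P \<inter> {..N}"
  let ?L = "\<Sum>a\<in>?G. 1 / real a"
  have card: "card ?G \<le> N" by (rule card_gen_le)
  \<comment> \<open>A negative slope would make the bound in \<open>psi\<close> negative for large
    \<open>n\<close>.\<close>
  have e: "e \<ge> 0"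
  proof (rule ccontr)
    assume "\<not> e \<ge> 0"
    then obtain n :: nat where "real n * (- e) > C" using reals_Archimedean3[of "- e"] by auto
    then show False using psi[of n] by (simp add: algebra_simps)
  qed
  have "(\<Sum>a\<in>?G. ln (real N)) = (\<Sum>a\<in>?G. ln (real a) + ln (real N / real a))"
    by (intro sum.cong refl) (auto simp: ln_div dest!: gen_pos)
  then have 1: "real (card ?G) * ln (real N) = (\<Sum>a\<in>?G. psi (gen P) (N div a)) + (\<Sum>a\<in>?G. ln (real N / real a))"
    by (simp add: sum.distrib sum_ln_gen)
  have 2: "0 \<le> (\<Sum>a\<in>?G. ln (real N / real a))"
    by (intro sum_nonneg ln_ge_zero) (auto dest: gen_pos)
  have "(\<Sum>a\<in>?G. ln (real N / real a)) \<le> (\<Sum>d=1..N. ln (real N / real d))"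
    by (intro sum_mono2 ln_ge_zero) (auto dest: gen_pos simp: Suc_le_eq)
  then have 3: "(\<Sum>a\<in>?G. ln (real N / real a)) \<le> 2 * real N" using sum_ln_div_le by (rule order_trans)
  have "\<bar>(\<Sum>a\<in>?G. psi (gen P) (N div a)) - k * (\<Sum>a\<in>?G. psi {0<..} (N div a))\<bar> =
      \<bar>\<Sum>a\<in>?G. psi (gen P) (N div a) - k * psi {0<..} (N div a)\<bar>"
    by (simp add: sum_subtractf sum_distrib_left)
  also have "\<dots> \<le> (\<Sum>a\<in>?G. e * (real N * (1 / real a)) + C)"
  proof (intro sum_abs[THEN order_trans] sum_mono)
    fix a assume "a \<in> ?G"
    have "real (N div a) \<le> real N * (1 / real a)" using of_nat_div_le_of_nat[of N a, where 'a = real] by simp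
    then have "e * real (N div a) \<le> e * (real N * (1 / real a))" using e by (rule mult_left_mono)
    then show "\<bar>psi (gen P) (N div a) - k * psi {0<..} (N div a)\<bar> \<le> e * (real N * (1 / real a)) + C"
      using psi[of "N div a"] by linarith
  qed
  also have "\<dots> = e * real N * ?L + C * real (card ?G)"
    by (simp add: sum.distrib sum_distrib_left mult.assoc)
  also have "C * real (card ?G) \<le> C * real N" using C card by (intro mult_left_mono) auto
  finally have 4: "\<bar>(\<Sum>a\<in>?G. psi (gen P) (N div a)) - k * (\<Sum>a\<in>?G. psi {0<..} (N div a))\<bar> \<le> e * real N * ?L + C * real N"
    by simp
  have "\<bar>k * ((\<Sum>a\<in>?G. psi {0<..} (N div a)) - real N * ?L)\<bar> \<le> 1 * (5 * real N)"
    unfolding abs_mult using k sum_psi_gen[OF P] by (intro mult_mono) auto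
  then have 5: "\<bar>k * (\<Sum>a\<in>?G. psi {0<..} (N div a)) - k * real N * ?L\<bar> \<le> 5 * real N"
    by (simp add: algebra_simps)
  show ?thesis unfolding 1 using 2 3 4 5 by (simp add: algebra_simps)
qed

text \<open>Division of \<open>card_gen_bound\<close> by \<open>N * ln N powr k\<close>: the error
  \<open>(C + 7) * N\<close> disappears because \<open>k > 0\<close>, and the error with
  \<open>e\<close> is small because the logarithmic averages eventually stay below
  \<open>\<bar>c\<bar> + 1\<close>.\<close>

theorem card_gen_tendsto:
  fixes k c :: real
  assumes P: "\<And>p. p \<in> P \<Longrightarrow> prime p" and k: "0 < k" "k \<le> 1"
    and psi: "\<And>e. e > 0 \<Longrightarrow> \<exists>C\<ge>0. \<forall>n. \<bar>psi (gen P) n - k * psi {0<..} n\<bar> \<le> e * real n + C"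
    and L: "(\<lambda>N. (\<Sum>a\<in>gen P \<inter> {..N}. 1 / real a) / ln (real N) powr k) \<longlonglongrightarrow> c"
  shows "(\<lambda>N. real (card (gen P \<inter> {..N})) * (ln (real N) powr (1 - k) / real N)) \<longlonglongrightarrow> k * c"
proof -
  let ?L = "\<lambda>N. \<Sum>a\<in>gen P \<inter> {..N}. 1 / real a"
  let ?X = "\<lambda>N. real (card (gen P \<inter> {..N})) * (ln (real N) powr (1 - k) / real N)"
  let ?Y = "\<lambda>N. k * (?L N / ln (real N) powr k)"
  have "(\<lambda>N. ?X N - ?Y N) \<longlonglongrightarrow> 0"
  proof (rule LIMSEQ_I)
    fix r :: real assume r: "r > 0"
    define e where "e = r / (2 * (\<bar>c\<bar> + 1))"
    have e: "e > 0" using r by (simp add: e_def)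
    obtain C where C: "C \<ge> 0" "\<And>n. \<bar>psi (gen P) n - k * psi {0<..} n\<bar> \<le> e * real n + C" using psi[OF e] by blast
    have "\<forall>\<^sub>F N in sequentially. ?L N / ln (real N) powr k < \<bar>c\<bar> + 1"
      using L by (rule order_tendstoD) linarith
    moreover have "(\<lambda>N. (C + 7) / ln (real N) powr k) \<longlonglongrightarrow> 0" using k C by real_asymp
    then have "\<forall>\<^sub>F N in sequentially. (C + 7) / ln (real N) powr k < r / 2"
      by (rule order_tendstoD) (use r in simp)
    moreover have "\<forall>\<^sub>F N::nat in sequentially. N \<ge> 3" by (rule eventually_ge_at_top)
    ultimately have "\<forall>\<^sub>F N in sequentially. norm (?X N - ?Y N - 0) < r"
    proof eventually_elim
      case (elim N)
      have l: "ln (real N) > 0" using elim by simp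
      define q where "q = ln (real N) powr k"
      have q: "q > 0" using l by (simp add: q_def)
      have X: "?X N = real (card (gen P \<inter> {..N})) * ln (real N) / (real N * q)"
        using l by (simp add: powr_diff q_def)
      have "?X N - ?Y N = (real (card (gen P \<inter> {..N})) * ln (real N) - k * real N * ?L N) / (real N * q)"
        unfolding X using elim q by (simp add: q_def[symmetric] field_simps)
      then have "\<bar>?X N - ?Y N\<bar> = \<bar>real (card (gen P \<inter> {..N})) * ln (real N) - k * real N * ?L N\<bar> / (real N * q)"
        using q by (simp add: abs_divide abs_mult)
      also have "\<dots> \<le> (e * real N * ?L N + (C + 7) * real N) / (real N * q)"
        using k C q by (intro divide_right_mono card_gen_bound[OF P]) auto
      also have "\<dots> = e * (?L N / q) + (C + 7) / q"
        using elim q by (simp add: field_simps)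
      also have "\<dots> < e * (\<bar>c\<bar> + 1) + r / 2"
        using elim e unfolding q_def by (intro add_le_less_mono mult_left_mono) auto
      also have "e * (\<bar>c\<bar> + 1) = r / 2" unfolding e_def by (simp add: field_simps add_pos_nonneg)
      finally show ?case by simp
    qed
    then show "\<exists>n0. \<forall>N\<ge>n0. norm (?X N - ?Y N - 0) < r" by (simp add: eventually_sequentially)
  qed
  moreover have "?Y \<longlonglongrightarrow> k * c" using L by (rule tendsto_mult_left)
  ultimately have "(\<lambda>N. (?X N - ?Y N) + ?Y N) \<longlonglongrightarrow> 0 + k * c" by (rule tendsto_add)
  then show ?thesis by simp
qed

section \<open>Balanced sets of primes: the Chebyshev function\<close>

text \<open>\<open>1 / prime_weight 1 n\<close> lies between \<open>n - 1\<close> and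
  \<open>n\<close>, so it grows by at most 2 per step, while \<open>ln\<close> grows by at most
  \<open>1 / n\<close>.\<close>

lemma ln_over_prime_weight_diff:
  assumes "n \<ge> 2"
  defines "r \<equiv> (\<lambda>n. ln (real n) / prime_weight 1 n)"
  shows "\<bar>r n - r (Suc n)\<bar> \<le> 2 * ln (real n + 1) + 1"
proof -
  let ?u = "1 / prime_weight 1 n" and ?v = "1 / prime_weight 1 (Suc n)"
  have b: "0 < 1 / real n" "1 / real n \<le> prime_weight 1 n" "prime_weight 1 n \<le> 1 / (real n - 1)"
    "1 / real (Suc n) \<le> prime_weight 1 (Suc n)" "prime_weight 1 (Suc n) \<le> 1 / real n"
    "0 < 1 / real (Suc n)"
    using prime_weight_1_bounds[of n] prime_weight_1_bounds[of "Suc n"] assms by auto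
  have pos: "prime_weight 1 n > 0" "prime_weight 1 (Suc n) > 0" using b by linarith+
  have u: "real n - 1 \<le> ?u" "?u \<le> real n" and v: "real n \<le> ?v" "?v \<le> real n + 1"
    using b pos assms by (auto simp: field_simps)
  have l: "0 \<le> ln (real n + 1)" "0 \<le> ln (real n + 1) - ln (real n)" using assms by auto
  have "ln (real n + 1) - ln (real n) = ln (1 + 1 / real n)"
  proof -
    have "real n + 1 = real n * (1 + 1 / real n)" using assms by (simp add: field_simps)
    moreover have "ln (real n * (1 + 1 / real n)) = ln (real n) + ln (1 + 1 / real n)"
      using assms by (intro ln_mult_pos) (auto intro: add_pos_nonneg)
    ultimately have "ln (real n + 1) = ln (real n) + ln (1 + 1 / real n)" by metis
    then show ?thesis by simp
  qed
  also have "\<dots> \<le> 1 / real n" by (rule ln_add_one_self_le_self) simp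
  finally have l2: "ln (real n + 1) - ln (real n) \<le> 1 / real n" .
  have "r (Suc n) - r n = ln (real n + 1) * (?v - ?u) + (ln (real n + 1) - ln (real n)) * ?u"
    by (simp add: r_def algebra_simps)
  moreover have "0 \<le> ln (real n + 1) * (?v - ?u)" using l u v by (intro mult_nonneg_nonneg) auto
  moreover have "ln (real n + 1) * (?v - ?u) \<le> ln (real n + 1) * 2" using l u v by (intro mult_left_mono) auto
  moreover have "0 \<le> (ln (real n + 1) - ln (real n)) * ?u" using l u pos by (intro mult_nonneg_nonneg) auto
  moreover have "(ln (real n + 1) - ln (real n)) * ?u \<le> 1 / real n * real n"
    using l2 u l pos by (intro mult_mono) auto
  moreover have "1 / real n * real n = 1" using assms by simp
  ultimately show ?thesis by linarith
qed

lemma tendsto_0_imp_sum_le: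
  fixes u :: "nat \<Rightarrow> real"
  assumes "u \<longlonglongrightarrow> 0" "e > 0"
  shows "\<exists>C\<ge>0. \<forall>n. (\<Sum>k<n. \<bar>u k\<bar>) \<le> e * real n + C"
proof -
  obtain M where M: "\<And>n. n \<ge> M \<Longrightarrow> \<bar>u n\<bar> < e" using LIMSEQ_D[OF assms] by auto
  have "(\<Sum>k<n. \<bar>u k\<bar>) \<le> e * real n + (\<Sum>k<M. \<bar>u k\<bar>)" for n
  proof (induction n)
    case (Suc n)
    show ?case
    proof (cases "n \<ge> M")
      case True
      then show ?thesis using Suc M[of n] by (simp add: algebra_simps)
    next
      case False
      then have "(\<Sum>k<Suc n. \<bar>u k\<bar>) \<le> (\<Sum>k<M. \<bar>u k\<bar>)" by (intro sum_mono2) auto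
      moreover have "0 \<le> e * real (Suc n)" using assms(2) by simp
      ultimately show ?thesis by linarith
    qed
  qed (auto intro: sum_nonneg)
  then show ?thesis by (intro exI[of _ "\<Sum>k<M. \<bar>u k\<bar>"]) (auto intro: sum_nonneg)
qed

text \<open>Partial summation from the weights $-\ln(1-1/p)$ to the weights $\ln p$.\<close>
lemma sum_mult_ln_le:
  fixes d :: "nat \<Rightarrow> real"
  assumes d: "\<And>n. n < 2 \<Longrightarrow> d n = 0"
    and lim: "(\<lambda>n. (\<Sum>k\<le>n. d k * prime_weight 1 k) * ln (real n)) \<longlonglongrightarrow> 0" and e: "e > 0"
  shows "\<exists>C\<ge>0. \<forall>n. \<bar>\<Sum>k\<le>n. d k * ln (real k)\<bar> \<le> e * real n + C"
proof -
  define D where "D n = (\<Sum>k\<le>n. d k * prime_weight 1 k)" for n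
  define r where "r n = ln (real n) / prime_weight 1 n" for n :: nat
  have w_pos: "prime_weight 1 n > 0" if "n \<ge> 2" for n
    using prime_weight_1_bounds(1)[OF that] that by (simp add: less_le_trans[of 0 "1 / real n"])
  \<comment> \<open>Summation by parts with \<open>ln k = prime_weight 1 k * r k\<close>. It starts
    at 2, since the weight at 1 is the degenerate \<open>- ln 0\<close>.\<close>
  have parts: "(\<Sum>k\<le>n. d k * ln (real k)) = D n * r n + (\<Sum>k=2..<n. D k * (r k - r (Suc k)))" if "n \<ge> 2" for n
    using that
  proof (induction n rule: dec_induct)
    case base
    have "(\<Sum>k\<le>2. d k * ln (real k)) = d 2 * ln 2" "D 2 = d 2 * prime_weight 1 2"
      using d by (simp_all add: D_def numeral_2_eq_2)
    then show ?case using w_pos[of 2] by (simp add: r_def)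
  next
    case (step n)
    have "d (Suc n) * ln (real (Suc n)) = d (Suc n) * prime_weight 1 (Suc n) * r (Suc n)"
      using w_pos[of "Suc n"] step by (simp add: r_def)
    then show ?case using step by (simp add: D_def algebra_simps)
  qed
  \<comment> \<open>The increments of \<open>r\<close> are of logarithmic size, so the sum needs
    \<open>D n * ln n\<close>, not just \<open>D n\<close>, to vanish; this is what the logarithm in
    \<open>lim\<close> pays for.\<close>
  define u where "u n = D n * (2 * ln (real n + 1) + 1)" for n
  have "D \<longlonglongrightarrow> 0" and u: "u \<longlonglongrightarrow> 0"
  proof -
    have "(\<lambda>n::nat. 1 / ln (real n)) \<longlonglongrightarrow> 0" by real_asymp
    then have "(\<lambda>n. D n * ln (real n) * (1 / ln (real n))) \<longlonglongrightarrow> 0 * 0"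
      using lim unfolding D_def by (intro tendsto_mult)
    moreover have "\<forall>\<^sub>F n in sequentially. D n * ln (real n) * (1 / ln (real n)) = D n"
      using eventually_ge_at_top[of 2] by eventually_elim simp
    ultimately show D0: "D \<longlonglongrightarrow> 0" by (simp add: tendsto_cong)
    have "(\<lambda>n::nat. (2 * ln (real n + 1) + 1) / ln (real n)) \<longlonglongrightarrow> 2" by real_asymp
    then have "(\<lambda>n. D n * ln (real n) * ((2 * ln (real n + 1) + 1) / ln (real n))) \<longlonglongrightarrow> 0 * 2"
      using lim unfolding D_def by (intro tendsto_mult)
    moreover have "\<forall>\<^sub>F n in sequentially. D n * ln (real n) * ((2 * ln (real n + 1) + 1) / ln (real n)) = u n"
      using eventually_ge_at_top[of 2] by eventually_elim (simp add: u_def)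
    ultimately show "u \<longlonglongrightarrow> 0" by (simp add: tendsto_cong)
  qed
  obtain C1 where C1: "C1 \<ge> 0" "\<And>n. (\<Sum>k<n. \<bar>u k\<bar>) \<le> e / 2 * real n + C1"
    using tendsto_0_imp_sum_le[OF u, of "e / 2"] e by auto
  obtain M where M: "\<And>n. n \<ge> M \<Longrightarrow> \<bar>D n * ln (real n)\<bar> < e / 2"
    using LIMSEQ_D[OF lim, of "e / 2"] e unfolding D_def by auto
  define C2 where "C2 = (\<Sum>n<M. \<bar>D n * ln (real n)\<bar> * real n)"
  have C2: "\<bar>D n * ln (real n)\<bar> * real n \<le> e / 2 * real n + C2" for n
  proof (cases "n \<ge> M")
    case True
    have "\<bar>D n * ln (real n)\<bar> * real n \<le> e / 2 * real n"
      using M[OF True] by (intro mult_right_mono) auto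
    moreover have "C2 \<ge> 0" unfolding C2_def by (intro sum_nonneg) auto
    ultimately show ?thesis by linarith
  next
    case False
    then have "\<bar>D n * ln (real n)\<bar> * real n \<le> C2"
      unfolding C2_def by (intro member_le_sum[of n "{..<M}" "\<lambda>n. \<bar>D n * ln (real n)\<bar> * real n"]) auto
    moreover have "0 \<le> e / 2 * real n" using e by simp
    ultimately show ?thesis by linarith
  qed
  have "\<bar>\<Sum>k\<le>n. d k * ln (real k)\<bar> \<le> e * real n + (C1 + C2)" for n
  proof (cases "n \<ge> 2")
    case True
    have "\<bar>D n * r n\<bar> \<le> \<bar>D n * ln (real n)\<bar> * real n"
    proof -
      have "1 / prime_weight 1 n \<le> real n"
        using prime_weight_1_bounds(1)[OF True] w_pos[OF True] True by (simp add: field_simps)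
      then have "\<bar>D n * ln (real n)\<bar> * (1 / prime_weight 1 n) \<le> \<bar>D n * ln (real n)\<bar> * real n"
        by (rule mult_left_mono) simp
      then show ?thesis using w_pos[OF True] by (simp add: r_def abs_mult)
    qed
    moreover have "\<bar>\<Sum>k=2..<n. D k * (r k - r (Suc k))\<bar> \<le> (\<Sum>k<n. \<bar>u k\<bar>)"
    proof -
      have "\<bar>\<Sum>k=2..<n. D k * (r k - r (Suc k))\<bar> \<le> (\<Sum>k=2..<n. \<bar>u k\<bar>)"
      proof (intro sum_abs[THEN order_trans] sum_mono)
        fix k assume k: "k \<in> {2..<n}"
        then have "\<bar>r k - r (Suc k)\<bar> \<le> 2 * ln (real k + 1) + 1"
          using ln_over_prime_weight_diff[of k] by (simp add: r_def)
        then have "\<bar>D k\<bar> * \<bar>r k - r (Suc k)\<bar> \<le> \<bar>D k\<bar> * \<bar>2 * ln (real k + 1) + 1\<bar>"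
          by (intro mult_left_mono) auto
        then show "\<bar>D k * (r k - r (Suc k))\<bar> \<le> \<bar>u k\<bar>" by (simp add: u_def abs_mult)
      qed
      also have "\<dots> \<le> (\<Sum>k<n. \<bar>u k\<bar>)" by (intro sum_mono2) auto
      finally show ?thesis .
    qed
    ultimately show ?thesis using parts[OF True] C1(2)[of n] C2[of n] by linarith
  next
    case False
    then have "(\<Sum>k\<le>n. d k * ln (real k)) = 0" using d by (intro sum.neutral) auto
    moreover have "C2 \<ge> 0" unfolding C2_def by (intro sum_nonneg) auto
    ultimately show ?thesis using C1 e by simp
  qed
  moreover have "C2 \<ge> 0" unfolding C2_def by (intro sum_nonneg) auto
  ultimately show ?thesis using C1(1) by (intro exI[of _ "C1 + C2"]) auto
qed

text \<open>Proper prime powers \<open>p ^ k \<le> n\<close> have \<open>p \<le> sqrt n\<close> and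
  \<open>k \<le> log 2 n\<close>; counting both coordinates from 0 gives the two summands 1.\<close>

lemma sum_mangoldt_nonprime_le:
  assumes "n \<ge> 1"
  shows "(\<Sum>d | d \<in> {1..n} \<and> \<not> prime d. mangoldt d) \<le> (sqrt (real n) + 1) * (log 2 (real n) + 1) * ln (real n)"
proof -
  define D where "D = {d \<in> {1..n}. primepow d \<and> \<not> prime d}"
  let ?X = "{..nat \<lfloor>sqrt (real n)\<rfloor>} \<times> {..nat \<lfloor>log 2 (real n)\<rfloor>}"
  have log0: "log 2 (real n) \<ge> 0" using assms by simp
  have "D \<subseteq> (\<lambda>(p, k). p ^ k) ` ?X"
  proof
    fix d assume d: "d \<in> D"
    then obtain p k where p: "prime p" "k > 0" "d = p ^ k" by (auto simp: D_def primepow_def)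
    have k: "k \<ge> 2" using d p by (cases "k = 1") (auto simp: D_def)
    have dn: "p ^ k \<le> n" using d p by (auto simp: D_def)
    have "p ^ 2 \<le> p ^ k" using k prime_gt_0_nat[OF p(1)] by (intro power_increasing) auto
    then have "real (p ^ 2) \<le> real n" using dn by (simp only: of_nat_le_iff)
    then have "real p \<le> sqrt (real n)" by (intro real_le_rsqrt) simp
    moreover have "2 ^ k \<le> p ^ k" using prime_ge_2_nat[OF p(1)] by (intro power_mono) auto
    then have "real (2 ^ k) \<le> real n" using dn by (simp only: of_nat_le_iff)
    then have "real k \<le> log 2 (real n)" using assms by (simp add: le_log_iff powr_realpow)
    ultimately have "(p, k) \<in> ?X" by (simp add: le_nat_floor)
    then show "d \<in> (\<lambda>(p, k). p ^ k) ` ?X" using p(3) by (intro image_eqI[of _ _ "(p, k)"]) auto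
  qed
  then have "card D \<le> card ?X" by (rule surj_card_le[rotated]) simp
  then have "real (card D) \<le> real (card ?X)" by (simp only: of_nat_le_iff)
  also have "\<dots> = (real (nat \<lfloor>sqrt (real n)\<rfloor>) + 1) * (real (nat \<lfloor>log 2 (real n)\<rfloor>) + 1)"
    by (simp only: card_cartesian_product card_atMost of_nat_mult of_nat_Suc add.commute)
  also have "\<dots> \<le> (sqrt (real n) + 1) * (log 2 (real n) + 1)"
    using log0 by (intro mult_mono) auto
  finally have card: "real (card D) \<le> (sqrt (real n) + 1) * (log 2 (real n) + 1)" .
  have "(\<Sum>d | d \<in> {1..n} \<and> \<not> prime d. mangoldt d) = (\<Sum>d\<in>D. mangoldt d :: real)"
    by (rule sum.mono_neutral_right) (auto simp: D_def mangoldt_def)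
  also have "\<dots> \<le> (\<Sum>d\<in>D. ln (real n))"
  proof (rule sum_mono)
    fix d assume "d \<in> D"
    then have "d > 0" "d \<le> n" by (auto simp: D_def)
    then have "mangoldt d \<le> ln (real d)" "ln (real d) \<le> ln (real n)" by (auto intro: mangoldt_le)
    then show "mangoldt d \<le> ln (real n)" by linarith
  qed
  also have "\<dots> = real (card D) * ln (real n)" by simp
  also have "\<dots> \<le> (sqrt (real n) + 1) * (log 2 (real n) + 1) * ln (real n)"
    using card assms by (intro mult_right_mono) auto
  finally show ?thesis .
qed

text \<open>Primes are handled by partial summation; higher prime powers are too few to matter,
  whatever their class. The form \<open>e * n + C\<close> holds for all \<open>n\<close>, because
  \<open>psi\<close> is later evaluated at every \<open>N div a\<close>, including small
  values.\<close>

theorem psi_gen_bound: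
  fixes k :: real
  assumes P: "\<And>p. p \<in> P \<Longrightarrow> prime p" and k: "0 \<le> k" "k \<le> 1" and e: "e > 0"
    and lim: "(\<lambda>n. (\<Sum>p | p \<le> n \<and> prime p. (of_bool (p \<in> P) - k) * prime_weight 1 p) * ln (real n)) \<longlonglongrightarrow> 0"
  shows "\<exists>C\<ge>0. \<forall>n. \<bar>psi (gen P) n - k * psi {0<..} n\<bar> \<le> e * real n + C"
proof -
  define d :: "nat \<Rightarrow> real" where "d p = (if prime p then of_bool (p \<in> P) - k else 0)" for p
  have "(\<Sum>p | p \<le> n \<and> prime p. (of_bool (p \<in> P) - k) * prime_weight 1 p) = (\<Sum>p\<le>n. d p * prime_weight 1 p)" for n
    by (rule sum.mono_neutral_cong_left) (auto simp: d_def)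
  then have lim': "(\<lambda>n. (\<Sum>p\<le>n. d p * prime_weight 1 p) * ln (real n)) \<longlonglongrightarrow> 0" using lim by simp
  have d0: "d n = 0" if "n < 2" for n using that prime_ge_2_nat[of n] by (auto simp: d_def)
  obtain C1 where C1: "C1 \<ge> 0" "\<And>n. \<bar>\<Sum>p\<le>n. d p * ln (real p)\<bar> \<le> e / 2 * real n + C1"
    using sum_mult_ln_le[OF d0 lim', of "e / 2"] e by auto
  define b where "b n = (sqrt (real n) + 1) * (log 2 (real n) + 1) * ln (real n)" for n :: nat
  have "(\<lambda>n. b n / real n) \<longlonglongrightarrow> 0" unfolding b_def by real_asymp
  then obtain M where M: "\<And>n. n \<ge> M \<Longrightarrow> \<bar>b n / real n\<bar> < e / 2"
    using LIMSEQ_D[of "\<lambda>n. b n / real n" 0 "e / 2"] e by auto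
  define C2 where "C2 = (\<Sum>n<M. \<bar>b n\<bar>)"
  have C2: "C2 \<ge> 0" unfolding C2_def by (intro sum_nonneg) auto
  have b: "b n \<le> e / 2 * real n + C2" if "n \<ge> 1" for n
  proof (cases "n \<ge> M")
    case True
    then have "b n / real n < e / 2" using M[of n] by linarith
    then have "b n < e / 2 * real n" using that by (simp add: field_simps)
    then show ?thesis using C2 by linarith
  next
    case False
    then have "\<bar>b n\<bar> \<le> C2" unfolding C2_def by (intro member_le_sum) auto
    moreover have "0 \<le> e / 2 * real n" using e by simp
    ultimately show ?thesis by linarith
  qed
  have "\<bar>psi (gen P) n - k * psi {0<..} n\<bar> \<le> e * real n + (C1 + C2)" for n
  proof (cases "n \<ge> 1")
    case True
    let ?g = "\<lambda>m. (of_bool (m \<in> gen P) - k) * mangoldt m :: real"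
    have "psi (gen P) n = (\<Sum>m=1..n. of_bool (m \<in> gen P) * mangoldt m)"
      unfolding psi_def by (rule sum.mono_neutral_cong_left) auto
    moreover have "psi {0<..} n = (\<Sum>m=1..n. mangoldt m)"
      unfolding psi_def by (rule sum.cong) auto
    ultimately have "psi (gen P) n - k * psi {0<..} n = (\<Sum>m=1..n. ?g m)"
      by (simp add: sum_subtractf sum_distrib_left algebra_simps)
    also have "\<dots> = (\<Sum>m | m \<in> {1..n} \<and> prime m. ?g m) + (\<Sum>m | m \<in> {1..n} \<and> \<not> prime m. ?g m)"
      by (subst sum.union_disjoint[symmetric]) (auto intro!: sum.cong)
    also have "(\<Sum>m | m \<in> {1..n} \<and> prime m. ?g m) = (\<Sum>p\<le>n. d p * ln (real p))"
    proof (rule sum.mono_neutral_cong_left)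
      fix p assume p: "p \<in> {m. m \<in> {1..n} \<and> prime m}"
      then have "p \<in> gen P \<longleftrightarrow> p \<in> P" by (auto simp: gen_def prime_factorization_prime prime_gt_0_nat)
      then show "?g p = d p * ln (real p)" using p by (simp add: d_def)
    qed (auto simp: d_def Suc_le_eq prime_gt_0_nat)
    finally have eq: "psi (gen P) n - k * psi {0<..} n =
      (\<Sum>p\<le>n. d p * ln (real p)) + (\<Sum>m | m \<in> {1..n} \<and> \<not> prime m. ?g m)" .
    have "\<bar>\<Sum>m | m \<in> {1..n} \<and> \<not> prime m. ?g m\<bar> \<le> (\<Sum>m | m \<in> {1..n} \<and> \<not> prime m. mangoldt m)"
    proof (intro sum_abs[THEN order_trans] sum_mono)
      fix m
      have "\<bar>of_bool (m \<in> gen P) - k\<bar> * mangoldt m \<le> 1 * mangoldt m"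
        using k by (intro mult_right_mono mangoldt_nonneg) (auto simp: of_bool_def)
      then show "\<bar>?g m\<bar> \<le> mangoldt m" by (simp add: abs_mult)
    qed
    also have "\<dots> \<le> b n" unfolding b_def using True by (rule sum_mangoldt_nonprime_le)
    also have "\<dots> \<le> e / 2 * real n + C2" using True by (rule b)
    finally show ?thesis unfolding eq using C1(2)[of n] by linarith
  next
    case False
    then have "psi (gen P) n = 0" "psi {0<..} n = 0" by (auto simp: psi_def)
    then show ?thesis using C1 C2 e by simp
  qed
  then show ?thesis using C1(1) C2 by (intro exI[of _ "C1 + C2"]) auto
qed

section \<open>The greedy partition of the primes\<close>

text \<open>Item \<open>k\<close> of weight \<open>v k\<close> goes to the class in \<open>{1..h}\<close> of least load; \<open>load n\<close> counts the
  items below \<open>n\<close>.\<close>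
primrec load :: "(nat \<Rightarrow> real) \<Rightarrow> nat \<Rightarrow> nat \<Rightarrow> nat \<Rightarrow> real" where
  "load v h 0 = (\<lambda>_. 0)"
| "load v h (Suc n) = (load v h n)(arg_min_on (load v h n) {1..h} := load v h n (arg_min_on (load v h n) {1..h}) + v n)"

declare load.simps(2) [simp del]

definition greedy_class :: "(nat \<Rightarrow> real) \<Rightarrow> nat \<Rightarrow> nat \<Rightarrow> nat" where
  "greedy_class v h n = arg_min_on (load v h n) {1..h}"

section \<open>Load balancing by the greedy rule\<close>

context
  fixes v :: "nat \<Rightarrow> real" and h :: nat
  assumes v_nonneg: "\<And>k. v k \<ge> 0" and h: "h \<ge> 1"
begin

lemma greedy_class_in: "greedy_class v h n \<in> {1..h}"
  unfolding greedy_class_def using h by (intro arg_min_if_finite(1)) auto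

lemma load_greedy_class_le: "j \<in> {1..h} \<Longrightarrow> load v h n (greedy_class v h n) \<le> load v h n j"
  unfolding greedy_class_def using h by (intro arg_min_least) auto

lemma load_Suc: "load v h (Suc n) i = load v h n i + (if i = greedy_class v h n then v n else 0)"
  by (simp add: load.simps(2) greedy_class_def)

lemma load_eq_sum: "load v h n i = (\<Sum>k<n. if greedy_class v h k = i then v k else 0)"
proof (induction n)
  case (Suc n)
  then show ?case unfolding load_Suc by auto
qed simp

lemma sum_load: "(\<Sum>i=1..h. load v h n i) = (\<Sum>k<n. v k)"
proof (induction n)
  case (Suc n)
  then show ?case using greedy_class_in[of n] unfolding load_Suc by (simp add: sum.distrib sum.delta)
qed simp

lemma load_mono: "m \<le> n \<Longrightarrow> load v h m i \<le> load v h n i"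
  unfolding load_eq_sum using v_nonneg by (intro sum_mono2) auto

text \<open>The class that receives an item was the least loaded, so it rises above any other class
  by no more than that item.\<close>

lemma load_spread_le:
  assumes w: "\<And>k. v k \<le> w" and "i \<in> {1..h}" "j \<in> {1..h}"
  shows "load v h n i - load v h n j \<le> w"
proof (induction n)
  case 0
  show ?case using v_nonneg[of 0] w[of 0] by simp
next
  case (Suc n)
  show ?case
    using Suc load_greedy_class_le[OF assms(3), of n] w[of n] v_nonneg[of n] unfolding load_Suc by auto
qed

text \<open>When class \<open>i\<close> receives an item of weight at most \<open>V\<close>, it has
  been the least loaded, so its lead is at most \<open>V\<close>. While it receives nothing more,
  the lead can only shrink.\<close>

lemma load_unchanged_or_spread_le:
  assumes V: "\<And>k. k \<ge> m \<Longrightarrow> v k \<le> V" and "m \<le> n"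
  shows "load v h n i = load v h m i \<or> (\<forall>j\<in>{1..h}. load v h n i - load v h n j \<le> V)"
  using assms(2)
proof (induction n rule: dec_induct)
  case (step n)
  show ?case
  proof (cases "i = greedy_class v h n")
    case True
    have "load v h (Suc n) i - load v h (Suc n) j \<le> V" if "j \<in> {1..h}" for j
    proof -
      have "load v h (Suc n) i = load v h n i + v n" using True by (simp add: load_Suc)
      moreover have "load v h n i \<le> load v h n j" using load_greedy_class_le[OF that] True by simp
      moreover have "load v h n j \<le> load v h (Suc n) j" by (rule load_mono) simp
      moreover have "v n \<le> V" using V step.hyps by simp
      ultimately show ?thesis by linarith
    qed
    then show ?thesis by blast
  next
    case False
    have "load v h n j \<le> load v h (Suc n) j" for j by (rule load_mono) simp
    then have le: "load v h (Suc n) i - load v h (Suc n) j \<le> load v h n i - load v h n j" for j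
      using False by (simp add: load_Suc[of n i])
    have "load v h (Suc n) i = load v h n i" using False by (simp add: load_Suc)
    with step.IH le show ?thesis by (metis order_trans)
  qed
qed simp

text \<open>If class \<open>i\<close> received nothing since \<open>m\<close>, comparison with it at
  times \<open>m\<close> and \<open>n\<close> limits the growth of every class to
  \<open>2 * w\<close>, and the total to \<open>2 * h * w\<close>. Enough new weight therefore
  erases the early imbalance and leaves only the size of late items.\<close>

lemma load_spread_late:
  assumes w: "\<And>k. v k \<le> w" and V: "\<And>k. k \<ge> m \<Longrightarrow> v k \<le> V" and "m \<le> n"
    and big: "(\<Sum>k=m..<n. v k) > 2 * real h * w" and ij: "i \<in> {1..h}" "j \<in> {1..h}"
  shows "load v h n i - load v h n j \<le> V"
proof -
  have "load v h n i \<noteq> load v h m i"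
  proof
    assume eq: "load v h n i = load v h m i"
    have "(\<Sum>k=m..<n. v k) = (\<Sum>k<n. v k) - (\<Sum>k<m. v k)"
      using assms(3) sum.atLeastLessThan_concat[of 0 m n v] by (simp add: atLeast0LessThan)
    also have "\<dots> = (\<Sum>l=1..h. load v h n l - load v h m l)"
      by (simp add: sum_load sum_subtractf del: One_nat_def)
    also have "\<dots> \<le> (\<Sum>l=1..h. 2 * w)"
    proof (rule sum_mono)
      fix l assume l: "l \<in> {1..h}"
      show "load v h n l - load v h m l \<le> 2 * w"
        using load_spread_le[OF w l ij(1), of n] load_spread_le[OF w ij(1) l, of m] eq by simp
    qed
    also have "\<dots> = 2 * real h * w" by simp
    finally show False using big by simp
  qed
  then show ?thesis using load_unchanged_or_spread_le[OF V assms(3), of i] ij by blast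
qed

lemma load_minus_mean_le:
  assumes "\<And>i j. i \<in> {1..h} \<Longrightarrow> j \<in> {1..h} \<Longrightarrow> load v h n i - load v h n j \<le> V" and "i \<in> {1..h}"
  shows "\<bar>load v h n i - (\<Sum>k<n. v k) / real h\<bar> \<le> V"
proof -
  have "load v h n i - (\<Sum>k<n. v k) / real h = (\<Sum>j=1..h. load v h n i - load v h n j) / real h"
    using h by (simp add: sum_subtractf sum_load field_simps del: One_nat_def)
  moreover have "\<bar>\<Sum>j=1..h. load v h n i - load v h n j\<bar> \<le> (\<Sum>j=1..h. V)"
  proof (intro sum_abs[THEN order_trans] sum_mono)
    fix j assume "j \<in> {1..h}"
    then show "\<bar>load v h n i - load v h n j\<bar> \<le> V"
      using assms(1)[of i j] assms(1)[of j i] assms(2) by linarith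
  qed
  ultimately show ?thesis using h by (simp add: field_simps)
qed

end

text \<open>Mertens' lower bound: the exponential of the sum is the Euler product at 1 over primes
  up to \<open>n\<close>, which is at least the harmonic sum.\<close>

lemma sum_prime_weight_lower:
  assumes "n \<ge> 2"
  shows "ln (ln (real n)) \<le> (\<Sum>p | p \<le> n \<and> prime p. prime_weight 1 p)"
proof -
  let ?P = "{p. prime p}"
  have l: "ln (real n) > 0" using assms by simp
  have set: "gen ?P \<inter> {..n} = {1..n}" by (auto simp: gen_primes)
  have "ln (real n) \<le> ln (real n + 1)" using assms by simp
  also have "\<dots> \<le> harm n" by (rule ln_le_harm)
  also have "harm n = (\<Sum>m\<in>gen ?P \<inter> {..n}. real m powr -1)"
    by (simp add: set harm_def powr_minus)
  also have "\<dots> \<le> (\<Prod>p\<in>?P \<inter> {..n}. 1 / (1 - real p powr -1))"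
    by (rule sum_powr_gen_le) auto
  also have "\<dots> = exp (\<Sum>p\<in>?P \<inter> {..n}. prime_weight 1 p)"
    by (rule exp_sum_prime_weight) (auto simp: prime_ge_2_nat)
  also have "?P \<inter> {..n} = {p. p \<le> n \<and> prime p}" by auto
  finally have "ln (ln (real n)) \<le> ln (exp (\<Sum>p | p \<le> n \<and> prime p. prime_weight 1 p))"
    using l by (subst ln_le_cancel_iff) auto
  then show ?thesis by simp
qed

text \<open>Crude but sufficient: bounding over all odd numbers telescopes to
  \<open>ln n / 2\<close>. The factor 1/2 matters, for the sum up to about
  \<open>(ln n) powr (3/2)\<close> must stay well below \<open>ln (ln n)\<close>; it makes the
  coefficient 3/4.\<close>

lemma sum_prime_weight_upper:
  assumes "n \<ge> 1"
  shows "(\<Sum>p | p \<le> n \<and> prime p. prime_weight 1 p) \<le> 1 + ln (real n) / 2"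
proof -
  define v where "v p = (if prime p then prime_weight 1 p else 0)" for p
  have w: "prime_weight 1 p = - ln (1 - 1 / real p)" for p
    by (simp add: prime_weight_def powr_minus_divide)
  have v2: "v 2 \<le> 1" using ln_2_less_1 ln_div[of 1 2] by (simp add: v_def w)
  have v_even: "v p = 0" if "even p" "p > 2" for p
    using that primes_dvd_imp_eq[of 2 p] by (auto simp: v_def)
  have v_odd: "v p \<le> (ln (real p) - ln (real p - 2)) / 2" if "p \<ge> 3" for p
  proof (cases "prime p")
    case True
    have p: "real p \<ge> 3" using that by simp
    have "2 * prime_weight 1 p = - ln ((1 - 1 / real p) ^ 2)"
      unfolding w using p by (subst ln_realpow) auto
    also have "\<dots> \<le> - ln ((real p - 2) / real p)"
    proof -
      have "(real p - 2) / real p \<le> (1 - 1 / real p) ^ 2"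
        using p by (simp add: power2_eq_square field_simps)
      then show ?thesis using p by (subst neg_le_iff_le, subst ln_le_cancel_iff) auto
    qed
    also have "\<dots> = ln (real p) - ln (real p - 2)" using p by (subst ln_div) auto
    finally show ?thesis using True by (simp add: v_def)
  next
    case False
    then show ?thesis using that by (simp add: v_def)
  qed
  have odd: "(\<Sum>p\<le>2*m+1. v p) \<le> v 2 + ln (real (2*m+1)) / 2" for m
  proof (induction m)
    case 0
    show ?case using v2 by (simp add: v_def prime_weight_nonneg w)
  next
    case (Suc m)
    have "(\<Sum>p\<le>2*Suc m+1. v p) = (\<Sum>p\<le>2*m+1. v p) + v (2*m+2) + v (2*m+3)"
      by (simp add: numeral_3_eq_3)
    moreover have "v (2*m+3) \<le> (ln (real (2*m+3)) - ln (real (2*m+1))) / 2"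
      using v_odd[of "2*m+3"] by simp
    moreover have "(\<Sum>p\<le>2*m+1. v p) + v (2*m+2) \<le> v 2 + ln (real (2*m+1)) / 2"
    proof (cases "m = 0")
      case True
      then show ?thesis by (simp add: v_def numeral_2_eq_2)
    next
      case False
      then show ?thesis using Suc v_even[of "2*m+2"] by simp
    qed
    ultimately show ?case by (simp add: field_simps)
  qed
  have "(\<Sum>p\<le>n. v p) \<le> v 2 + ln (real n) / 2"
  proof (cases "odd n")
    case True
    then show ?thesis using odd[of "n div 2"] by simp
  next
    case False
    then obtain m where m: "n = 2 * m + 2"
      using assms by (metis add_2_eq_Suc' dvdE mult_Suc_right not_one_le_zero old.nat.exhaust mult_0_right mult_2 add_2_eq_Suc)
    show ?thesis
    proof (cases "m = 0")
      case True
      have "(\<Sum>p\<le>2. v p) = v 2" by (simp add: numeral_2_eq_2 v_def)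
      moreover have "n = 2" using m True by simp
      ultimately show ?thesis by simp
    next
      case False
      have "(\<Sum>p\<le>n. v p) = (\<Sum>p\<le>2*m+1. v p)" using m False v_even[of "2*m+2"] by simp
      moreover have "ln (real (2*m+1)) \<le> ln (real n)" using m by simp
      ultimately show ?thesis using odd[of m] by linarith
    qed
  qed
  moreover have "(\<Sum>p | p \<le> n \<and> prime p. prime_weight 1 p) = (\<Sum>p\<le>n. v p)"
    by (rule sum.mono_neutral_cong_left) (auto simp: v_def)
  ultimately show ?thesis using v2 by linarith
qed

theorem exists_balanced_prime_classes:
  assumes "h \<ge> 1"
  obtains P :: "nat \<Rightarrow> nat set"
  where "\<And>p. prime p \<Longrightarrow> \<exists>i\<in>{1..h}. p \<in> P i" "\<And>i p. p \<in> P i \<Longrightarrow> prime p"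
    "\<And>i. i \<in> {1..h} \<Longrightarrow> (\<lambda>n. (\<Sum>p | p \<le> n \<and> prime p. (of_bool (p \<in> P i) - 1 / real h) * prime_weight 1 p) * ln (real n)) \<longlonglongrightarrow> 0"
proof -
  \<comment> \<open>All naturals are items; a nonprime has weight 0 and changes no load.\<close>
  define v where "v p = (if prime p then prime_weight 1 p else 0)" for p
  have v_prime: "v p = prime_weight 1 p" if "prime p" for p using that by (simp add: v_def)
  have v_nonprime: "v p = 0" if "\<not> prime p" for p using that by (simp add: v_def)
  have v_nonneg: "v p \<ge> 0" for p by (simp add: v_def prime_weight_nonneg prime_ge_2_nat)
  have v_le: "v p \<le> 1 / (real m - 1)" if "p \<ge> m" "m \<ge> 2" for p m
  proof (cases "prime p")
    case True
    have "prime_weight 1 p \<le> 1 / (real p - 1)"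
      using prime_weight_1_bounds(2)[of p] that by simp
    also have "\<dots> \<le> 1 / (real m - 1)" using that by (intro divide_left_mono mult_pos_pos) auto
    finally show ?thesis using True by (simp add: v_def)
  next
    case False
    then show ?thesis using that by (simp add: v_def)
  qed
  have v_le1: "v p \<le> 1" for p
  proof (cases "prime p")
    case True
    then show ?thesis using v_le[of 2 p] prime_ge_2_nat by simp
  qed (simp add: v_def)
  define P where "P i = {p. prime p \<and> greedy_class v h p = i}" for i
  have v_sum: "(\<Sum>k\<le>n. v k) = (\<Sum>p | p \<le> n \<and> prime p. prime_weight 1 p)" for n
    by (rule sum.mono_neutral_cong_right) (auto simp: v_def)
  \<comment> \<open>The exponent exceeds 1, so that a discrepancy of \<open>1 / m\<close> is
    \<open>o(1 / ln n)\<close>, and is below 2, so that the available bounds still leave a weight of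
    about \<open>(1 - 3/4) * ln (ln n)\<close> between \<open>m\<close> and \<open>n\<close>. The
    added 2 gives \<open>m \<ge> 2\<close>, as \<open>v_le\<close> asks.\<close>
  define m where "m n = nat \<lfloor>ln (real n) powr (3/2)\<rfloor> + 2" for n :: nat
  have m: "ln (real n) powr (3/2) \<le> real (m n) - 1" "real (m n) \<le> ln (real n) powr (3/2) + 2" for n
  proof -
    have "ln (real n) powr (3/2) < real_of_int \<lfloor>ln (real n) powr (3/2)\<rfloor> + 1" by linarith
    moreover have "real_of_int \<lfloor>ln (real n) powr (3/2)\<rfloor> \<le> ln (real n) powr (3/2)" by (rule of_int_floor_le)
    moreover have "real (m n) = real_of_int \<lfloor>ln (real n) powr (3/2)\<rfloor> + 2" by (simp add: m_def)
    ultimately show "ln (real n) powr (3/2) \<le> real (m n) - 1" "real (m n) \<le> ln (real n) powr (3/2) + 2"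
      by linarith+
  qed
  have D: "\<forall>\<^sub>F n in sequentially. \<forall>i\<in>{1..h}. \<bar>load v h (Suc n) i - (\<Sum>k\<le>n. v k) / real h\<bar> \<le> 1 / ln (real n) powr (3/2)"
  proof -
    have "filterlim (\<lambda>n::nat. ln (ln (real n)) - (1 + ln (ln (real n) powr (3/2) + 2) / 2)) at_top sequentially"
      by real_asymp
    then have "\<forall>\<^sub>F n in sequentially. ln (ln (real n)) - (1 + ln (ln (real n) powr (3/2) + 2) / 2) > 2 * real h * 1"
      by (simp add: filterlim_at_top_dense)
    moreover have "\<forall>\<^sub>F n::nat in sequentially. ln (real n) powr (3/2) + 2 < real n" by real_asymp
    moreover have "\<forall>\<^sub>F n::nat in sequentially. n \<ge> 3" by (rule eventually_ge_at_top)
    ultimately show ?thesis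
    proof eventually_elim
      case (elim n)
      have mn: "m n \<le> Suc n" using elim m(2)[of n] by linarith
      have m2: "m n \<ge> 2" by (simp add: m_def)
      have l: "ln (real n) > 0" using elim by simp
      have "(\<Sum>k=m n..<Suc n. v k) = (\<Sum>k<Suc n. v k) - (\<Sum>k<m n. v k)"
        using mn sum.atLeastLessThan_concat[of 0 "m n" "Suc n" v] by (simp add: atLeast0LessThan)
      moreover have "(\<Sum>k<m n. v k) \<le> (\<Sum>k\<le>m n. v k)" using v_nonneg by (intro sum_mono2) auto
      moreover have "(\<Sum>k\<le>m n. v k) \<le> 1 + ln (real (m n)) / 2"
        unfolding v_sum using m2 by (intro sum_prime_weight_upper) simp
      moreover have "ln (real (m n)) \<le> ln (ln (real n) powr (3/2) + 2)"
        using m(2)[of n] m2 by (subst ln_le_cancel_iff) (auto intro: add_nonneg_pos)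
      moreover have "ln (ln (real n)) \<le> (\<Sum>k<Suc n. v k)"
        using sum_prime_weight_lower[of n] elim by (simp only: lessThan_Suc_atMost v_sum)
      ultimately have big: "(\<Sum>k=m n..<Suc n. v k) > 2 * real h * 1" using elim(1) by linarith
      have "\<bar>load v h (Suc n) i - (\<Sum>k<Suc n. v k) / real h\<bar> \<le> 1 / (real (m n) - 1)" if "i \<in> {1..h}" for i
      proof (rule load_minus_mean_le[OF v_nonneg assms _ that])
        show "load v h (Suc n) i - load v h (Suc n) j \<le> 1 / (real (m n) - 1)"
          if "i \<in> {1..h}" "j \<in> {1..h}" for i j
          using load_spread_late[OF v_nonneg assms v_le1 v_le mn big that] m2 by blast
      qed
      moreover have "1 / (real (m n) - 1) \<le> 1 / ln (real n) powr (3/2)"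
        using m(1)[of n] l m2 by (intro divide_left_mono mult_pos_pos) auto
      ultimately show ?case unfolding lessThan_Suc_atMost by (meson order_trans)
    qed
  qed
  show thesis
  proof (rule that[of P])
    show "\<exists>i\<in>{1..h}. p \<in> P i" if "prime p" for p
      using that greedy_class_in[OF v_nonneg assms] by (auto simp: P_def)
    show "prime p" if "p \<in> P i" for i p using that by (simp add: P_def)
    fix i assume i: "i \<in> {1..h}"
    \<comment> \<open>\<open>load\<close> counts items below its argument, hence
      \<open>Suc n\<close> for primes up to \<open>n\<close>.\<close>
    have eq: "(\<Sum>p | p \<le> n \<and> prime p. (of_bool (p \<in> P i) - 1 / real h) * prime_weight 1 p) =
        load v h (Suc n) i - (\<Sum>k\<le>n. v k) / real h" for n
    proof -
      have "(\<Sum>p | p \<le> n \<and> prime p. of_bool (p \<in> P i) * prime_weight 1 p) = load v h (Suc n) i"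
        unfolding load_eq_sum[OF v_nonneg assms] lessThan_Suc_atMost
        by (rule sum.mono_neutral_cong_left) (auto simp: v_prime v_nonprime P_def)
      then show ?thesis by (simp add: v_sum left_diff_distrib sum_subtractf sum_divide_distrib)
    qed
    have lim: "(\<lambda>n::nat. 1 / ln (real n) powr (3/2) * ln (real n)) \<longlonglongrightarrow> 0" by real_asymp
    show "(\<lambda>n. (\<Sum>p | p \<le> n \<and> prime p. (of_bool (p \<in> P i) - 1 / real h) * prime_weight 1 p) * ln (real n)) \<longlonglongrightarrow> 0"
      unfolding eq
    proof (rule Lim_null_comparison[OF _ lim])
      show "\<forall>\<^sub>F n in sequentially. norm ((load v h (Suc n) i - (\<Sum>k\<le>n. v k) / real h) * ln (real n)) \<le> 1 / ln (real n) powr (3/2) * ln (real n)"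
        using D eventually_ge_at_top[of 1]
      proof eventually_elim
        case (elim n)
        then have "\<bar>load v h (Suc n) i - (\<Sum>k\<le>n. v k) / real h\<bar> * ln (real n) \<le> 1 / ln (real n) powr (3/2) * ln (real n)"
          using i by (intro mult_right_mono) auto
        then show ?case using elim(2) by (simp add: abs_mult)
      qed
    qed
  qed
qed

section \<open>The optimal complement\<close>

lemma prod_in_gen: "(\<And>x. x \<in> S \<Longrightarrow> f x \<in> gen P) \<Longrightarrow> (\<Prod>x\<in>S. f x) \<in> gen P"
proof (induction S rule: infinite_finite_induct)
  case (insert x S)
  then have *: "f x \<in> gen P" "prod f S \<in> gen P" by auto
  then show ?case using insert.hyps gen_mult_iff[OF *[THEN gen_pos]] by simp
qed (simp_all add: gen_def)

lemma multiplicative_complement_gen: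
  assumes "\<And>p. prime p \<Longrightarrow> \<exists>i\<in>{1..h}. p \<in> P i"
  shows "multiplicative_complement h (\<lambda>i. gen (P i))"
  unfolding multiplicative_complement_def
proof (intro conjI ballI allI impI)
  show "gen (P i) \<subseteq> {0<..}" for i by (auto dest: gen_pos)
next
  fix n :: nat assume n: "n > 0"
  \<comment> \<open>The classes are only assumed to cover the primes, so \<open>f\<close> settles
    one class per prime and \<open>a i\<close> collects the prime powers of \<open>n\<close> sent to
    \<open>i\<close>.\<close>
  obtain f where f: "\<And>p. prime p \<Longrightarrow> f p \<in> {1..h} \<and> p \<in> P (f p)" using assms by metis
  define a where "a i = (\<Prod>p\<in>{p \<in> prime_factors n. f p = i}. p ^ multiplicity p n)" for i
  have "a i \<in> gen (P i)" for i
    unfolding a_def using f by (intro prod_in_gen prime_power_in_gen) auto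
  moreover have "(\<Prod>i=1..h. a i) = (\<Prod>p\<in>prime_factors n. p ^ multiplicity p n)"
    unfolding a_def using f by (intro prod.group) (auto simp: in_prime_factors_iff)
  then have "n = (\<Prod>i=1..h. a i)" using n prod_prime_factors[of n] by simp
  ultimately show "\<exists>a. (\<forall>i\<in>{1..h}. a i \<in> gen (P i)) \<and> n = (\<Prod>i=1..h. a i)" by blast
qed

text \<open>At each \<open>x\<close> the maximum is one of finitely many values, all of them near
  \<open>c\<close> simultaneously.\<close>

lemma tendsto_Max:
  fixes f :: "'i \<Rightarrow> 'a \<Rightarrow> nat" and g :: "'a \<Rightarrow> real"
  assumes "finite I" "I \<noteq> {}" and lim: "\<And>i. i \<in> I \<Longrightarrow> ((\<lambda>x. real (f i x) * g x) \<longlongrightarrow> c) F"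
  shows "((\<lambda>x. real (Max ((\<lambda>i. f i x) ` I)) * g x) \<longlongrightarrow> c) F"
proof (rule tendstoI)
  fix e :: real assume "e > 0"
  then have "\<forall>\<^sub>F x in F. \<forall>i\<in>I. dist (real (f i x) * g x) c < e"
    using assms by (intro eventually_ball_finite ballI tendstoD) auto
  then show "\<forall>\<^sub>F x in F. dist (real (Max ((\<lambda>i. f i x) ` I)) * g x) c < e"
  proof eventually_elim
    case (elim x)
    have "Max ((\<lambda>i. f i x) ` I) \<in> (\<lambda>i. f i x) ` I" using assms by (intro Max_in) auto
    then obtain i where "i \<in> I" "Max ((\<lambda>i. f i x) ` I) = f i x" by auto
    then show ?case using elim by simp
  qed
qed

lemma counting_function_gen:
  assumes "x \<ge> 0"
  shows "counting_function (gen P) x = card (gen P \<inter> {..nat \<lfloor>x\<rfloor>})"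
proof -
  have "{a \<in> gen P. real a \<le> x} = gen P \<inter> {..nat \<lfloor>x\<rfloor>}" using assms by (auto simp: le_nat_iff le_floor_iff)
  then show ?thesis by (simp add: counting_function_def)
qed

text \<open>The first factor is constant between integers; only the smooth factor changes, and its
  ratio at \<open>x\<close> and at the floor of \<open>x\<close> tends to 1.\<close>

lemma tendsto_nat_floor:
  fixes a :: "nat \<Rightarrow> real" and k c :: real
  assumes "(\<lambda>N. a N * (ln (real N) powr k / real N)) \<longlonglongrightarrow> c"
  shows "((\<lambda>x. a (nat \<lfloor>x\<rfloor>) * (ln x powr k / x)) \<longlongrightarrow> c) at_top"
proof -
  let ?N = "\<lambda>x::real. nat \<lfloor>x\<rfloor>"
  have "filterlim ?N at_top at_top"
    by (rule filterlim_nat_sequentially[THEN filterlim_compose]) (rule filterlim_floor_sequentially)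
  with assms have "((\<lambda>x. a (?N x) * (ln (real (?N x)) powr k / real (?N x))) \<longlongrightarrow> c) at_top"
    by (rule filterlim_compose)
  moreover have "((\<lambda>x. (ln x / ln (real_of_int \<lfloor>x\<rfloor>)) powr k * (real_of_int \<lfloor>x\<rfloor> / x)) \<longlongrightarrow> 1 powr k * 1) at_top"
  proof (intro tendsto_mult tendsto_powr tendsto_const)
    show "((\<lambda>x. ln x / ln (real_of_int \<lfloor>x\<rfloor>)) \<longlongrightarrow> 1) at_top" by real_asymp
    show "((\<lambda>x. real_of_int \<lfloor>x\<rfloor> / x) \<longlongrightarrow> 1) at_top" by real_asymp
  qed simp
  ultimately have "((\<lambda>x. a (?N x) * (ln (real (?N x)) powr k / real (?N x)) *
      ((ln x / ln (real_of_int \<lfloor>x\<rfloor>)) powr k * (real_of_int \<lfloor>x\<rfloor> / x))) \<longlongrightarrow> c * (1 powr k * 1)) at_top"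
    by (rule tendsto_mult)
  moreover have "\<forall>\<^sub>F x in at_top. a (?N x) * (ln (real (?N x)) powr k / real (?N x)) *
      ((ln x / ln (real_of_int \<lfloor>x\<rfloor>)) powr k * (real_of_int \<lfloor>x\<rfloor> / x)) = a (?N x) * (ln x powr k / x)"
    using eventually_ge_at_top[of 3]
  proof eventually_elim
    case (elim x)
    then have "\<lfloor>x\<rfloor> \<ge> 3" by (simp add: le_floor_iff)
    moreover define y where "y = real_of_int \<lfloor>x\<rfloor>"
    ultimately have y: "y \<ge> 3" "real (?N x) = y" by simp_all
    then have "ln y > 0" by simp
    then show ?case unfolding y(2) y_def[symmetric] using y(1) elim by (simp add: powr_divide)
  qed
  ultimately show ?thesis by (simp add: tendsto_cong)
qed

theorem exists_optimal_complement:
  assumes h: "h \<ge> 1"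
  shows "\<exists>A. multiplicative_complement h A \<and>
    ((\<lambda>x::real. real (max_counting h A x) * (ln x powr (1 - 1 / real h) / x)) \<longlongrightarrow> 1 / Gamma (1 / real h)) at_top"
proof -
  define k where "k = 1 / real h"
  have k: "0 < k" "k \<le> 1" using h by (auto simp: k_def)
  obtain P :: "nat \<Rightarrow> nat set"
    where cover: "\<And>p. prime p \<Longrightarrow> \<exists>i\<in>{1..h}. p \<in> P i" and P: "\<And>i p. p \<in> P i \<Longrightarrow> prime p"
      and bal: "\<And>i. i \<in> {1..h} \<Longrightarrow> (\<lambda>n. (\<Sum>p | p \<le> n \<and> prime p. (of_bool (p \<in> P i) - k) * prime_weight 1 p) * ln (real n)) \<longlonglongrightarrow> 0"
    unfolding k_def using exists_balanced_prime_classes[OF h] by blast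
  define A where "A i = gen (P i)" for i
  have lim: "(\<lambda>N. real (card (A i \<inter> {..N})) * (ln (real N) powr (1 - k) / real N)) \<longlonglongrightarrow> 1 / Gamma k"
    if i: "i \<in> {1..h}" for i
  proof -
    \<comment> \<open>The balance enters at two strengths: with the logarithm for the Chebyshev
      functions, and without it for the Dirichlet series.\<close>
    let ?D = "\<lambda>n. \<Sum>p | p \<le> n \<and> prime p. (of_bool (p \<in> P i) - k) * prime_weight 1 p"
    have inv: "(\<lambda>n::nat. 1 / ln (real n)) \<longlonglongrightarrow> 0" by real_asymp
    have "(\<lambda>n. ?D n * ln (real n) * (1 / ln (real n))) \<longlonglongrightarrow> 0"
      using tendsto_mult[OF bal[OF i] inv] by simp
    moreover have "\<forall>\<^sub>F n in sequentially. ?D n * ln (real n) * (1 / ln (real n)) = ?D n"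
      using eventually_ge_at_top[of 2] by eventually_elim simp
    ultimately have "?D \<longlonglongrightarrow> 0" by (rule Lim_transform_eventually)
    then have "(\<lambda>N. (\<Sum>n\<in>gen (P i) \<inter> {..N}. 1 / real n) / ln (real N) powr k) \<longlonglongrightarrow> 1 / Gamma (k + 1)"
      using k P by (intro reciprocal_sum_gen) auto
    then have "(\<lambda>N. real (card (A i \<inter> {..N})) * (ln (real N) powr (1 - k) / real N)) \<longlonglongrightarrow> k * (1 / Gamma (k + 1))"
      unfolding A_def using k P bal[OF i] by (intro card_gen_tendsto psi_gen_bound) auto
    also have "k * (1 / Gamma (k + 1)) = 1 / Gamma k"
      using k by (subst Gamma_plus1) auto
    finally show ?thesis .
  qed
  have "(\<lambda>N. real (Max ((\<lambda>i. card (A i \<inter> {..N})) ` {1..h})) * (ln (real N) powr (1 - k) / real N)) \<longlonglongrightarrow> 1 / Gamma k"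
    using h lim by (intro tendsto_Max) auto
  then have "((\<lambda>x. real (Max ((\<lambda>i. card (A i \<inter> {..nat \<lfloor>x\<rfloor>})) ` {1..h})) * (ln x powr (1 - k) / x)) \<longlongrightarrow> 1 / Gamma k) at_top"
    by (rule tendsto_nat_floor)
  moreover have "\<forall>\<^sub>F x in at_top. real (Max ((\<lambda>i. card (A i \<inter> {..nat \<lfloor>x\<rfloor>})) ` {1..h})) * (ln x powr (1 - k) / x) =
      real (max_counting h A x) * (ln x powr (1 - k) / x)"
    using eventually_ge_at_top[of 0]
    by eventually_elim (simp add: max_counting_def A_def counting_function_gen)
  ultimately have "((\<lambda>x. real (max_counting h A x) * (ln x powr (1 - k) / x)) \<longlongrightarrow> 1 / Gamma k) at_top"
    by (rule Lim_transform_eventually)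
  moreover have "multiplicative_complement h A"
    unfolding A_def using cover by (rule multiplicative_complement_gen)
  ultimately show ?thesis unfolding k_def by blast
qed

theorem corollary8:
  fixes h :: nat
  assumes "h \<ge> 1"
  shows "(\<forall>A. multiplicative_complement h A \<longrightarrow>
            Limsup at_top (\<lambda>x::real. ereal (real (max_counting h A x)
                 * (ln x powr (1 - 1 / real h) / x)))
              \<ge> ereal (1 / Gamma (1 / real h))) \<and>
         (\<exists>A. multiplicative_complement h A \<and>
            ((\<lambda>x::real. real (max_counting h A x)
                 * (ln x powr (1 - 1 / real h) / x))
              \<longlongrightarrow> 1 / Gamma (1 / real h)) at_top)"
  using limsup_max_counting_ge[OF assms] exists_optimal_complement[OF assms] by blast

end
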